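(* Let $k$ be a commutative ring, let $\mathcal{O}$ be an operad in the category $C(k)$ of complexes of $k$-modules, let $s$ be an integer, let $M=\mathrm{cone}(\mathrm{id}_k)[s]$ and let $n$ be a non-negative integer. Let $F(M,n)$ be the free operad generated by the complex $M$ of $n$-ary operations. Then the natural map of operads $$\mathcal{O}\to \mathcal{O}\coprod F(M,n)$$ (the canonical map into the coproduct in the category of operads in $C(k)$) is a componentwise quasi-isomorphism, provided that at least one of the following holds: (i) $\mathcal{O}(0)=0$ and $n>0$; (ii) $k\supseteq\mathbb{Q}$.
   Context: $C(k)$ denotes the symmetric monoidal category of (unbounded) complexes of $k$-modules with tensor product over $k$. An operad $\mathcal{O}$ in $C(k)$ is a symmetric operad with unit: it has components $\mathcal{O}(r)\in C(k)$ for all $r\ge 0$, with an action of the symmetric group $\Sigma_r$ on $\mathcal{O}(r)$, a unit and compositions. $\mathtt{Op}(C(k))$ denotes the category of such operads. $\mathrm{cone}(\mathrm{id}_k)[s]$ is the $s$-fold shift of the cone of the identity map of $k$, where $k$ is regarded as a complex concentrated in degree $0$. For $M\in C(k)$ and $n\ge 0$, $F(M,n)$ is the free operad generated by $M$ placed in arity $n$ as a complex of free $n$-ary operations (no symmetry relations imposed); i.e. it is characterized by $\mathrm{Hom}_{\mathtt{Op}(C(k))}(F(M,n),\mathcal{P})=\mathrm{Hom}_{C(k)}(M,\mathcal{P}(n))$, naturally in the operad $\mathcal{P}$. A map of operads $f:\mathcal{O}\to\mathcal{O}'$ is a componentwise quasi-isomorphism if $f(r):\mathcal{O}(r)\to\mathcal{O}'(r)$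 is a quasi-isomorphism of complexes for every $r\ge 0$. The condition $k\supseteq\mathbb{Q}$ means that $k$ contains $\mathbb{Q}$ as a subring. *)

theory Defs
  imports Complex_Main "HOL-Algebra.Module" "HOL-Algebra.AbelCoset" "HOL-Combinatorics.Permutations"
begin

section \<open>Complexes of modules\<close>

text \<open>
  Modules are those of \<^theory>\<open>HOL-Algebra.Module\<close>: the \<^const>\<open>monoid.mult\<close> and \<^const>\<open>one\<close> fields of a
  module record carry no information. Complexes are unbounded and cohomologically graded.
\<close>

record ('k, 'a) cochain_complex =
  obj :: "int \<Rightarrow> ('k, 'a) module"
  differential :: "int \<Rightarrow> 'a \<Rightarrow> 'a"

definition mod_hom ::
    "('k, 'm) ring_scheme \<Rightarrow> ('k, 'a) module \<Rightarrow> ('k, 'b) module \<Rightarrow> ('a \<Rightarrow> 'b) set" where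
  "mod_hom R M N =
    {f \<in> carrier M \<rightarrow> carrier N.
      (\<forall>x\<in>carrier M. \<forall>y\<in>carrier M. f (x \<oplus>\<^bsub>M\<^esub> y) = f x \<oplus>\<^bsub>N\<^esub> f y) \<and>
      (\<forall>c\<in>carrier R. \<forall>x\<in>carrier M. f (c \<odot>\<^bsub>M\<^esub> x) = c \<odot>\<^bsub>N\<^esub> f x)}"

locale cochain_complex =
  fixes R :: "'k ring" (structure) and C :: "('k, 'a) cochain_complex"
  assumes obj_module: "module R (obj C p)"
    and differential_hom: "differential C p \<in> mod_hom R (obj C p) (obj C (p + 1))"
    and differential_differential:
      "x \<in> carrier (obj C p) \<Longrightarrow>
        differential C (p + 1) (differential C p x) = \<zero>\<^bsub>obj C (p + 2)\<^esub>"

definition cochain_map ::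
    "'k ring \<Rightarrow> ('k, 'a) cochain_complex \<Rightarrow> ('k, 'b) cochain_complex \<Rightarrow>
      (int \<Rightarrow> 'a \<Rightarrow> 'b) \<Rightarrow> bool" where
  "cochain_map R C D f \<longleftrightarrow>
    (\<forall>p. f p \<in> mod_hom R (obj C p) (obj D p)) \<and>
    (\<forall>p. \<forall>x\<in>carrier (obj C p). f (p + 1) (differential C p x) = differential D p (f p x))"

definition cocycles :: "('k, 'a) cochain_complex \<Rightarrow> int \<Rightarrow> 'a set" where
  "cocycles C p = {x \<in> carrier (obj C p). differential C p x = \<zero>\<^bsub>obj C (p + 1)\<^esub>}"

definition coboundaries :: "('k, 'a) cochain_complex \<Rightarrow> int \<Rightarrow> 'a set" where
  "coboundaries C p = differential C (p - 1) ` carrier (obj C (p - 1))"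

definition cohomology :: "('k, 'a) cochain_complex \<Rightarrow> int \<Rightarrow> 'a set monoid" where
  "cohomology C p = (add_monoid (obj C p)) \<lparr>carrier := cocycles C p\<rparr> Mod coboundaries C p"

text \<open>
  The coset \<open>x + B\<^sup>p(C)\<close> is sent to \<open>f x + B\<^sup>p(D)\<close>. The induced map is automatically
  \<open>R\<close>-linear, so it is enough to ask for an isomorphism of the underlying groups.
\<close>

definition cohomology_map ::
    "('k, 'b) cochain_complex \<Rightarrow> (int \<Rightarrow> 'a \<Rightarrow> 'b) \<Rightarrow> int \<Rightarrow> 'a set \<Rightarrow> 'b set" where
  "cohomology_map D f p X = coboundaries D p <+>\<^bsub>obj D p\<^esub> (f p ` X)"

definition quasi_isomorphism ::
    "'k ring \<Rightarrow> ('k, 'a) cochain_complex \<Rightarrow> ('k, 'b) cochain_complex \<Rightarrow>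
      (int \<Rightarrow> 'a \<Rightarrow> 'b) \<Rightarrow> bool" where
  "quasi_isomorphism R C D f \<longleftrightarrow>
    cochain_map R C D f \<and>
    (\<forall>p. cohomology_map D f p \<in> iso (cohomology C p) (cohomology D p))"


subsection \<open>Shift, cone, and the base ring as a complex\<close>

definition koszul_sign :: "'k ring \<Rightarrow> int \<Rightarrow> 'k" where
  "koszul_sign R e = (if even e then \<one>\<^bsub>R\<^esub> else \<ominus>\<^bsub>R\<^esub> \<one>\<^bsub>R\<^esub>)"

definition ring_module :: "'k ring \<Rightarrow> ('k, 'k) module" where
  "ring_module R =
    \<lparr>carrier = carrier R, monoid.mult = monoid.mult R, one = one R, zero = zero R, add = add R, smult = monoid.mult R\<rparr>"

definition ring_complex :: "'k ring \<Rightarrow> ('k, 'k) cochain_complex" where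
  "ring_complex R =
    \<lparr>obj = (\<lambda>p. if p = 0 then ring_module R else (ring_module R) \<lparr>carrier := {\<zero>\<^bsub>R\<^esub>}\<rparr>),
     differential = (\<lambda>p x. \<zero>\<^bsub>R\<^esub>)\<rparr>"

definition shift ::
    "'k ring \<Rightarrow> ('k, 'a) cochain_complex \<Rightarrow> int \<Rightarrow> ('k, 'a) cochain_complex" where
  "shift R C s =
    \<lparr>obj = (\<lambda>p. obj C (p + s)),
     differential = (\<lambda>p x. koszul_sign R s \<odot>\<^bsub>obj C (p + s + 1)\<^esub> differential C (p + s) x)\<rparr>"

definition prod_module :: "('k, 'a) module \<Rightarrow> ('k, 'b) module \<Rightarrow> ('k, 'a \<times> 'b) module" where
  "prod_module M N =
    \<lparr>carrier = carrier M \<times> carrier N, monoid.mult = undefined, one = undefined,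
     zero = (\<zero>\<^bsub>M\<^esub>, \<zero>\<^bsub>N\<^esub>), add = (\<lambda>(x, y) (x', y'). (x \<oplus>\<^bsub>M\<^esub> x', y \<oplus>\<^bsub>N\<^esub> y')),
     smult = (\<lambda>c (x, y). (c \<odot>\<^bsub>M\<^esub> x, c \<odot>\<^bsub>N\<^esub> y))\<rparr>"

definition cone ::
    "('k, 'a) cochain_complex \<Rightarrow> ('k, 'b) cochain_complex \<Rightarrow> (int \<Rightarrow> 'a \<Rightarrow> 'b) \<Rightarrow>
      ('k, 'a \<times> 'b) cochain_complex" where
  "cone C D f =
    \<lparr>obj = (\<lambda>p. prod_module (obj C (p + 1)) (obj D p)),
     differential = (\<lambda>p (x, y).
       (\<ominus>\<^bsub>obj C (p + 2)\<^esub> differential C (p + 1) x,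
        f (p + 1) x \<oplus>\<^bsub>obj D (p + 1)\<^esub> differential D p y))\<rparr>"

definition contains_rationals :: "'k ring \<Rightarrow> bool" where
  "contains_rationals R \<longleftrightarrow>
    (\<exists>h \<in> ring_hom \<lparr>carrier = (UNIV :: rat set), monoid.mult = (*), one = 1, zero = 0, add = (+)\<rparr> R.
      inj h)"


section \<open>Symmetric operads\<close>

text \<open>
  Operads are given by partial compositions. Inputs of an operation of arity \<open>r\<close> are numbered
  \<open>0, \<dots>, r - 1\<close>. In \<open>pcomp P r i m p q x y\<close>, the operation \<open>y\<close> (arity \<open>m\<close>, degree \<open>q\<close>) is
  plugged into input \<open>i\<close> of \<open>x\<close> (arity \<open>r\<close>, degree \<open>p\<close>); \<open>sym_act P r p \<sigma> x\<close> is the right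
  action, input \<open>j\<close> of \<open>x \<cdot> \<sigma>\<close> being input \<open>\<sigma> j\<close> of \<open>x\<close>. All structure maps carry the arities
  and degrees of their arguments because different components may share elements of \<open>'a\<close>.
\<close>

record ('k, 'a) operad =
  component :: "nat \<Rightarrow> ('k, 'a) cochain_complex"
  sym_act :: "nat \<Rightarrow> int \<Rightarrow> (nat \<Rightarrow> nat) \<Rightarrow> 'a \<Rightarrow> 'a"
  op_unit :: 'a
  pcomp :: "nat \<Rightarrow> nat \<Rightarrow> nat \<Rightarrow> int \<Rightarrow> int \<Rightarrow> 'a \<Rightarrow> 'a \<Rightarrow> 'a"

abbreviation opobj :: "('k, 'a) operad \<Rightarrow> nat \<Rightarrow> int \<Rightarrow> ('k, 'a) module" where
  "opobj P r p \<equiv> obj (component P r) p"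

abbreviation opdiff :: "('k, 'a) operad \<Rightarrow> nat \<Rightarrow> int \<Rightarrow> 'a \<Rightarrow> 'a" where
  "opdiff P r p \<equiv> differential (component P r) p"

text \<open>
  The permutation \<open>\<rho>\<close> with \<open>(x \<cdot> \<sigma>) \<circ>\<^sub>i (y \<cdot> \<tau>) = (x \<circ>\<^bsub>\<sigma> i\<^esub> y) \<cdot> \<rho>\<close>, where \<open>y\<close> has arity \<open>m\<close> and
  \<open>x\<close> has arity \<open>r\<close>.
\<close>

definition comp_perm ::
    "nat \<Rightarrow> nat \<Rightarrow> nat \<Rightarrow> (nat \<Rightarrow> nat) \<Rightarrow> (nat \<Rightarrow> nat) \<Rightarrow> nat \<Rightarrow> nat" where
  "comp_perm r m i \<sigma> \<tau> j =
    (let place = (\<lambda>u. if u < \<sigma> i then u else u + m - 1)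
     in if j < i then place (\<sigma> j)
        else if j < i + m then \<sigma> i + \<tau> (j - i)
        else if j < r + m - 1 then place (\<sigma> (j + 1 - m))
        else j)"

locale operad =
  fixes R :: "'k ring" (structure) and P :: "('k, 'a) operad"
  assumes component_complex: "cochain_complex R (component P r)"
    and act_cochain_map:
      "\<sigma> permutes {..<r} \<Longrightarrow>
        cochain_map R (component P r) (component P r) (\<lambda>p. sym_act P r p \<sigma>)"
    and act_id: "x \<in> carrier (opobj P r p) \<Longrightarrow> sym_act P r p id x = x"
    and act_act:
      "\<lbrakk>\<sigma> permutes {..<r}; \<tau> permutes {..<r}; x \<in> carrier (opobj P r p)\<rbrakk> \<Longrightarrow>
        sym_act P r p \<tau> (sym_act P r p \<sigma> x) = sym_act P r p (\<sigma> \<circ> \<tau>) x"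
    and unit_closed: "op_unit P \<in> carrier (opobj P 1 0)"
    and unit_cocycle: "opdiff P 1 0 (op_unit P) = \<zero>\<^bsub>opobj P 1 1\<^esub>"
    and pcomp_hom_left:
      "\<lbrakk>i < r; y \<in> carrier (opobj P m q)\<rbrakk> \<Longrightarrow>
        (\<lambda>x. pcomp P r i m p q x y) \<in> mod_hom R (opobj P r p) (opobj P (r + m - 1) (p + q))"
    and pcomp_hom_right:
      "\<lbrakk>i < r; x \<in> carrier (opobj P r p)\<rbrakk> \<Longrightarrow>
        pcomp P r i m p q x \<in> mod_hom R (opobj P m q) (opobj P (r + m - 1) (p + q))"
    and pcomp_differential:
      "\<lbrakk>i < r; x \<in> carrier (opobj P r p); y \<in> carrier (opobj P m q)\<rbrakk> \<Longrightarrow>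
        opdiff P (r + m - 1) (p + q) (pcomp P r i m p q x y) =
          pcomp P r i m (p + 1) q (opdiff P r p x) y
          \<oplus>\<^bsub>opobj P (r + m - 1) (p + q + 1)\<^esub>
          koszul_sign R p \<odot>\<^bsub>opobj P (r + m - 1) (p + q + 1)\<^esub>
            pcomp P r i m p (q + 1) x (opdiff P m q y)"
    and pcomp_unit_left:
      "y \<in> carrier (opobj P m q) \<Longrightarrow> pcomp P 1 0 m 0 q (op_unit P) y = y"
    and pcomp_unit_right:
      "\<lbrakk>i < r; x \<in> carrier (opobj P r p)\<rbrakk> \<Longrightarrow> pcomp P r i 1 p 0 x (op_unit P) = x"
    and pcomp_assoc:
      "\<lbrakk>i < r; j < m; x \<in> carrier (opobj P r p); y \<in> carrier (opobj P m q);
        z \<in> carrier (opobj P l t)\<rbrakk> \<Longrightarrow>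
        pcomp P (r + m - 1) (i + j) l (p + q) t (pcomp P r i m p q x y) z =
        pcomp P r i (m + l - 1) p (q + t) x (pcomp P m j l q t y z)"
    and pcomp_parallel:
      "\<lbrakk>i < j; j < r; x \<in> carrier (opobj P r p); y \<in> carrier (opobj P m q);
        z \<in> carrier (opobj P l t)\<rbrakk> \<Longrightarrow>
        pcomp P (r + l - 1) i m (p + t) q (pcomp P r j l p t x z) y =
        koszul_sign R (q * t) \<odot>\<^bsub>opobj P (r + l - 1 + m - 1) (p + t + q)\<^esub>
          pcomp P (r + m - 1) (j + m - 1) l (p + q) t (pcomp P r i m p q x y) z"
    and pcomp_equivariant:
      "\<lbrakk>\<sigma> permutes {..<r}; \<tau> permutes {..<m}; i < r; x \<in> carrier (opobj P r p);
        y \<in> carrier (opobj P m q)\<rbrakk> \<Longrightarrow>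
        pcomp P r i m p q (sym_act P r p \<sigma> x) (sym_act P m q \<tau> y) =
        sym_act P (r + m - 1) (p + q) (comp_perm r m i \<sigma> \<tau>) (pcomp P r (\<sigma> i) m p q x y)"

definition operad_hom ::
    "'k ring \<Rightarrow> ('k, 'a) operad \<Rightarrow> ('k, 'b) operad \<Rightarrow> (nat \<Rightarrow> int \<Rightarrow> 'a \<Rightarrow> 'b) \<Rightarrow> bool" where
  "operad_hom R P Q f \<longleftrightarrow>
    (\<forall>r. cochain_map R (component P r) (component Q r) (f r)) \<and>
    (\<forall>r p \<sigma>. \<forall>x\<in>carrier (opobj P r p). \<sigma> permutes {..<r} \<longrightarrow>
      f r p (sym_act P r p \<sigma> x) = sym_act Q r p \<sigma> (f r p x)) \<and>
    f 1 0 (op_unit P) = op_unit Q \<and>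
    (\<forall>r i m p q. \<forall>x\<in>carrier (opobj P r p). \<forall>y\<in>carrier (opobj P m q). i < r \<longrightarrow>
      f (r + m - 1) (p + q) (pcomp P r i m p q x y) =
      pcomp Q r i m p q (f r p x) (f m q y))"

definition componentwise_quasi_isomorphism ::
    "'k ring \<Rightarrow> ('k, 'a) operad \<Rightarrow> ('k, 'b) operad \<Rightarrow> (nat \<Rightarrow> int \<Rightarrow> 'a \<Rightarrow> 'b) \<Rightarrow> bool" where
  "componentwise_quasi_isomorphism R P Q f \<longleftrightarrow>
    operad_hom R P Q f \<and> (\<forall>r. quasi_isomorphism R (component P r) (component Q r) (f r))"


section \<open>Operads presented by generators and relations\<close>

text \<open>
  Free operads and coproducts are both constructed as the operad generated by homogeneous
  operations \<open>G r p\<close> (arity \<open>r\<close>, degree \<open>p\<close>) subject to relations \<open>E\<close>: formal expressions modulo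
  the congruence generated by \<open>E\<close> and the operad axioms. Their universal properties are
  \<open>free_operad_universal\<close> and \<open>operad_coproduct_universal\<close> below; test operads there have an
  arbitrary element type.
\<close>

datatype ('k, 'g) opterm =
    TGen nat int 'g
  | TUnit
  | TZero nat int
  | TAdd "('k, 'g) opterm" "('k, 'g) opterm"
  | TScal 'k "('k, 'g) opterm"
  | TDiff "('k, 'g) opterm"
  | TAct "nat \<Rightarrow> nat" "('k, 'g) opterm"
  | TComp nat "('k, 'g) opterm" "('k, 'g) opterm"

primrec arity :: "('k, 'g) opterm \<Rightarrow> nat" where
  "arity (TGen r p g) = r"
| "arity TUnit = 1"
| "arity (TZero r p) = r"
| "arity (TAdd s t) = arity s"
| "arity (TScal c t) = arity t"
| "arity (TDiff t) = arity t"
| "arity (TAct \<sigma> t) = arity t"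
| "arity (TComp i s t) = arity s + arity t - 1"

primrec deg :: "('k, 'g) opterm \<Rightarrow> int" where
  "deg (TGen r p g) = p"
| "deg TUnit = 0"
| "deg (TZero r p) = p"
| "deg (TAdd s t) = deg s"
| "deg (TScal c t) = deg t"
| "deg (TDiff t) = deg t + 1"
| "deg (TAct \<sigma> t) = deg t"
| "deg (TComp i s t) = deg s + deg t"

primrec wf_term :: "'k ring \<Rightarrow> (nat \<Rightarrow> int \<Rightarrow> 'g set) \<Rightarrow> ('k, 'g) opterm \<Rightarrow> bool" where
  "wf_term R G (TGen r p g) \<longleftrightarrow> g \<in> G r p"
| "wf_term R G TUnit \<longleftrightarrow> True"
| "wf_term R G (TZero r p) \<longleftrightarrow> True"
| "wf_term R G (TAdd s t) \<longleftrightarrow>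
    wf_term R G s \<and> wf_term R G t \<and> arity s = arity t \<and> deg s = deg t"
| "wf_term R G (TScal c t) \<longleftrightarrow> c \<in> carrier R \<and> wf_term R G t"
| "wf_term R G (TDiff t) \<longleftrightarrow> wf_term R G t"
| "wf_term R G (TAct \<sigma> t) \<longleftrightarrow> \<sigma> permutes {..<arity t} \<and> wf_term R G t"
| "wf_term R G (TComp i s t) \<longleftrightarrow> i < arity s \<and> wf_term R G s \<and> wf_term R G t"

inductive term_eq ::
    "'k ring \<Rightarrow> (nat \<Rightarrow> int \<Rightarrow> 'g set) \<Rightarrow> (('k, 'g) opterm \<Rightarrow> ('k, 'g) opterm \<Rightarrow> bool) \<Rightarrow>
      ('k, 'g) opterm \<Rightarrow> ('k, 'g) opterm \<Rightarrow> bool"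
  for R (structure) and G and E where
  refl: "wf_term R G t \<Longrightarrow> term_eq R G E t t"
| sym: "term_eq R G E s t \<Longrightarrow> term_eq R G E t s"
| trans: "\<lbrakk>term_eq R G E s t; term_eq R G E t u\<rbrakk> \<Longrightarrow> term_eq R G E s u"
| relation:
    "\<lbrakk>E s t; wf_term R G s; wf_term R G t; arity s = arity t; deg s = deg t\<rbrakk> \<Longrightarrow>
      term_eq R G E s t"
| cong_add:
    "\<lbrakk>term_eq R G E s s'; term_eq R G E t t'; wf_term R G (TAdd s t)\<rbrakk> \<Longrightarrow>
      term_eq R G E (TAdd s t) (TAdd s' t')"
| cong_scal:
    "\<lbrakk>term_eq R G E t t'; c \<in> carrier R\<rbrakk> \<Longrightarrow> term_eq R G E (TScal c t) (TScal c t')"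
| cong_diff: "term_eq R G E t t' \<Longrightarrow> term_eq R G E (TDiff t) (TDiff t')"
| cong_act:
    "\<lbrakk>term_eq R G E t t'; \<sigma> permutes {..<arity t}\<rbrakk> \<Longrightarrow>
      term_eq R G E (TAct \<sigma> t) (TAct \<sigma> t')"
| cong_comp:
    "\<lbrakk>term_eq R G E s s'; term_eq R G E t t'; i < arity s\<rbrakk> \<Longrightarrow>
      term_eq R G E (TComp i s t) (TComp i s' t')"
| add_assoc:
    "wf_term R G (TAdd (TAdd s t) u) \<Longrightarrow>
      term_eq R G E (TAdd (TAdd s t) u) (TAdd s (TAdd t u))"
| add_comm: "wf_term R G (TAdd s t) \<Longrightarrow> term_eq R G E (TAdd s t) (TAdd t s)"
| add_zero: "wf_term R G t \<Longrightarrow> term_eq R G E (TAdd (TZero (arity t) (deg t)) t) t"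
| scal_add_left:
    "\<lbrakk>a \<in> carrier R; b \<in> carrier R; wf_term R G t\<rbrakk> \<Longrightarrow>
      term_eq R G E (TScal (a \<oplus> b) t) (TAdd (TScal a t) (TScal b t))"
| scal_add_right:
    "wf_term R G (TScal a (TAdd s t)) \<Longrightarrow>
      term_eq R G E (TScal a (TAdd s t)) (TAdd (TScal a s) (TScal a t))"
| scal_scal:
    "\<lbrakk>a \<in> carrier R; b \<in> carrier R; wf_term R G t\<rbrakk> \<Longrightarrow>
      term_eq R G E (TScal (a \<otimes> b) t) (TScal a (TScal b t))"
| scal_one: "wf_term R G t \<Longrightarrow> term_eq R G E (TScal \<one> t) t"
| scal_zero: "wf_term R G t \<Longrightarrow> term_eq R G E (TScal \<zero> t) (TZero (arity t) (deg t))"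
| diff_add:
    "wf_term R G (TAdd s t) \<Longrightarrow>
      term_eq R G E (TDiff (TAdd s t)) (TAdd (TDiff s) (TDiff t))"
| diff_scal:
    "wf_term R G (TScal a t) \<Longrightarrow> term_eq R G E (TDiff (TScal a t)) (TScal a (TDiff t))"
| diff_diff:
    "wf_term R G t \<Longrightarrow> term_eq R G E (TDiff (TDiff t)) (TZero (arity t) (deg t + 2))"
| act_add:
    "wf_term R G (TAct \<sigma> (TAdd s t)) \<Longrightarrow>
      term_eq R G E (TAct \<sigma> (TAdd s t)) (TAdd (TAct \<sigma> s) (TAct \<sigma> t))"
| act_scal:
    "wf_term R G (TAct \<sigma> (TScal a t)) \<Longrightarrow>
      term_eq R G E (TAct \<sigma> (TScal a t)) (TScal a (TAct \<sigma> t))"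
| act_diff:
    "wf_term R G (TAct \<sigma> (TDiff t)) \<Longrightarrow>
      term_eq R G E (TAct \<sigma> (TDiff t)) (TDiff (TAct \<sigma> t))"
| act_id: "wf_term R G t \<Longrightarrow> term_eq R G E (TAct id t) t"
| act_act:
    "wf_term R G (TAct \<tau> (TAct \<sigma> t)) \<Longrightarrow>
      term_eq R G E (TAct \<tau> (TAct \<sigma> t)) (TAct (\<sigma> \<circ> \<tau>) t)"
| unit_cocycle: "term_eq R G E (TDiff TUnit) (TZero 1 1)"
| comp_add_left:
    "wf_term R G (TComp i (TAdd s s') t) \<Longrightarrow>
      term_eq R G E (TComp i (TAdd s s') t) (TAdd (TComp i s t) (TComp i s' t))"
| comp_add_right:
    "wf_term R G (TComp i s (TAdd t t')) \<Longrightarrow>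
      term_eq R G E (TComp i s (TAdd t t')) (TAdd (TComp i s t) (TComp i s t'))"
| comp_scal_left:
    "wf_term R G (TComp i (TScal a s) t) \<Longrightarrow>
      term_eq R G E (TComp i (TScal a s) t) (TScal a (TComp i s t))"
| comp_scal_right:
    "wf_term R G (TComp i s (TScal a t)) \<Longrightarrow>
      term_eq R G E (TComp i s (TScal a t)) (TScal a (TComp i s t))"
| comp_diff:
    "wf_term R G (TComp i s t) \<Longrightarrow>
      term_eq R G E (TDiff (TComp i s t))
        (TAdd (TComp i (TDiff s) t) (TScal (koszul_sign R (deg s)) (TComp i s (TDiff t))))"
| comp_unit_left: "wf_term R G t \<Longrightarrow> term_eq R G E (TComp 0 TUnit t) t"
| comp_unit_right: "wf_term R G (TComp i t TUnit) \<Longrightarrow> term_eq R G E (TComp i t TUnit) t"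
| comp_assoc:
    "\<lbrakk>wf_term R G s; wf_term R G t; wf_term R G u; i < arity s; j < arity t\<rbrakk> \<Longrightarrow>
      term_eq R G E (TComp (i + j) (TComp i s t) u) (TComp i s (TComp j t u))"
| comp_parallel:
    "\<lbrakk>wf_term R G s; wf_term R G t; wf_term R G u; i < j; j < arity s\<rbrakk> \<Longrightarrow>
      term_eq R G E (TComp i (TComp j s u) t)
        (TScal (koszul_sign R (deg t * deg u)) (TComp (j + arity t - 1) (TComp i s t) u))"
| comp_equivariant:
    "wf_term R G (TComp i (TAct \<sigma> s) (TAct \<tau> t)) \<Longrightarrow>
      term_eq R G E (TComp i (TAct \<sigma> s) (TAct \<tau> t))
        (TAct (comp_perm (arity s) (arity t) i \<sigma> \<tau>) (TComp (\<sigma> i) s t))"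

definition term_class ::
    "'k ring \<Rightarrow> (nat \<Rightarrow> int \<Rightarrow> 'g set) \<Rightarrow> (('k, 'g) opterm \<Rightarrow> ('k, 'g) opterm \<Rightarrow> bool) \<Rightarrow>
      ('k, 'g) opterm \<Rightarrow> ('k, 'g) opterm set" where
  "term_class R G E t = {s. term_eq R G E t s}"

definition term_rep :: "('k, 'g) opterm set \<Rightarrow> ('k, 'g) opterm" where
  "term_rep X = (SOME t. t \<in> X)"

definition presented_operad ::
    "'k ring \<Rightarrow> (nat \<Rightarrow> int \<Rightarrow> 'g set) \<Rightarrow> (('k, 'g) opterm \<Rightarrow> ('k, 'g) opterm \<Rightarrow> bool) \<Rightarrow>
      ('k, ('k, 'g) opterm set) operad" where
  "presented_operad R G E =
    (let cls = term_class R G E in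
      \<lparr>component = (\<lambda>r.
         \<lparr>obj = (\<lambda>p.
            \<lparr>carrier = {cls t | t. wf_term R G t \<and> arity t = r \<and> deg t = p},
             monoid.mult = undefined, one = undefined,
             zero = cls (TZero r p),
             add = (\<lambda>X Y. cls (TAdd (term_rep X) (term_rep Y))),
             smult = (\<lambda>c X. cls (TScal c (term_rep X)))\<rparr>),
          differential = (\<lambda>p X. cls (TDiff (term_rep X)))\<rparr>),
       sym_act = (\<lambda>r p \<sigma> X. cls (TAct \<sigma> (term_rep X))),
       op_unit = cls TUnit,
       pcomp = (\<lambda>r i m p q X Y. cls (TComp i (term_rep X) (term_rep Y)))\<rparr>)"


subsection \<open>Free operads\<close>

inductive free_rel ::
    "'k ring \<Rightarrow> ('k, 'a) cochain_complex \<Rightarrow> nat \<Rightarrow> ('k, 'a) opterm \<Rightarrow> ('k, 'a) opterm \<Rightarrow> bool"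
  for R M n where
  "\<lbrakk>x \<in> carrier (obj M p); y \<in> carrier (obj M p)\<rbrakk> \<Longrightarrow>
    free_rel R M n (TGen n p (x \<oplus>\<^bsub>obj M p\<^esub> y)) (TAdd (TGen n p x) (TGen n p y))"
| "\<lbrakk>c \<in> carrier R; x \<in> carrier (obj M p)\<rbrakk> \<Longrightarrow>
    free_rel R M n (TGen n p (c \<odot>\<^bsub>obj M p\<^esub> x)) (TScal c (TGen n p x))"
| "x \<in> carrier (obj M p) \<Longrightarrow>
    free_rel R M n (TGen n (p + 1) (differential M p x)) (TDiff (TGen n p x))"

definition free_gens :: "('k, 'a) cochain_complex \<Rightarrow> nat \<Rightarrow> nat \<Rightarrow> int \<Rightarrow> 'a set" where
  "free_gens M n r p = (if r = n then carrier (obj M p) else {})"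

definition free_operad ::
    "'k ring \<Rightarrow> ('k, 'a) cochain_complex \<Rightarrow> nat \<Rightarrow> ('k, ('k, 'a) opterm set) operad" where
  "free_operad R M n = presented_operad R (free_gens M n) (free_rel R M n)"

definition free_in ::
    "'k ring \<Rightarrow> ('k, 'a) cochain_complex \<Rightarrow> nat \<Rightarrow> int \<Rightarrow> 'a \<Rightarrow> ('k, 'a) opterm set" where
  "free_in R M n p x = term_class R (free_gens M n) (free_rel R M n) (TGen n p x)"


subsection \<open>Coproducts of operads\<close>

text \<open>The relations saying that \<open>x \<mapsto> TGen r p (h x)\<close> is a map of operads on \<open>P\<close>.\<close>

inductive hom_rel ::
    "'k ring \<Rightarrow> ('k, 'a) operad \<Rightarrow> ('a \<Rightarrow> 'g) \<Rightarrow> ('k, 'g) opterm \<Rightarrow> ('k, 'g) opterm \<Rightarrow> bool"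
  for R P h where
  "\<lbrakk>x \<in> carrier (opobj P r p); y \<in> carrier (opobj P r p)\<rbrakk> \<Longrightarrow>
    hom_rel R P h (TGen r p (h (x \<oplus>\<^bsub>opobj P r p\<^esub> y))) (TAdd (TGen r p (h x)) (TGen r p (h y)))"
| "\<lbrakk>c \<in> carrier R; x \<in> carrier (opobj P r p)\<rbrakk> \<Longrightarrow>
    hom_rel R P h (TGen r p (h (c \<odot>\<^bsub>opobj P r p\<^esub> x))) (TScal c (TGen r p (h x)))"
| "x \<in> carrier (opobj P r p) \<Longrightarrow>
    hom_rel R P h (TGen r (p + 1) (h (opdiff P r p x))) (TDiff (TGen r p (h x)))"
| "\<lbrakk>\<sigma> permutes {..<r}; x \<in> carrier (opobj P r p)\<rbrakk> \<Longrightarrow>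
    hom_rel R P h (TGen r p (h (sym_act P r p \<sigma> x))) (TAct \<sigma> (TGen r p (h x)))"
| "hom_rel R P h (TGen 1 0 (h (op_unit P))) TUnit"
| "\<lbrakk>i < r; x \<in> carrier (opobj P r p); y \<in> carrier (opobj P m q)\<rbrakk> \<Longrightarrow>
    hom_rel R P h (TGen (r + m - 1) (p + q) (h (pcomp P r i m p q x y)))
      (TComp i (TGen r p (h x)) (TGen m q (h y)))"

definition coproduct_rel ::
    "'k ring \<Rightarrow> ('k, 'a) operad \<Rightarrow> ('k, 'b) operad \<Rightarrow>
      ('k, 'a + 'b) opterm \<Rightarrow> ('k, 'a + 'b) opterm \<Rightarrow> bool" where
  "coproduct_rel R P Q s t \<longleftrightarrow> hom_rel R P Inl s t \<or> hom_rel R Q Inr s t"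

definition coproduct_gens ::
    "('k, 'a) operad \<Rightarrow> ('k, 'b) operad \<Rightarrow> nat \<Rightarrow> int \<Rightarrow> ('a + 'b) set" where
  "coproduct_gens P Q r p = Inl ` carrier (opobj P r p) \<union> Inr ` carrier (opobj Q r p)"

definition operad_coproduct ::
    "'k ring \<Rightarrow> ('k, 'a) operad \<Rightarrow> ('k, 'b) operad \<Rightarrow> ('k, ('k, 'a + 'b) opterm set) operad" where
  "operad_coproduct R P Q = presented_operad R (coproduct_gens P Q) (coproduct_rel R P Q)"

definition coproduct_inl ::
    "'k ring \<Rightarrow> ('k, 'a) operad \<Rightarrow> ('k, 'b) operad \<Rightarrow>
      nat \<Rightarrow> int \<Rightarrow> 'a \<Rightarrow> ('k, 'a + 'b) opterm set" where
  "coproduct_inl R P Q r p x =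
    term_class R (coproduct_gens P Q) (coproduct_rel R P Q) (TGen r p (Inl x))"

definition coproduct_inr ::
    "'k ring \<Rightarrow> ('k, 'a) operad \<Rightarrow> ('k, 'b) operad \<Rightarrow>
      nat \<Rightarrow> int \<Rightarrow> 'b \<Rightarrow> ('k, 'a + 'b) opterm set" where
  "coproduct_inr R P Q r p y =
    term_class R (coproduct_gens P Q) (coproduct_rel R P Q) (TGen r p (Inr y))"


section \<open>Universal properties\<close>

lemma comp_perm_permutes:
  assumes s: "\<sigma> permutes {..<r}" and t: "\<tau> permutes {..<m}" and i: "i < r"
  shows "comp_perm r m i \<sigma> \<tau> permutes {..<r + m - 1}"
proof (rule bij_imp_permutes)
  let ?f = "comp_perm r m i \<sigma> \<tau>"
  have si: "\<sigma> j < r" if "j < r" for j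
    using permutes_in_image[OF s, of j] that by simp
  have ti: "\<tau> j < m" if "j < m" for j
    using permutes_in_image[OF t, of j] that by simp
  have sinj: "\<sigma> a = \<sigma> b \<Longrightarrow> a = b" for a b
    using permutes_inj[OF s] by (auto dest: injD)
  have tinj: "\<tau> a = \<tau> b \<Longrightarrow> a = b" for a b
    using permutes_inj[OF t] by (auto dest: injD)
  have into: "?f j < r + m - 1" if "j < r + m - 1" for j
  proof -
    consider "j < i" | "i \<le> j" "j < i + m" | "i + m \<le> j" by linarith
    then show ?thesis
    proof cases
      case 1
      have "\<sigma> j \<noteq> \<sigma> i" using sinj[of j i] 1 by auto
      then show ?thesis using 1 i si[of j] si[of i] by (auto simp: comp_perm_def Let_def)
    next
      case 2
      then have "\<sigma> i < r" "\<tau> (j - i) < m" using i si[of i] ti[of "j - i"] by auto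
      then show ?thesis using 2 i by (simp add: comp_perm_def Let_def)
    next
      case 3
      have "\<sigma> (j + 1 - m) \<noteq> \<sigma> i" using sinj[of "j + 1 - m" i] 3 by auto
      moreover have "\<sigma> (j + 1 - m) < r" using 3 i that si[of "j + 1 - m"] by simp
      ultimately show ?thesis using 3 i that si[of i]
        by (auto simp: comp_perm_def Let_def)
    qed
  qed
  define pl where "pl = (\<lambda>u. if u < \<sigma> i then u else u + m - 1)"
  have pl_inj: "u = v" if "pl u = pl v" "u \<noteq> \<sigma> i" "v \<noteq> \<sigma> i" for u v
    using that unfolding pl_def by (auto split: if_splits)
  have pl_out: "pl u \<noteq> \<sigma> i + \<tau> k" if "u \<noteq> \<sigma> i" "k < m" for u k
    using that ti[of k] unfolding pl_def by (auto split: if_splits)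
  define z where "z = (\<lambda>j. if j < i then j else j + 1 - m)"
  define mid where "mid = (\<lambda>j. i \<le> j \<and> j < i + m)"
  have f_mid: "?f j = \<sigma> i + \<tau> (j - i)" if "mid j" for j
    using that by (simp add: comp_perm_def mid_def)
  have f_out: "?f j = pl (\<sigma> (z j))" if "\<not> mid j" "j < r + m - 1" for j
    using that by (auto simp: comp_perm_def pl_def z_def mid_def Let_def)
  have z_ne: "\<sigma> (z j) \<noteq> \<sigma> i" if "\<not> mid j" for j
  proof
    assume "\<sigma> (z j) = \<sigma> i"
    then have "z j = i" by (rule sinj)
    then show False using that by (auto simp: z_def mid_def split: if_splits)
  qed
  have z_inj: "a = b" if "\<not> mid a" "\<not> mid b" "z a = z b" for a b
    using that by (auto simp: z_def mid_def split: if_splits)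
  have inj: "inj_on ?f {..<r + m - 1}"
  proof (rule inj_onI)
    fix a b assume a: "a \<in> {..<r + m - 1}" and b: "b \<in> {..<r + m - 1}" and eq: "?f a = ?f b"
    show "a = b"
    proof (cases "mid a"; cases "mid b")
      assume m: "mid a" "mid b"
      then have "\<tau> (a - i) = \<tau> (b - i)" using eq f_mid by simp
      then have "a - i = b - i" by (rule tinj)
      then show ?thesis using m eq_diff_iff[of i a b] by (simp add: mid_def)
    next
      assume m: "mid a" "\<not> mid b"
      have "pl (\<sigma> (z b)) \<noteq> \<sigma> i + \<tau> (a - i)"
        using m by (intro pl_out z_ne) (auto simp: mid_def)
      then show ?thesis using eq f_mid[OF m(1)] f_out[OF m(2)] b by simp
    next
      assume m: "\<not> mid a" "mid b"
      have "pl (\<sigma> (z a)) \<noteq> \<sigma> i + \<tau> (b - i)"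
        using m by (intro pl_out z_ne) (auto simp: mid_def)
      then show ?thesis using eq f_mid[OF m(2)] f_out[OF m(1)] a by simp
    next
      assume m: "\<not> mid a" "\<not> mid b"
      then have "pl (\<sigma> (z a)) = pl (\<sigma> (z b))" using eq f_out a b by simp
      then have "\<sigma> (z a) = \<sigma> (z b)" using pl_inj z_ne m by blast
      then show ?thesis using sinj z_inj m by blast
    qed
  qed
  have sub: "?f ` {..<r + m - 1} \<subseteq> {..<r + m - 1}" using into by auto
  show "bij_betw ?f {..<r + m - 1} {..<r + m - 1}"
    using inj endo_inj_surj[OF _ sub inj] by (simp add: bij_betw_def)
  show "?f x = x" if "x \<notin> {..<r + m - 1}" for x
    using that i by (auto simp: comp_perm_def Let_def)
qed

lemma koszul_sign_closed: "cring R \<Longrightarrow> koszul_sign R e \<in> carrier R"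
  by (simp add: koszul_sign_def cring.cring_simprules)

lemma term_eq_wf:
  assumes "term_eq R G E s t" and "cring R"
  shows "wf_term R G s \<and> wf_term R G t \<and> arity s = arity t \<and> deg s = deg t"
  using assms(1)
proof induction
  case (comp_equivariant i \<sigma> s \<tau> t)
  then have p: "\<sigma> permutes {..<arity s}" "\<tau> permutes {..<arity t}" "i < arity s" by auto
  then show ?case using comp_equivariant comp_perm_permutes[OF p] permutes_in_image[OF p(1), of i]
    by auto
next
  case (comp_parallel s t u i j)
  then show ?case by (auto simp: koszul_sign_closed[OF assms(2)])
qed (auto simp: koszul_sign_closed[OF assms(2)] cring.cring_simprules[OF assms(2)] permutes_compose
        permutes_id)


subsection \<open>The presented operad is an operad\<close>

locale presentation =
  fixes R :: "'k ring" (structure) and G :: "nat \<Rightarrow> int \<Rightarrow> 'g set"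
    and E :: "('k, 'g) opterm \<Rightarrow> ('k, 'g) opterm \<Rightarrow> bool"
  assumes cring: "cring R"
begin

abbreviation "cls \<equiv> term_class R G E"
abbreviation "wft \<equiv> wf_term R G"
abbreviation "PO \<equiv> presented_operad R G E"

lemma cls_eq: "term_eq R G E s t \<Longrightarrow> cls s = cls t"
  unfolding term_class_def by (blast intro: term_eq.sym term_eq.trans)

lemma cls_eqD: "cls s = cls t \<Longrightarrow> wft t \<Longrightarrow> term_eq R G E s t"
  unfolding term_class_def by (blast intro: term_eq.refl)

lemma rep: "wft t \<Longrightarrow> term_eq R G E t (term_rep (cls t))"
  unfolding term_rep_def by (rule someI2[of _ t]) (auto simp: term_class_def intro: term_eq.refl)

lemma rep': "wft t \<Longrightarrow> term_eq R G E (term_rep (cls t)) t"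
  by (rule term_eq.sym[OF rep])

lemma rep_wf:
  assumes "wft t"
  shows "wft (term_rep (cls t))" "arity (term_rep (cls t)) = arity t" "deg (term_rep (cls t)) = deg t"
  using term_eq_wf[OF rep[OF assms] cring] by auto

lemma carrier_PO: "carrier (opobj PO r p) = {cls t | t. wft t \<and> arity t = r \<and> deg t = p}"
  by (simp add: presented_operad_def Let_def)

lemma cls_carrier: "wft t \<Longrightarrow> arity t = r \<Longrightarrow> deg t = p \<Longrightarrow> cls t \<in> carrier (opobj PO r p)"
  by (auto simp: carrier_PO)

lemma carrierE:
  assumes "x \<in> carrier (opobj PO r p)"
  obtains t where "x = cls t" "wft t" "arity t = r" "deg t = p"
  using assms by (auto simp: carrier_PO)

lemma zero_PO: "\<zero>\<^bsub>opobj PO r p\<^esub> = cls (TZero r p)"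
  by (simp add: presented_operad_def Let_def)

lemma unit_PO: "op_unit PO = cls TUnit"
  by (simp add: presented_operad_def Let_def)

lemma add_PO:
  assumes "wft s" "wft t" "arity s = arity t" "deg s = deg t"
  shows "cls s \<oplus>\<^bsub>opobj PO r p\<^esub> cls t = cls (TAdd s t)"
  using assms by (auto simp: presented_operad_def Let_def rep_wf del: equalityI intro!: cls_eq term_eq.cong_add rep')

lemma smult_PO:
  assumes "c \<in> carrier R" "wft t"
  shows "c \<odot>\<^bsub>opobj PO r p\<^esub> cls t = cls (TScal c t)"
  using assms by (auto simp: presented_operad_def Let_def rep_wf del: equalityI intro!: cls_eq term_eq.cong_scal rep')

lemma diff_PO: "wft t \<Longrightarrow> opdiff PO r p (cls t) = cls (TDiff t)"
  by (auto simp: presented_operad_def Let_def rep_wf del: equalityI intro!: cls_eq term_eq.cong_diff rep')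

lemma act_PO:
  "wft t \<Longrightarrow> \<sigma> permutes {..<arity t} \<Longrightarrow> sym_act PO r p \<sigma> (cls t) = cls (TAct \<sigma> t)"
  by (auto simp: presented_operad_def Let_def rep_wf del: equalityI intro!: cls_eq term_eq.cong_act rep')

lemma pcomp_PO:
  "wft s \<Longrightarrow> wft t \<Longrightarrow> i < arity s \<Longrightarrow> pcomp PO r i m p q (cls s) (cls t) = cls (TComp i s t)"
  by (auto simp: presented_operad_def Let_def rep_wf del: equalityI intro!: cls_eq term_eq.cong_comp rep')

lemmas ops_PO = zero_PO unit_PO add_PO smult_PO diff_PO act_PO pcomp_PO

lemma module_PO: "module R (opobj PO r p)"
proof (rule moduleI[OF cring])
  interpret cring R by (rule cring)
  show "abelian_group (opobj PO r p)"
  proof (rule abelian_groupI)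
    fix x y assume "x \<in> carrier (opobj PO r p)" "y \<in> carrier (opobj PO r p)"
    then obtain s t where st: "x = cls s" "wft s" "arity s = r" "deg s = p"
      "y = cls t" "wft t" "arity t = r" "deg t = p" by (auto elim!: carrierE)
    then show "x \<oplus>\<^bsub>opobj PO r p\<^esub> y \<in> carrier (opobj PO r p)"
      by (auto simp: ops_PO intro!: cls_carrier)
    from st show "x \<oplus>\<^bsub>opobj PO r p\<^esub> y = y \<oplus>\<^bsub>opobj PO r p\<^esub> x"
      by (auto simp: ops_PO del: equalityI intro!: cls_eq term_eq.add_comm)
  next
    fix x y z assume "x \<in> carrier (opobj PO r p)" "y \<in> carrier (opobj PO r p)"
      "z \<in> carrier (opobj PO r p)"
    then obtain s t u where "x = cls s" "wft s" "arity s = r" "deg s = p"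
      "y = cls t" "wft t" "arity t = r" "deg t = p" "z = cls u" "wft u" "arity u = r" "deg u = p"
      by (auto elim!: carrierE)
    then show "x \<oplus>\<^bsub>opobj PO r p\<^esub> y \<oplus>\<^bsub>opobj PO r p\<^esub> z = x \<oplus>\<^bsub>opobj PO r p\<^esub> (y \<oplus>\<^bsub>opobj PO r p\<^esub> z)"
      by (simp add: ops_PO cls_eq[OF term_eq.add_assoc])
  next
    show "\<zero>\<^bsub>opobj PO r p\<^esub> \<in> carrier (opobj PO r p)"
      by (auto simp: ops_PO intro!: cls_carrier)
  next
    fix x assume "x \<in> carrier (opobj PO r p)"
    then obtain t where t: "x = cls t" "wft t" "arity t = r" "deg t = p" by (auto elim!: carrierE)
    show "\<zero>\<^bsub>opobj PO r p\<^esub> \<oplus>\<^bsub>opobj PO r p\<^esub> x = x"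
      using t term_eq.add_zero[of R G t E] by (auto simp: ops_PO del: equalityI intro!: cls_eq)
    have "term_eq R G E (TAdd (TScal (\<ominus> \<one>) t) t) (TAdd (TScal (\<ominus> \<one>) t) (TScal \<one> t))"
      using t by (intro term_eq.cong_add term_eq.refl term_eq.sym[OF term_eq.scal_one]) auto
    also have "term_eq R G E \<dots> (TScal (\<ominus> \<one> \<oplus> \<one>) t)"
      using t by (intro term_eq.sym[OF term_eq.scal_add_left]) auto
    also (term_eq.trans) have "\<ominus> \<one> \<oplus> \<one> = \<zero>" by (simp add: l_neg)
    also have "term_eq R G E (TScal \<zero> t) (TZero r p)"
      using t term_eq.scal_zero[of R G t E] by auto
    finally (term_eq.trans) have "cls (TScal (\<ominus> \<one>) t) \<oplus>\<^bsub>opobj PO r p\<^esub> x = \<zero>\<^bsub>opobj PO r p\<^esub>"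
      using t by (auto simp: ops_PO del: equalityI intro!: cls_eq)
    moreover have "cls (TScal (\<ominus> \<one>) t) \<in> carrier (opobj PO r p)"
      using t by (intro cls_carrier) auto
    ultimately show "\<exists>y\<in>carrier (opobj PO r p). y \<oplus>\<^bsub>opobj PO r p\<^esub> x = \<zero>\<^bsub>opobj PO r p\<^esub>"
      by blast
  qed
qed (auto elim!: carrierE simp: ops_PO cring.cring_simprules[OF cring]
      del: equalityI intro!: cls_carrier cls_eq term_eq.scal_add_left
        term_eq.scal_add_right term_eq.scal_scal term_eq.scal_one)

lemma complex_PO: "cochain_complex R (component PO r)"
proof (rule cochain_complex.intro)
  show "module R (opobj PO r p)" for p by (rule module_PO)
  show "opdiff PO r p \<in> mod_hom R (opobj PO r p) (opobj PO r (p + 1))" for p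
    by (auto simp: mod_hom_def ops_PO elim!: carrierE
        del: equalityI intro!: cls_carrier cls_eq term_eq.diff_add term_eq.diff_scal)
  show "opdiff PO r (p + 1) (opdiff PO r p x) = \<zero>\<^bsub>opobj PO r (p + 2)\<^esub>"
    if "x \<in> carrier (opobj PO r p)" for p x
    using that by (auto simp: ops_PO elim!: carrierE del: equalityI intro!: cls_eq term_eq.diff_diff)
qed

theorem operad_PO: "operad R PO"
proof (rule operad.intro)
  show "cochain_complex R (component PO r)" for r by (rule complex_PO)
  show "cochain_map R (component PO r) (component PO r) (\<lambda>p. sym_act PO r p \<sigma>)"
    if "\<sigma> permutes {..<r}" for \<sigma> r
    using that by (auto simp: cochain_map_def mod_hom_def ops_PO elim!: carrierE
        del: equalityI intro!: cls_carrier cls_eq term_eq.act_add term_eq.act_scal term_eq.act_diff)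
  show "sym_act PO r p id x = x" if "x \<in> carrier (opobj PO r p)" for r p x
    using that by (auto simp: ops_PO permutes_id elim!: carrierE del: equalityI intro!: cls_eq term_eq.act_id)
  show "sym_act PO r p \<tau> (sym_act PO r p \<sigma> x) = sym_act PO r p (\<sigma> \<circ> \<tau>) x"
    if "\<sigma> permutes {..<r}" "\<tau> permutes {..<r}" "x \<in> carrier (opobj PO r p)" for \<sigma> \<tau> r p x
    using that by (auto simp: ops_PO permutes_compose elim!: carrierE
        del: equalityI intro!: cls_eq term_eq.act_act)
  show "op_unit PO \<in> carrier (opobj PO 1 0)"
    by (auto simp: ops_PO intro!: cls_carrier)
  show "opdiff PO 1 0 (op_unit PO) = \<zero>\<^bsub>opobj PO 1 1\<^esub>"
    by (auto simp: ops_PO del: equalityI intro!: cls_eq term_eq.unit_cocycle[simplified])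
  show "(\<lambda>x. pcomp PO r i m p q x y) \<in> mod_hom R (opobj PO r p) (opobj PO (r + m - 1) (p + q))"
    if "i < r" "y \<in> carrier (opobj PO m q)" for i r y m p q
    using that by (auto simp: mod_hom_def ops_PO elim!: carrierE
        del: equalityI intro!: cls_carrier cls_eq term_eq.comp_add_left term_eq.comp_scal_left)
  show "pcomp PO r i m p q x \<in> mod_hom R (opobj PO m q) (opobj PO (r + m - 1) (p + q))"
    if "i < r" "x \<in> carrier (opobj PO r p)" for i r x m p q
    using that by (auto simp: mod_hom_def ops_PO elim!: carrierE
        del: equalityI intro!: cls_carrier cls_eq term_eq.comp_add_right term_eq.comp_scal_right)
  show "opdiff PO (r + m - 1) (p + q) (pcomp PO r i m p q x y) =
          pcomp PO r i m (p + 1) q (opdiff PO r p x) y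
          \<oplus>\<^bsub>opobj PO (r + m - 1) (p + q + 1)\<^esub>
          koszul_sign R p \<odot>\<^bsub>opobj PO (r + m - 1) (p + q + 1)\<^esub>
            pcomp PO r i m p (q + 1) x (opdiff PO m q y)"
    if "i < r" "x \<in> carrier (opobj PO r p)" "y \<in> carrier (opobj PO m q)" for i r x y m p q
    using that by (auto simp: ops_PO koszul_sign_closed[OF cring] elim!: carrierE
        del: equalityI intro!: cls_eq term_eq.comp_diff)
  show "pcomp PO 1 0 m 0 q (op_unit PO) y = y" if "y \<in> carrier (opobj PO m q)" for m q y
    using that by (auto simp: ops_PO elim!: carrierE del: equalityI intro!: cls_eq term_eq.comp_unit_left)
  show "pcomp PO r i 1 p 0 x (op_unit PO) = x" if "i < r" "x \<in> carrier (opobj PO r p)" for i r p x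
    using that by (auto simp: ops_PO elim!: carrierE del: equalityI intro!: cls_eq term_eq.comp_unit_right)
  show "pcomp PO (r + m - 1) (i + j) l (p + q) t (pcomp PO r i m p q x y) z =
        pcomp PO r i (m + l - 1) p (q + t) x (pcomp PO m j l q t y z)"
    if "i < r" "j < m" "x \<in> carrier (opobj PO r p)" "y \<in> carrier (opobj PO m q)"
      "z \<in> carrier (opobj PO l t)" for i r j m x p y q z l t
    using that by (auto simp: ops_PO elim!: carrierE del: equalityI intro!: cls_eq term_eq.comp_assoc)
  show "pcomp PO (r + l - 1) i m (p + t) q (pcomp PO r j l p t x z) y =
        koszul_sign R (q * t) \<odot>\<^bsub>opobj PO (r + l - 1 + m - 1) (p + t + q)\<^esub>
          pcomp PO (r + m - 1) (j + m - 1) l (p + q) t (pcomp PO r i m p q x y) z"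
    if "i < j" "j < r" "x \<in> carrier (opobj PO r p)" "y \<in> carrier (opobj PO m q)"
      "z \<in> carrier (opobj PO l t)" for i r j m x p y q z l t
  proof -
    from that obtain a b c where "x = cls a" "wft a" "arity a = r" "deg a = p"
      "y = cls b" "wft b" "arity b = m" "deg b = q" "z = cls c" "wft c" "arity c = l" "deg c = t"
      by (auto elim!: carrierE)
    then show ?thesis
      using that(1,2) cls_eq[OF term_eq.comp_parallel[of R G a b c i j E]]
      by (simp add: ops_PO koszul_sign_closed[OF cring])
  qed
  show "pcomp PO r i m p q (sym_act PO r p \<sigma> x) (sym_act PO m q \<tau> y) =
        sym_act PO (r + m - 1) (p + q) (comp_perm r m i \<sigma> \<tau>) (pcomp PO r (\<sigma> i) m p q x y)"
    if "\<sigma> permutes {..<r}" "\<tau> permutes {..<m}" "i < r" "x \<in> carrier (opobj PO r p)"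
      "y \<in> carrier (opobj PO m q)" for \<sigma> r \<tau> m i p q x y
  proof -
    from that obtain a b where "x = cls a" "wft a" "arity a = r" "deg a = p"
      "y = cls b" "wft b" "arity b = m" "deg b = q"
      by (auto elim!: carrierE)
    moreover have "\<sigma> i < r" using permutes_in_image[OF that(1), of i] that(3) by simp
    ultimately show ?thesis
      using that(1-3) comp_perm_permutes[OF that(1-3)]
        cls_eq[OF term_eq.comp_equivariant[of R G i \<sigma> a \<tau> b E]]
      by (simp add: ops_PO)
  qed
qed

end

lemma mod_homD:
  assumes "f \<in> mod_hom R M N"
  shows "x \<in> carrier M \<Longrightarrow> f x \<in> carrier N"
    and "\<lbrakk>x \<in> carrier M; y \<in> carrier M\<rbrakk> \<Longrightarrow> f (x \<oplus>\<^bsub>M\<^esub> y) = f x \<oplus>\<^bsub>N\<^esub> f y"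
    and "\<lbrakk>c \<in> carrier R; x \<in> carrier M\<rbrakk> \<Longrightarrow> f (c \<odot>\<^bsub>M\<^esub> x) = c \<odot>\<^bsub>N\<^esub> f x"
  using assms by (auto simp: mod_hom_def)

lemma mod_hom_zero:
  assumes "f \<in> mod_hom R M N" "module R M" "module R N"
  shows "f \<zero>\<^bsub>M\<^esub> = \<zero>\<^bsub>N\<^esub>"
proof -
  interpret M: module R M by fact
  interpret N: module R N by fact
  have "f (\<zero>\<^bsub>R\<^esub> \<odot>\<^bsub>M\<^esub> \<zero>\<^bsub>M\<^esub>) = \<zero>\<^bsub>R\<^esub> \<odot>\<^bsub>N\<^esub> f \<zero>\<^bsub>M\<^esub>"
    by (rule mod_homD(3)[OF assms(1)]) auto
  then show ?thesis using mod_homD(1)[OF assms(1), of "\<zero>\<^bsub>M\<^esub>"] by simp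
qed

lemma mod_hom_neg:
  assumes "h \<in> mod_hom R A B" "module R A" "module R B" "w \<in> carrier A"
  shows "h (\<ominus>\<^bsub>A\<^esub> w) = \<ominus>\<^bsub>B\<^esub> h w"
proof -
  interpret A: module R A by fact
  interpret B: module R B by fact
  have "h w \<oplus>\<^bsub>B\<^esub> h (\<ominus>\<^bsub>A\<^esub> w) = h (w \<oplus>\<^bsub>A\<^esub> \<ominus>\<^bsub>A\<^esub> w)"
    using mod_homD(2)[OF assms(1)] assms(4) by simp
  also have "\<dots> = \<zero>\<^bsub>B\<^esub>" using assms mod_hom_zero[OF assms(1-3)] by (simp add: A.M.r_neg)
  finally show ?thesis using assms mod_homD(1)[OF assms(1)]
    by (metis A.M.a_inv_closed B.M.a_comm B.M.minus_equality)
qed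

context operad
begin

lemma opobj_module: "module R (opobj P r p)"
  using component_complex cochain_complex.obj_module by blast

lemma R_cring: "cring R"
  using opobj_module module.axioms(1) by blast

lemmas opdiff_hom = cochain_complex.differential_hom[OF component_complex]

lemma act_hom: "\<sigma> permutes {..<r} \<Longrightarrow> sym_act P r p \<sigma> \<in> mod_hom R (opobj P r p) (opobj P r p)"
  using act_cochain_map by (simp add: cochain_map_def)

lemma act_opdiff:
  "\<sigma> permutes {..<r} \<Longrightarrow> x \<in> carrier (opobj P r p) \<Longrightarrow>
    sym_act P r (p + 1) \<sigma> (opdiff P r p x) = opdiff P r p (sym_act P r p \<sigma> x)"
  using act_cochain_map by (simp add: cochain_map_def)

lemmas opdiff_simps = mod_homD[OF opdiff_hom]
lemmas act_simps = mod_homD[OF act_hom]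
lemmas pcomp_left_simps = mod_homD[OF pcomp_hom_left]
lemmas pcomp_right_simps = mod_homD[OF pcomp_hom_right]
lemmas opdiff_opdiff = cochain_complex.differential_differential[OF component_complex]

end


subsection \<open>The universal property of a presentation\<close>

primrec eval_term ::
    "('k, 'c) operad \<Rightarrow> (nat \<Rightarrow> int \<Rightarrow> 'g \<Rightarrow> 'c) \<Rightarrow> ('k, 'g) opterm \<Rightarrow> 'c" where
  "eval_term Q \<phi> (TGen r p g) = \<phi> r p g"
| "eval_term Q \<phi> TUnit = op_unit Q"
| "eval_term Q \<phi> (TZero r p) = \<zero>\<^bsub>opobj Q r p\<^esub>"
| "eval_term Q \<phi> (TAdd s t) = eval_term Q \<phi> s \<oplus>\<^bsub>opobj Q (arity s) (deg s)\<^esub> eval_term Q \<phi> t"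
| "eval_term Q \<phi> (TScal c t) = c \<odot>\<^bsub>opobj Q (arity t) (deg t)\<^esub> eval_term Q \<phi> t"
| "eval_term Q \<phi> (TDiff t) = opdiff Q (arity t) (deg t) (eval_term Q \<phi> t)"
| "eval_term Q \<phi> (TAct \<sigma> t) = sym_act Q (arity t) (deg t) \<sigma> (eval_term Q \<phi> t)"
| "eval_term Q \<phi> (TComp i s t) =
    pcomp Q (arity s) i (arity t) (deg s) (deg t) (eval_term Q \<phi> s) (eval_term Q \<phi> t)"

locale presentation_model = presentation R G E + Q: operad R Q
  for R :: "'k ring" (structure) and G :: "nat \<Rightarrow> int \<Rightarrow> 'g set" and E and Q :: "('k, 'c) operad" +
  fixes \<phi> :: "nat \<Rightarrow> int \<Rightarrow> 'g \<Rightarrow> 'c"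
  assumes gen_closed: "g \<in> G r p \<Longrightarrow> \<phi> r p g \<in> carrier (opobj Q r p)"
    and gen_rel:
      "\<lbrakk>E s t; wft s; wft t; arity s = arity t; deg s = deg t\<rbrakk> \<Longrightarrow>
        eval_term Q \<phi> s = eval_term Q \<phi> t"
begin

abbreviation "ev \<equiv> eval_term Q \<phi>"

lemma ev_closed: "wft t \<Longrightarrow> ev t \<in> carrier (opobj Q (arity t) (deg t))"
proof (induction t)
  case (TZero r p)
  interpret M: module R "opobj Q r p" by (rule Q.opobj_module)
  show ?case by simp
next
  case (TAdd s t)
  interpret M: module R "opobj Q (arity t) (deg t)" by (rule Q.opobj_module)
  show ?case using TAdd by auto
next
  case (TScal c t)
  interpret M: module R "opobj Q (arity t) (deg t)" by (rule Q.opobj_module)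
  show ?case using TScal by auto
qed (use gen_closed Q.unit_closed Q.opdiff_simps(1) Q.act_simps(1) Q.pcomp_left_simps(1) in auto)

lemma ev_eq: "term_eq R G E s t \<Longrightarrow> ev s = ev t"
proof (induction rule: term_eq.induct)
  case (cong_add s s' t t')
  then show ?case using term_eq_wf[OF cong_add(1) cring] by simp
next
  case (cong_scal t t' c)
  then show ?case using term_eq_wf[OF cong_scal(1) cring] by simp
next
  case (cong_diff t t')
  then show ?case using term_eq_wf[OF cong_diff(1) cring] by simp
next
  case (cong_act t t' \<sigma>)
  then show ?case using term_eq_wf[OF cong_act(1) cring] by simp
next
  case (cong_comp s s' t t' i)
  then show ?case using term_eq_wf[OF cong_comp(1) cring] term_eq_wf[OF cong_comp(2) cring] by simp
next
  case (add_assoc s t u)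
  interpret M: module R "opobj Q (arity s) (deg s)" by (rule Q.opobj_module)
  have "ev s \<in> carrier (opobj Q (arity s) (deg s))" "ev t \<in> carrier (opobj Q (arity s) (deg s))"
    "ev u \<in> carrier (opobj Q (arity s) (deg s))"
    using add_assoc ev_closed[of s] ev_closed[of t] ev_closed[of u] by auto
  from M.a_assoc[OF this] show ?case using add_assoc by simp
next
  case (add_comm s t)
  interpret M: module R "opobj Q (arity t) (deg t)" by (rule Q.opobj_module)
  show ?case using add_comm ev_closed[of s] ev_closed[of t] by (simp add: M.a_comm)
next
  case (add_zero t)
  interpret M: module R "opobj Q (arity t) (deg t)" by (rule Q.opobj_module)
  show ?case using add_zero ev_closed[of t] by simp
next
  case (scal_add_left a b t)
  interpret M: module R "opobj Q (arity t) (deg t)" by (rule Q.opobj_module)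
  show ?case using scal_add_left ev_closed[of t] by (simp add: M.smult_l_distr)
next
  case (scal_add_right a s t)
  interpret M: module R "opobj Q (arity t) (deg t)" by (rule Q.opobj_module)
  show ?case using scal_add_right ev_closed[of s] ev_closed[of t] by (simp add: M.smult_r_distr)
next
  case (scal_scal a b t)
  interpret M: module R "opobj Q (arity t) (deg t)" by (rule Q.opobj_module)
  show ?case using scal_scal ev_closed[of t] by (simp add: M.smult_assoc1)
next
  case (scal_one t)
  interpret M: module R "opobj Q (arity t) (deg t)" by (rule Q.opobj_module)
  show ?case using scal_one ev_closed[of t] by simp
next
  case (scal_zero t)
  interpret M: module R "opobj Q (arity t) (deg t)" by (rule Q.opobj_module)
  show ?case using scal_zero ev_closed[of t] by simp
next
  case (diff_add s t)
  then show ?case using ev_closed[of s] ev_closed[of t] by (simp add: Q.opdiff_simps)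
next
  case (diff_scal a t)
  then show ?case using ev_closed[of t] by (simp add: Q.opdiff_simps)
next
  case (diff_diff t)
  then show ?case using ev_closed[of t] by (simp add: Q.opdiff_opdiff)
next
  case (act_add \<sigma> s t)
  then show ?case using ev_closed[of s] ev_closed[of t] by (auto simp: Q.act_simps)
next
  case (act_scal \<sigma> a t)
  then show ?case using ev_closed[of t] by (simp add: Q.act_simps)
next
  case (act_diff \<sigma> t)
  then show ?case using ev_closed[of t] by (simp add: Q.act_opdiff)
next
  case (act_id t)
  then show ?case using ev_closed[of t] by (simp add: Q.act_id)
next
  case (act_act \<tau> \<sigma> t)
  then show ?case using ev_closed[of t] by (simp add: Q.act_act)
next
  case unit_cocycle
  show ?case using Q.unit_cocycle by simp
next
  case (comp_add_left i s s' t)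
  then show ?case using ev_closed[of s] ev_closed[of s'] ev_closed[of t]
    by (simp add: Q.pcomp_left_simps(2))
next
  case (comp_add_right i s t t')
  then show ?case using ev_closed[of s] ev_closed[of t'] ev_closed[of t]
    by (simp add: Q.pcomp_right_simps(2))
next
  case (comp_scal_left i a s t)
  then show ?case using ev_closed[of s] ev_closed[of t] by (simp add: Q.pcomp_left_simps(3))
next
  case (comp_scal_right i s a t)
  then show ?case using ev_closed[of s] ev_closed[of t] by (simp add: Q.pcomp_right_simps(3))
next
  case (comp_diff i s t)
  then show ?case
    using Q.pcomp_differential[of i "arity s" "ev s" "deg s" "ev t" "arity t" "deg t"]
      ev_closed[of s] ev_closed[of t] by (simp add: algebra_simps)
next
  case (comp_unit_left t)
  then show ?case using ev_closed[of t] Q.pcomp_unit_left[of "ev t" "arity t" "deg t"] by simp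
next
  case (comp_unit_right i t)
  then show ?case using ev_closed[of t] Q.pcomp_unit_right[of i "arity t" "ev t" "deg t"] by simp
next
  case (comp_assoc s t u i j)
  then show ?case using ev_closed[of s] ev_closed[of t] ev_closed[of u]
      Q.pcomp_assoc[of i "arity s" j "arity t" "ev s" "deg s" "ev t" "deg t" "ev u" "arity u" "deg u"]
    by simp
next
  case (comp_parallel s t u i j)
  have eqs: "arity s + arity u - 1 + arity t - 1 = arity s + arity t - 1 + arity u - 1"
    "deg s + deg u + deg t = deg s + deg t + deg u" using comp_parallel by auto
  show ?case using comp_parallel ev_closed[of s] ev_closed[of t] ev_closed[of u]
      Q.pcomp_parallel[of i j "arity s" "ev s" "deg s" "ev t" "arity t" "deg t" "ev u" "arity u" "deg u"]
    unfolding eqs by simp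
next
  case (comp_equivariant i \<sigma> s \<tau> t)
  then show ?case using ev_closed[of s] ev_closed[of t]
      Q.pcomp_equivariant[of \<sigma> "arity s" \<tau> "arity t" i "ev s" "deg s" "ev t" "deg t"]
    by simp
qed (simp_all add: gen_rel)

definition ev_class :: "nat \<Rightarrow> int \<Rightarrow> ('k, 'g) opterm set \<Rightarrow> 'c" where
  "ev_class r p X = ev (term_rep X)"

lemma ev_class_cls: "wft t \<Longrightarrow> ev_class r p (cls t) = ev t"
  unfolding ev_class_def by (rule ev_eq[OF rep'])

lemma ev_class_hom: "operad_hom R PO Q ev_class"
  unfolding operad_hom_def cochain_map_def mod_hom_def
  by (auto elim!: carrierE simp: ops_PO ev_class_cls ev_closed)

end

context presentation
begin

lemma presented_unique:
  assumes "operad R Q" and f: "operad_hom R PO Q f" and g: "operad_hom R PO Q g"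
    and gens: "\<And>r p x. x \<in> G r p \<Longrightarrow> f r p (cls (TGen r p x)) = g r p (cls (TGen r p x))"
    and X: "X \<in> carrier (opobj PO r p)"
  shows "f r p X = g r p X"
proof -
  interpret Q: operad R Q by fact
  have hom: "h r p \<in> mod_hom R (opobj PO r p) (opobj Q r p)" if "operad_hom R PO Q h" for h r p
    using that by (simp add: operad_hom_def cochain_map_def)
  have *: "f (arity t) (deg t) (cls t) = g (arity t) (deg t) (cls t)" if "wft t" for t
    using that
  proof (induction t)
    case (TGen r p x)
    then show ?case using gens by simp
  next
    case TUnit
    then show ?case using f g by (simp add: operad_hom_def ops_PO)
  next
    case (TZero r p)
    then show ?case
      using mod_hom_zero[OF hom[OF f] module_PO Q.opobj_module]
        mod_hom_zero[OF hom[OF g] module_PO Q.opobj_module] by (simp add: ops_PO)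
  next
    case (TAdd s t)
    have "cls s \<in> carrier (opobj PO (arity s) (deg s))" "cls t \<in> carrier (opobj PO (arity s) (deg s))"
      using TAdd.prems by (auto intro!: cls_carrier)
    from mod_homD(2)[OF hom[OF f] this] mod_homD(2)[OF hom[OF g] this]
    show ?case using TAdd by (simp add: ops_PO)
  next
    case (TScal c t)
    have "c \<in> carrier R" "cls t \<in> carrier (opobj PO (arity t) (deg t))"
      using TScal.prems by (auto intro!: cls_carrier)
    from mod_homD(3)[OF hom[OF f] this] mod_homD(3)[OF hom[OF g] this]
    show ?case using TScal by (simp add: ops_PO)
  next
    case (TDiff t)
    have "cls t \<in> carrier (opobj PO (arity t) (deg t))"
      using TDiff.prems by (auto intro!: cls_carrier)
    then have "h (arity t) (deg t + 1) (opdiff PO (arity t) (deg t) (cls t)) =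
        opdiff Q (arity t) (deg t) (h (arity t) (deg t) (cls t))" if "operad_hom R PO Q h" for h
      using that by (simp add: operad_hom_def cochain_map_def)
    from this[OF f] this[OF g] show ?case using TDiff by (simp add: ops_PO)
  next
    case (TAct \<sigma> t)
    have "cls t \<in> carrier (opobj PO (arity t) (deg t))"
      using TAct.prems by (auto intro!: cls_carrier)
    then have "h (arity t) (deg t) (sym_act PO (arity t) (deg t) \<sigma> (cls t)) =
        sym_act Q (arity t) (deg t) \<sigma> (h (arity t) (deg t) (cls t))"
      if "operad_hom R PO Q h" for h
      using that TAct.prems by (simp add: operad_hom_def)
    from this[OF f] this[OF g] show ?case using TAct by (simp add: ops_PO)
  next
    case (TComp i s t)
    have "cls s \<in> carrier (opobj PO (arity s) (deg s))" "cls t \<in> carrier (opobj PO (arity t) (deg t))"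
      using TComp.prems by (auto intro!: cls_carrier)
    then have "h (arity s + arity t - 1) (deg s + deg t)
          (pcomp PO (arity s) i (arity t) (deg s) (deg t) (cls s) (cls t)) =
        pcomp Q (arity s) i (arity t) (deg s) (deg t)
          (h (arity s) (deg s) (cls s)) (h (arity t) (deg t) (cls t))"
      if "operad_hom R PO Q h" for h
      using that TComp.prems by (simp add: operad_hom_def)
    from this[OF f] this[OF g] show ?case using TComp by (simp add: ops_PO)
  qed
  show ?thesis using X * by (auto elim!: carrierE)
qed

end


subsection \<open>The universal property of free operads\<close>

lemma operad_free_operad: "cring R \<Longrightarrow> operad R (free_operad R M n)"
  unfolding free_operad_def by (intro presentation.operad_PO presentation.intro)

lemma free_in_cochain_map:
  assumes "cochain_complex R M"
  shows "cochain_map R M (component (free_operad R M n) n) (free_in R M n)"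
proof -
  interpret cochain_complex R M by fact
  have cr: "cring R" using obj_module module.axioms(1) by blast
  interpret presentation R "free_gens M n" "free_rel R M n" by (rule presentation.intro) (rule cr)
  have fg[simp]: "free_gens M n n p = carrier (obj M p)" for p by (simp add: free_gens_def)
  have add[simp]: "x \<oplus>\<^bsub>obj M p\<^esub> y \<in> carrier (obj M p)"
    if "x \<in> carrier (obj M p)" "y \<in> carrier (obj M p)" for x y p
  proof -
    interpret M: module R "obj M p" by (rule obj_module)
    show ?thesis using that by auto
  qed
  have smult[simp]: "c \<odot>\<^bsub>obj M p\<^esub> x \<in> carrier (obj M p)"
    if "x \<in> carrier (obj M p)" "c \<in> carrier R" for x p c
    using module.smult_closed[OF obj_module] that by blast
  have d[simp]: "x \<in> carrier (obj M p) \<Longrightarrow> differential M p x \<in> carrier (obj M (p + 1))" for x p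
    using mod_homD(1)[OF differential_hom] by blast
  show ?thesis
    unfolding cochain_map_def mod_hom_def free_in_def free_operad_def
    by (auto simp: ops_PO del: equalityI
        intro!: cls_carrier cls_eq term_eq.relation free_rel.intros)
qed

theorem free_operad_universal:
  fixes Q :: "('k, 'c) operad"
  assumes M: "cochain_complex R M" and Q: "operad R Q"
    and u: "cochain_map R M (component Q n) u"
  shows "\<exists>f. operad_hom R (free_operad R M n) Q f \<and>
    (\<forall>p. \<forall>x\<in>carrier (obj M p). f n p (free_in R M n p x) = u p x) \<and>
    (\<forall>g. operad_hom R (free_operad R M n) Q g \<and>
        (\<forall>p. \<forall>x\<in>carrier (obj M p). g n p (free_in R M n p x) = u p x) \<longrightarrow>
      (\<forall>r p. \<forall>z\<in>carrier (opobj (free_operad R M n) r p). g r p z = f r p z))"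
proof -
  interpret Q: operad R Q by fact
  interpret P: presentation R "free_gens M n" "free_rel R M n" by (rule presentation.intro) (rule Q.R_cring)
  interpret m: presentation_model R "free_gens M n" "free_rel R M n" Q "\<lambda>r. u"
  proof (intro presentation_model.intro presentation.intro presentation_model_axioms.intro)
    show "cring R" "operad R Q" by (rule Q.R_cring, rule Q)
    show "u p g \<in> carrier (opobj Q r p)" if "g \<in> free_gens M n r p" for g r p
      using that u by (auto simp: free_gens_def cochain_map_def mod_hom_def split: if_splits)
    show "eval_term Q (\<lambda>r. u) s = eval_term Q (\<lambda>r. u) t" if "free_rel R M n s t" for s t
      using that u by cases (auto simp: cochain_map_def mod_hom_def)
  qed
  have on_gens: "m.ev_class n p (free_in R M n p x) = u p x" if "x \<in> carrier (obj M p)" for p x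
    using that by (simp add: free_in_def m.ev_class_cls free_gens_def)
  have "g r p z = m.ev_class r p z"
    if "operad_hom R (free_operad R M n) Q g"
      "\<forall>p. \<forall>x\<in>carrier (obj M p). g n p (free_in R M n p x) = u p x"
      "z \<in> carrier (opobj (free_operad R M n) r p)" for g r p z
  proof (rule P.presented_unique[OF Q])
    show "g r p (P.cls (TGen r p x)) = m.ev_class r p (P.cls (TGen r p x))"
      if "x \<in> free_gens M n r p" for r p x
      using that \<open>\<forall>p. \<forall>x\<in>carrier (obj M p). g n p (free_in R M n p x) = u p x\<close> on_gens
      by (auto simp: free_gens_def free_in_def split: if_splits)
  qed (use that m.ev_class_hom in \<open>auto simp: free_operad_def\<close>)
  then show ?thesis
    using m.ev_class_hom on_gens unfolding free_operad_def by blast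
qed


subsection \<open>The universal property of coproducts\<close>

lemma operad_operad_coproduct: "cring R \<Longrightarrow> operad R (operad_coproduct R P Q)"
  unfolding operad_coproduct_def by (intro presentation.operad_PO presentation.intro)

context operad
begin

lemma closed_facts:
  "\<lbrakk>x \<in> carrier (opobj P r p); y \<in> carrier (opobj P r p)\<rbrakk> \<Longrightarrow>
    x \<oplus>\<^bsub>opobj P r p\<^esub> y \<in> carrier (opobj P r p)"
  "\<lbrakk>c \<in> carrier R; x \<in> carrier (opobj P r p)\<rbrakk> \<Longrightarrow> c \<odot>\<^bsub>opobj P r p\<^esub> x \<in> carrier (opobj P r p)"
proof -
  interpret M: module R "opobj P r p" by (rule opobj_module)
  show "\<lbrakk>x \<in> carrier (opobj P r p); y \<in> carrier (opobj P r p)\<rbrakk> \<Longrightarrow>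
      x \<oplus>\<^bsub>opobj P r p\<^esub> y \<in> carrier (opobj P r p)"
    "\<lbrakk>c \<in> carrier R; x \<in> carrier (opobj P r p)\<rbrakk> \<Longrightarrow> c \<odot>\<^bsub>opobj P r p\<^esub> x \<in> carrier (opobj P r p)"
    by auto
qed

lemma hom_rel_operad_hom:
  assumes "\<And>r p x. x \<in> carrier (opobj P r p) \<Longrightarrow> h x \<in> G r p"
    and "\<And>s t. hom_rel R P h s t \<Longrightarrow> E s t"
  shows "operad_hom R P (presented_operad R G E) (\<lambda>r p x. term_class R G E (TGen r p (h x)))"
proof -
  interpret PR: presentation R G E by (rule presentation.intro) (rule R_cring)
  show ?thesis
    unfolding operad_hom_def cochain_map_def mod_hom_def
    using assms(1) closed_facts unit_closed opdiff_simps(1) act_simps(1) pcomp_left_simps(1)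
    by (auto simp: PR.ops_PO del: equalityI
        intro!: PR.cls_carrier PR.cls_eq term_eq.relation assms(2) hom_rel.intros[simplified] hom_rel.intros)
qed

lemma eval_hom_rel:
  assumes "operad_hom R P Q f" and "hom_rel R P h s t"
    and "\<And>r p x. \<phi> r p (h x) = f r p x"
  shows "eval_term Q \<phi> s = eval_term Q \<phi> t"
  using assms(2,1) by cases (auto simp: operad_hom_def cochain_map_def mod_hom_def assms(3))

end

lemma coproduct_inl_hom:
  assumes "operad R P"
  shows "operad_hom R P (operad_coproduct R P Q) (coproduct_inl R P Q)"
  using operad.hom_rel_operad_hom[OF assms, of Inl "coproduct_gens P Q" "coproduct_rel R P Q"]
  unfolding operad_coproduct_def coproduct_inl_def[abs_def] coproduct_gens_def coproduct_rel_def
  by auto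

lemma coproduct_inr_hom:
  assumes "operad R Q"
  shows "operad_hom R Q (operad_coproduct R P Q) (coproduct_inr R P Q)"
  using operad.hom_rel_operad_hom[OF assms, of Inr "coproduct_gens P Q" "coproduct_rel R P Q"]
  unfolding operad_coproduct_def coproduct_inr_def[abs_def] coproduct_gens_def coproduct_rel_def
  by auto

theorem operad_coproduct_universal:
  fixes T :: "('k, 'c) operad"
  assumes P: "operad R P" and Q: "operad R Q" and T: "operad R T"
    and u: "operad_hom R P T u" and v: "operad_hom R Q T v"
  shows "\<exists>f. operad_hom R (operad_coproduct R P Q) T f \<and>
    (\<forall>r p. \<forall>x\<in>carrier (opobj P r p). f r p (coproduct_inl R P Q r p x) = u r p x) \<and>
    (\<forall>r p. \<forall>y\<in>carrier (opobj Q r p). f r p (coproduct_inr R P Q r p y) = v r p y) \<and>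
    (\<forall>g. operad_hom R (operad_coproduct R P Q) T g \<and>
        (\<forall>r p. \<forall>x\<in>carrier (opobj P r p). g r p (coproduct_inl R P Q r p x) = u r p x) \<and>
        (\<forall>r p. \<forall>y\<in>carrier (opobj Q r p). g r p (coproduct_inr R P Q r p y) = v r p y) \<longrightarrow>
      (\<forall>r p. \<forall>z\<in>carrier (opobj (operad_coproduct R P Q) r p). g r p z = f r p z))"
proof -
  interpret T: operad R T by fact
  let ?G = "coproduct_gens P Q" and ?E = "coproduct_rel R P Q"
  have uh: "u r p \<in> mod_hom R (opobj P r p) (opobj T r p)" for r p
    using u by (simp add: operad_hom_def cochain_map_def)
  have vh: "v r p \<in> mod_hom R (opobj Q r p) (opobj T r p)" for r p
    using v by (simp add: operad_hom_def cochain_map_def)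
  let ?\<phi> = "\<lambda>r p. case_sum (u r p) (v r p)"
  interpret PR: presentation R ?G ?E by (rule presentation.intro) (rule T.R_cring)
  interpret m: presentation_model R ?G ?E T ?\<phi>
  proof (intro presentation_model.intro presentation.intro presentation_model_axioms.intro)
    show "cring R" "operad R T" by (rule T.R_cring, rule T)
    show "?\<phi> r p g \<in> carrier (opobj T r p)" if "g \<in> coproduct_gens P Q r p" for g r p
      using that mod_homD(1)[OF uh] mod_homD(1)[OF vh] by (auto simp: coproduct_gens_def)
    show "eval_term T ?\<phi> s = eval_term T ?\<phi> t" if "coproduct_rel R P Q s t" for s t
      using that operad.eval_hom_rel[OF P u, of Inl s t ?\<phi>] operad.eval_hom_rel[OF Q v, of Inr s t ?\<phi>]
      by (auto simp: coproduct_rel_def)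
  qed
  have inl: "m.ev_class r p (coproduct_inl R P Q r p x) = u r p x"
    if "x \<in> carrier (opobj P r p)" for r p x
    using that by (simp add: coproduct_inl_def m.ev_class_cls coproduct_gens_def)
  have inr: "m.ev_class r p (coproduct_inr R P Q r p y) = v r p y"
    if "y \<in> carrier (opobj Q r p)" for r p y
    using that by (simp add: coproduct_inr_def m.ev_class_cls coproduct_gens_def)
  have "g r p z = m.ev_class r p z"
    if "operad_hom R (operad_coproduct R P Q) T g"
      and l: "\<forall>r p. \<forall>x\<in>carrier (opobj P r p). g r p (coproduct_inl R P Q r p x) = u r p x"
      and r: "\<forall>r p. \<forall>y\<in>carrier (opobj Q r p). g r p (coproduct_inr R P Q r p y) = v r p y"
      and "z \<in> carrier (opobj (operad_coproduct R P Q) r p)" for g r p z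
  proof (rule PR.presented_unique[OF T])
    show "g r p (PR.cls (TGen r p x)) = m.ev_class r p (PR.cls (TGen r p x))"
      if "x \<in> coproduct_gens P Q r p" for r p x
      using that l r inl inr
      by (auto simp: coproduct_gens_def coproduct_inl_def coproduct_inr_def)
  qed (use that m.ev_class_hom in \<open>auto simp: operad_coproduct_def\<close>)
  then show ?thesis
    using m.ev_class_hom inl inr unfolding operad_coproduct_def by blast
qed

subsection \<open>The complex \<open>cone(id\<^sub>k)[s]\<close>\<close>

lemma cochain_complex_shift:
  assumes "cochain_complex R C"
  shows "cochain_complex R (shift R C s)"
proof (rule cochain_complex.intro)
  interpret cochain_complex R C by fact
  have cr: "cring R" using obj_module module.axioms(1) by blast
  note ks = koszul_sign_closed[OF cr, of s]
  note d = mod_homD[OF differential_hom]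
  show "module R (obj (shift R C s) p)" for p by (simp add: shift_def obj_module)
  show "differential (shift R C s) p \<in> mod_hom R (obj (shift R C s) p) (obj (shift R C s) (p + 1))" for p
  proof -
    interpret M: module R "obj C (p + s + 1)" by (rule obj_module)
    have e: "p + 1 + s = p + s + 1" by simp
    show ?thesis
      unfolding shift_def mod_hom_def by (auto simp: e d ks M.smult_r_distr M.smult_assoc1[symmetric] M.R.m_comm)
  qed
  show "differential (shift R C s) (p + 1) (differential (shift R C s) p x) = \<zero>\<^bsub>obj (shift R C s) (p + 2)\<^esub>"
    if "x \<in> carrier (obj (shift R C s) p)" for p x
  proof -
    interpret M: module R "obj C (p + s + 2)" by (rule obj_module)
    have e: "p + 1 + s = p + s + 1" "p + s + 1 + 1 = p + s + 2" "p + 2 + s = p + s + 2" by auto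
    have x: "x \<in> carrier (obj C (p + s))" using that by (simp add: shift_def)
    show ?thesis
      using d(3)[OF ks d(1)[OF x]] differential_differential[OF x]
      by (simp add: shift_def e ks)
  qed
qed

lemma module_prod_module:
  assumes "module R M" "module R N"
  shows "module R (prod_module M N)"
proof -
  interpret M: module R M by fact
  interpret N: module R N by fact
  show ?thesis
  proof (rule moduleI)
    show "cring R" by (rule M.R.is_cring)
    show "abelian_group (prod_module M N)"
    proof (rule abelian_groupI)
      show "\<exists>y\<in>carrier (prod_module M N). y \<oplus>\<^bsub>prod_module M N\<^esub> x = \<zero>\<^bsub>prod_module M N\<^esub>"
        if "x \<in> carrier (prod_module M N)" for x
        using that by (intro bexI[of _ "(\<ominus>\<^bsub>M\<^esub> fst x, \<ominus>\<^bsub>N\<^esub> snd x)"])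
          (auto simp: prod_module_def M.M.l_neg N.M.l_neg)
    qed (auto simp: prod_module_def M.M.a_assoc N.M.a_assoc intro: M.M.a_comm N.M.a_comm)
  qed (auto simp: prod_module_def M.smult_l_distr N.smult_l_distr M.smult_r_distr N.smult_r_distr
      M.smult_assoc1 N.smult_assoc1)
qed

lemma cochain_complex_cone:
  assumes "cochain_complex R C" "cochain_complex R D" "cochain_map R C D f"
  shows "cochain_complex R (cone C D f)"
proof (rule cochain_complex.intro)
  interpret C: cochain_complex R C by fact
  interpret D: cochain_complex R D by fact
  note dC = mod_homD[OF C.differential_hom]
  note dD = mod_homD[OF D.differential_hom]
  have fh: "f p \<in> mod_hom R (obj C p) (obj D p)" for p using assms(3) by (simp add: cochain_map_def)
  note f = mod_homD[OF fh]
  have fd: "x \<in> carrier (obj C p) \<Longrightarrow> f (p + 1) (differential C p x) = differential D p (f p x)" for p x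
    using assms(3) by (simp add: cochain_map_def)
  show "module R (obj (cone C D f) p)" for p
    by (simp add: cone_def module_prod_module C.obj_module D.obj_module)
  show "differential (cone C D f) p \<in> mod_hom R (obj (cone C D f) p) (obj (cone C D f) (p + 1))" for p
  proof -
    interpret M: module R "obj C (p + 2)" by (rule C.obj_module)
    interpret N: module R "obj D (p + 1)" by (rule D.obj_module)
    have e: "p + 1 + 1 = p + 2" by simp
    show ?thesis
      using dC(1)[of _ "p + 1"] dC(2)[of _ "p + 1"] dC(3)[of _ _ "p + 1"]
      unfolding cone_def mod_hom_def prod_module_def
      by (auto simp: e dD f M.M.minus_add M.smult_r_minus N.smult_r_distr N.M.a_ac)
  qed
  show "differential (cone C D f) (p + 1) (differential (cone C D f) p z) = \<zero>\<^bsub>obj (cone C D f) (p + 2)\<^esub>"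
    if zc: "z \<in> carrier (obj (cone C D f) p)" for p z
  proof -
    interpret M: module R "obj C (p + 3)" by (rule C.obj_module)
    interpret M2: module R "obj C (p + 2)" by (rule C.obj_module)
    interpret N: module R "obj D (p + 2)" by (rule D.obj_module)
    have e: "p + 1 + 1 = p + 2" "p + 2 + 1 = p + 3" "p + 1 + 2 = p + 3" by auto
    obtain x y where z: "z = (x, y)" "x \<in> carrier (obj C (p + 1))" "y \<in> carrier (obj D p)"
      by (cases z) (use zc in \<open>auto simp: cone_def prod_module_def\<close>)
    show ?thesis
      using z dC(1)[OF z(2)] dD(1)[OF z(3)] f(1)[OF z(2)] dD(1)[of _ "p + 1"] f(1)[of _ "p + 2"]
        mod_hom_neg[OF C.differential_hom C.obj_module C.obj_module, of _ "p + 2"]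
        mod_hom_neg[OF fh C.obj_module D.obj_module, of _ "p + 2"]
        C.differential_differential[OF z(2)] D.differential_differential[OF z(3)] fd[OF z(2)]
        dD(2)[of _ "p + 1"]
      by (simp add: cone_def prod_module_def e N.M.l_neg)
  qed
qed

lemma cochain_complex_ring_complex:
  assumes "cring R"
  shows "cochain_complex R (ring_complex R)"
proof (rule cochain_complex.intro)
  interpret cring R by fact
  have neg: "\<exists>y\<in>carrier R. y \<oplus>\<^bsub>R\<^esub> x = \<zero>\<^bsub>R\<^esub>" if "x \<in> carrier R" for x
    using that l_neg by blast
  show "module R (obj (ring_complex R) p)" for p
    by (cases "p = 0"; rule moduleI[OF assms])
      (auto simp: ring_complex_def ring_module_def l_distr r_distr m_assoc
        intro!: abelian_groupI neg a_assoc a_comm)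
  show "differential (ring_complex R) p
      \<in> mod_hom R (obj (ring_complex R) p) (obj (ring_complex R) (p + 1))" for p
    by (auto simp: ring_complex_def ring_module_def mod_hom_def)
qed (auto simp: ring_complex_def ring_module_def)

lemma cochain_complex_shift_cone_id:
  assumes "cring R"
  shows "cochain_complex R (shift R (cone (ring_complex R) (ring_complex R) (\<lambda>p x. x)) s)"
  using cochain_complex_ring_complex[OF assms]
  by (intro cochain_complex_shift cochain_complex_cone)
    (auto simp: cochain_map_def mod_hom_def)

end

theory Submission
  imports Defs
begin

text \<open>
  Let \<open>Q\<close> be the coproduct and \<open>\<kappa>\<close> its new generators. A contraction of \<open>M\<close> extends to operators
  \<open>H\<close> of degree \<open>-1\<close> on \<open>Q\<close> in two ways: as a derivation, so that \<open>D = dH + Hd\<close> multiplies a tree by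
  its number of vertices from \<open>M\<close>; or, for a fixed input \<open>j\<close>, by acting on the vertex from \<open>M\<close>
  closest to the root on the path from the root to \<open>j\<close>, so that \<open>1 - D\<close> kills the trees with such a
  vertex and fixes the others. In both cases \<open>D\<close> maps cocycles to coboundaries. If \<open>\<rat> \<subseteq> R\<close>, the
  derivation makes the part of positive weight acyclic, because \<open>D - w\<close> kills weight \<open>w\<close> and \<open>w\<close> is
  invertible. If \<open>P(0) = 0\<close> and \<open>n > 0\<close>, every vertex lies on a path to some input, so composing the
  maps \<open>1 - D\<close> for all inputs leaves only the image of \<open>P\<close>.

  Operators on \<open>Q\<close> obeying such composition rules are morphisms from \<open>Q\<close> to an auxiliary operad of
  tuples of elements of \<open>Q\<close>, hence are obtained from the universal property.
\<close>

section \<open>The operad tracking an operation along paths\<close>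

text \<open>The coproduct consists of formal expressions modulo a congruence, with no normal form by
  trees, so a recipe on trees would first have to be shown well defined. A morphism out of the
  coproduct needs values on generators only; the work moves into checking that the composition rules
  for D and H are associative and equivariant. For a path this rests on the multiplicativity of 1 -
  D. The decomposition by weight is replaced by eigenvectors of D, whose span is everything because
  it is a suboperad that contains the generators.

  Two kinds of operator occur because a contraction has to treat the new vertices symmetrically.
  Acting on all of them produces the weight as a factor, which must then be divided by. A marked
  input orders the vertices on its path, so one of them can be chosen compatibly with the symmetric
  groups, and D then has only the eigenvalues 0 and 1. The price is that vertices off the path are
  missed: all inputs are needed, and nullary operations, which can hide a vertex from every input,
  must be excluded.\<close>

lemma koszul_sign_mult:
  assumes "cring R"
  shows "koszul_sign R a \<otimes>\<^bsub>R\<^esub> koszul_sign R b = koszul_sign R (a + b)"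
proof -
  interpret cring R by fact
  show ?thesis by (auto simp: koszul_sign_def l_minus r_minus)
qed

lemma koszul_sign_cong: "even (a - b) \<Longrightarrow> koszul_sign R a = koszul_sign R b"
  by (simp add: koszul_sign_def)

text \<open>
  An input \<open>Some j\<close> of \<open>x \<circ>\<^sub>i y\<close>, with \<open>y\<close> of arity \<open>m\<close>, is reached through input \<open>left_index m i (Some j)\<close>
  of \<open>x\<close> and, if it comes from \<open>y\<close>, input \<open>right_index m i (Some j)\<close> of \<open>y\<close>; otherwise the latter is an
  index \<open>\<ge> m\<close>, where all components vanish. The index \<open>None\<close> stands for the derivation.
\<close>

definition left_index :: "nat \<Rightarrow> nat \<Rightarrow> nat option \<Rightarrow> nat option" where
  "left_index m i = map_option (\<lambda>j. if j < i then j else if j < i + m then i else j + 1 - m)"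

definition right_index :: "nat \<Rightarrow> nat \<Rightarrow> nat option \<Rightarrow> nat option" where
  "right_index m i = map_option (\<lambda>j. if j < i then m else j - i)"

text \<open>The operator written \<open>B\<close> below. For a path it is 1 - D, which discards an
  operation with a new vertex on the path; so the inner factor of a composite is reached only when
  the outer one has no such vertex.\<close>

definition kept ::
    "('k, 'a) operad \<Rightarrow> nat \<Rightarrow> int \<Rightarrow> 'a \<times> (bool \<Rightarrow> nat option \<Rightarrow> 'a) \<Rightarrow> nat option \<Rightarrow> 'a" where
  "kept P r p X j =
    (case j of None \<Rightarrow> fst X | Some _ \<Rightarrow> fst X \<ominus>\<^bsub>opobj P r p\<^esub> snd X False j)"

text \<open>
  An element \<open>(z, E)\<close> has \<open>E False j\<close> (the value of \<open>D\<close>) in the degree of \<open>z\<close> and \<open>E True j\<close> (the value of \<open>H\<close>)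
  one degree lower. With \<open>B z = z\<close> for the derivation and \<open>B z = z - D z\<close> for a path, both satisfy
  \<open>E (x \<circ> y) = E x \<circ> y \<plusminus> B x \<circ> E y\<close>; the differential encodes \<open>H d = D - d H\<close>.
\<close>

definition tracking_operad ::
    "'k ring \<Rightarrow> ('k, 'a) operad \<Rightarrow> ('k, 'a \<times> (bool \<Rightarrow> nat option \<Rightarrow> 'a)) operad" where
  "tracking_operad R P =
    \<lparr>component = (\<lambda>r.
       \<lparr>obj = (\<lambda>p.
          \<lparr>carrier = {X. fst X \<in> carrier (opobj P r p) \<and>
             (\<forall>e j. snd X e j \<in> carrier (opobj P r (p - of_bool e))) \<and>
             (\<forall>e j. r \<le> j \<longrightarrow> snd X e (Some j) = \<zero>\<^bsub>opobj P r (p - of_bool e)\<^esub>)},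
           monoid.mult = undefined, one = undefined,
           zero = (\<zero>\<^bsub>opobj P r p\<^esub>, \<lambda>e j. \<zero>\<^bsub>opobj P r (p - of_bool e)\<^esub>),
           add = (\<lambda>X Y. (fst X \<oplus>\<^bsub>opobj P r p\<^esub> fst Y,
             \<lambda>e j. snd X e j \<oplus>\<^bsub>opobj P r (p - of_bool e)\<^esub> snd Y e j)),
           smult = (\<lambda>c X. (c \<odot>\<^bsub>opobj P r p\<^esub> fst X,
             \<lambda>e j. c \<odot>\<^bsub>opobj P r (p - of_bool e)\<^esub> snd X e j))\<rparr>),
        differential = (\<lambda>p X. (opdiff P r p (fst X),
          \<lambda>e j. if e then snd X False j \<ominus>\<^bsub>opobj P r p\<^esub> opdiff P r (p - 1) (snd X True j)
            else opdiff P r p (snd X False j)))\<rparr>),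
     sym_act = (\<lambda>r p \<sigma> X. (sym_act P r p \<sigma> (fst X),
       \<lambda>e j. sym_act P r (p - of_bool e) \<sigma> (snd X e (map_option \<sigma> j)))),
     op_unit = (op_unit P, \<lambda>e j. \<zero>\<^bsub>opobj P 1 (0 - of_bool e)\<^esub>),
     pcomp = (\<lambda>r i m p q X Y. (pcomp P r i m p q (fst X) (fst Y),
       \<lambda>e j. pcomp P r i m (p - of_bool e) q (snd X e (left_index m i j)) (fst Y)
         \<oplus>\<^bsub>opobj P (r + m - 1) (p + q - of_bool e)\<^esub>
         koszul_sign R (of_bool e * p) \<odot>\<^bsub>opobj P (r + m - 1) (p + q - of_bool e)\<^esub>
           pcomp P r i m p (q - of_bool e) (kept P r p X (left_index m i j))
             (snd Y e (right_index m i j))))\<rparr>"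

section \<open>Arithmetic across arities and degrees\<close>

context operad
begin

abbreviation "TP \<equiv> tracking_operad R P"

lemma pcomp_zero_left: "i < r \<Longrightarrow> y \<in> carrier (opobj P m q) \<Longrightarrow>
    pcomp P r i m p q \<zero>\<^bsub>opobj P r p\<^esub> y = \<zero>\<^bsub>opobj P (r + m - 1) (p + q)\<^esub>"
  using mod_hom_zero[OF pcomp_hom_left opobj_module opobj_module] .

lemma pcomp_zero_right: "i < r \<Longrightarrow> x \<in> carrier (opobj P r p) \<Longrightarrow>
    pcomp P r i m p q x \<zero>\<^bsub>opobj P m q\<^esub> = \<zero>\<^bsub>opobj P (r + m - 1) (p + q)\<^esub>"
  using mod_hom_zero[OF pcomp_hom_right opobj_module opobj_module] .

lemma pcomp_neg_left: "\<lbrakk>i < r; x \<in> carrier (opobj P r p); y \<in> carrier (opobj P m q)\<rbrakk> \<Longrightarrow>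
    pcomp P r i m p q (\<ominus>\<^bsub>opobj P r p\<^esub> x) y = \<ominus>\<^bsub>opobj P (r + m - 1) (p + q)\<^esub> pcomp P r i m p q x y"
  using mod_hom_neg[OF pcomp_hom_left opobj_module opobj_module] .

lemma pcomp_neg_right: "\<lbrakk>i < r; x \<in> carrier (opobj P r p); y \<in> carrier (opobj P m q)\<rbrakk> \<Longrightarrow>
    pcomp P r i m p q x (\<ominus>\<^bsub>opobj P m q\<^esub> y) = \<ominus>\<^bsub>opobj P (r + m - 1) (p + q)\<^esub> pcomp P r i m p q x y"
  using mod_hom_neg[OF pcomp_hom_right opobj_module opobj_module] .

lemmas opdiff_zero = mod_hom_zero[OF opdiff_hom opobj_module opobj_module]
lemmas opdiff_neg = mod_hom_neg[OF opdiff_hom opobj_module opobj_module]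
lemmas act_zero = mod_hom_zero[OF act_hom opobj_module opobj_module]
lemmas act_neg = mod_hom_neg[OF act_hom opobj_module opobj_module]

lemma zero_closed: "\<zero>\<^bsub>opobj P r p\<^esub> \<in> carrier (opobj P r p)"
proof -
  interpret M: module R "opobj P r p" by (rule opobj_module)
  show ?thesis by simp
qed

lemma neg_closed: "x \<in> carrier (opobj P r p) \<Longrightarrow> \<ominus>\<^bsub>opobj P r p\<^esub> x \<in> carrier (opobj P r p)"
proof -
  interpret M: module R "opobj P r p" by (rule opobj_module)
  show "x \<in> carrier (opobj P r p) \<Longrightarrow> \<ominus>\<^bsub>opobj P r p\<^esub> x \<in> carrier (opobj P r p)" by simp
qed

lemma minus_closed:
  "x \<in> carrier (opobj P r p) \<Longrightarrow> y \<in> carrier (opobj P r p) \<Longrightarrow>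
    x \<ominus>\<^bsub>opobj P r p\<^esub> y \<in> carrier (opobj P r p)"
  by (simp add: a_minus_def closed_facts neg_closed)

lemmas sign_closed = koszul_sign_closed[OF R_cring]

text \<open>Arity and degree of the result are variables bound by equations, so that the rule also
  applies when they appear in another arithmetic form.\<close>

lemma pcomp_closed:
  "\<lbrakk>i < r; x \<in> carrier (opobj P r p); y \<in> carrier (opobj P m q); k = r + m - 1; u = p + q\<rbrakk> \<Longrightarrow>
    pcomp P r i m p q x y \<in> carrier (opobj P k u)"
  using pcomp_left_simps(1) by blast

lemma opdiff_closed:
  "\<lbrakk>x \<in> carrier (opobj P r p); u = p + 1\<rbrakk> \<Longrightarrow> opdiff P r p x \<in> carrier (opobj P r u)"
  using opdiff_simps(1) by blast

lemmas closures = closed_facts zero_closed neg_closed minus_closed sign_closed pcomp_closed opdiff_closed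
  act_simps(1)


text \<open>An interpretation of \<open>module\<close> fixes one component, while the computations
  below mix several. The module laws are therefore restated for arbitrary \<open>r\<close> and
  \<open>p\<close>, in a form fit for rewriting.\<close>

lemma opobj_arith:
  assumes "x \<in> carrier (opobj P r p)"
  shows "\<zero>\<^bsub>opobj P r p\<^esub> \<oplus>\<^bsub>opobj P r p\<^esub> x = x" "x \<oplus>\<^bsub>opobj P r p\<^esub> \<zero>\<^bsub>opobj P r p\<^esub> = x"
    "\<ominus>\<^bsub>opobj P r p\<^esub> x \<oplus>\<^bsub>opobj P r p\<^esub> x = \<zero>\<^bsub>opobj P r p\<^esub>"
    "x \<oplus>\<^bsub>opobj P r p\<^esub> \<ominus>\<^bsub>opobj P r p\<^esub> x = \<zero>\<^bsub>opobj P r p\<^esub>"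
    "\<ominus>\<^bsub>opobj P r p\<^esub> (\<ominus>\<^bsub>opobj P r p\<^esub> x) = x"
    "\<one> \<odot>\<^bsub>opobj P r p\<^esub> x = x"
proof -
  interpret M: module R "opobj P r p" by (rule opobj_module)
  show "\<zero>\<^bsub>opobj P r p\<^esub> \<oplus>\<^bsub>opobj P r p\<^esub> x = x" "x \<oplus>\<^bsub>opobj P r p\<^esub> \<zero>\<^bsub>opobj P r p\<^esub> = x"
    "\<ominus>\<^bsub>opobj P r p\<^esub> x \<oplus>\<^bsub>opobj P r p\<^esub> x = \<zero>\<^bsub>opobj P r p\<^esub>"
    "x \<oplus>\<^bsub>opobj P r p\<^esub> \<ominus>\<^bsub>opobj P r p\<^esub> x = \<zero>\<^bsub>opobj P r p\<^esub>"
    "\<ominus>\<^bsub>opobj P r p\<^esub> (\<ominus>\<^bsub>opobj P r p\<^esub> x) = x"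
    "\<one> \<odot>\<^bsub>opobj P r p\<^esub> x = x"
    using assms by (auto simp: M.M.l_neg M.M.r_neg)
qed

lemma opobj_zero_arith:
  "\<ominus>\<^bsub>opobj P r p\<^esub> \<zero>\<^bsub>opobj P r p\<^esub> = \<zero>\<^bsub>opobj P r p\<^esub>"
  "c \<in> carrier R \<Longrightarrow> c \<odot>\<^bsub>opobj P r p\<^esub> \<zero>\<^bsub>opobj P r p\<^esub> = \<zero>\<^bsub>opobj P r p\<^esub>"
  using opobj_arith(1,4)[OF neg_closed[OF zero_closed]] opobj_arith(2)[OF neg_closed[OF zero_closed]]
    opobj_arith(3)[OF zero_closed] module.smult_r_null[OF opobj_module] by auto

lemma opobj_ac:
  assumes "x \<in> carrier (opobj P r p)" "y \<in> carrier (opobj P r p)"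
  shows "x \<oplus>\<^bsub>opobj P r p\<^esub> y = y \<oplus>\<^bsub>opobj P r p\<^esub> x"
    "z \<in> carrier (opobj P r p) \<Longrightarrow>
      x \<oplus>\<^bsub>opobj P r p\<^esub> y \<oplus>\<^bsub>opobj P r p\<^esub> z = x \<oplus>\<^bsub>opobj P r p\<^esub> (y \<oplus>\<^bsub>opobj P r p\<^esub> z)"
    "z \<in> carrier (opobj P r p) \<Longrightarrow>
      x \<oplus>\<^bsub>opobj P r p\<^esub> (y \<oplus>\<^bsub>opobj P r p\<^esub> z) = y \<oplus>\<^bsub>opobj P r p\<^esub> (x \<oplus>\<^bsub>opobj P r p\<^esub> z)"
    "\<ominus>\<^bsub>opobj P r p\<^esub> (x \<oplus>\<^bsub>opobj P r p\<^esub> y) = \<ominus>\<^bsub>opobj P r p\<^esub> x \<oplus>\<^bsub>opobj P r p\<^esub> \<ominus>\<^bsub>opobj P r p\<^esub> y"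
    "\<ominus>\<^bsub>opobj P r p\<^esub> x \<oplus>\<^bsub>opobj P r p\<^esub> (x \<oplus>\<^bsub>opobj P r p\<^esub> y) = y"
    "x \<oplus>\<^bsub>opobj P r p\<^esub> (\<ominus>\<^bsub>opobj P r p\<^esub> x \<oplus>\<^bsub>opobj P r p\<^esub> y) = y"
proof -
  interpret M: module R "opobj P r p" by (rule opobj_module)
  show "x \<oplus>\<^bsub>opobj P r p\<^esub> y = y \<oplus>\<^bsub>opobj P r p\<^esub> x"
    "z \<in> carrier (opobj P r p) \<Longrightarrow>
      x \<oplus>\<^bsub>opobj P r p\<^esub> y \<oplus>\<^bsub>opobj P r p\<^esub> z = x \<oplus>\<^bsub>opobj P r p\<^esub> (y \<oplus>\<^bsub>opobj P r p\<^esub> z)"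
    "z \<in> carrier (opobj P r p) \<Longrightarrow>
      x \<oplus>\<^bsub>opobj P r p\<^esub> (y \<oplus>\<^bsub>opobj P r p\<^esub> z) = y \<oplus>\<^bsub>opobj P r p\<^esub> (x \<oplus>\<^bsub>opobj P r p\<^esub> z)"
    "\<ominus>\<^bsub>opobj P r p\<^esub> (x \<oplus>\<^bsub>opobj P r p\<^esub> y) = \<ominus>\<^bsub>opobj P r p\<^esub> x \<oplus>\<^bsub>opobj P r p\<^esub> \<ominus>\<^bsub>opobj P r p\<^esub> y"
    "\<ominus>\<^bsub>opobj P r p\<^esub> x \<oplus>\<^bsub>opobj P r p\<^esub> (x \<oplus>\<^bsub>opobj P r p\<^esub> y) = y"
    "x \<oplus>\<^bsub>opobj P r p\<^esub> (\<ominus>\<^bsub>opobj P r p\<^esub> x \<oplus>\<^bsub>opobj P r p\<^esub> y) = y"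
    using assms by (auto simp: M.M.r_neg1 M.M.r_neg2 M.M.minus_add M.M.a_assoc intro: M.M.a_comm M.M.a_lcomm)
qed

lemma opobj_smult:
  assumes "c \<in> carrier R" "x \<in> carrier (opobj P r p)"
  shows "y \<in> carrier (opobj P r p) \<Longrightarrow> c \<odot>\<^bsub>opobj P r p\<^esub> (x \<oplus>\<^bsub>opobj P r p\<^esub> y) =
      c \<odot>\<^bsub>opobj P r p\<^esub> x \<oplus>\<^bsub>opobj P r p\<^esub> c \<odot>\<^bsub>opobj P r p\<^esub> y"
    "d \<in> carrier R \<Longrightarrow> (c \<oplus> d) \<odot>\<^bsub>opobj P r p\<^esub> x =
      c \<odot>\<^bsub>opobj P r p\<^esub> x \<oplus>\<^bsub>opobj P r p\<^esub> d \<odot>\<^bsub>opobj P r p\<^esub> x"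
    "c \<odot>\<^bsub>opobj P r p\<^esub> (\<ominus>\<^bsub>opobj P r p\<^esub> x) = \<ominus>\<^bsub>opobj P r p\<^esub> (c \<odot>\<^bsub>opobj P r p\<^esub> x)"
    "d \<in> carrier R \<Longrightarrow> d \<odot>\<^bsub>opobj P r p\<^esub> (c \<odot>\<^bsub>opobj P r p\<^esub> x) = (d \<otimes> c) \<odot>\<^bsub>opobj P r p\<^esub> x"
proof -
  interpret M: module R "opobj P r p" by (rule opobj_module)
  show "y \<in> carrier (opobj P r p) \<Longrightarrow> c \<odot>\<^bsub>opobj P r p\<^esub> (x \<oplus>\<^bsub>opobj P r p\<^esub> y) =
      c \<odot>\<^bsub>opobj P r p\<^esub> x \<oplus>\<^bsub>opobj P r p\<^esub> c \<odot>\<^bsub>opobj P r p\<^esub> y"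
    "d \<in> carrier R \<Longrightarrow> (c \<oplus> d) \<odot>\<^bsub>opobj P r p\<^esub> x =
      c \<odot>\<^bsub>opobj P r p\<^esub> x \<oplus>\<^bsub>opobj P r p\<^esub> d \<odot>\<^bsub>opobj P r p\<^esub> x"
    "c \<odot>\<^bsub>opobj P r p\<^esub> (\<ominus>\<^bsub>opobj P r p\<^esub> x) = \<ominus>\<^bsub>opobj P r p\<^esub> (c \<odot>\<^bsub>opobj P r p\<^esub> x)"
    "d \<in> carrier R \<Longrightarrow> d \<odot>\<^bsub>opobj P r p\<^esub> (c \<odot>\<^bsub>opobj P r p\<^esub> x) = (d \<otimes> c) \<odot>\<^bsub>opobj P r p\<^esub> x"
    using assms by (auto simp: M.smult_r_distr M.smult_l_distr M.smult_r_minus M.smult_assoc1)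
qed

lemma opobj_sign:
  assumes "x \<in> carrier (opobj P r p)"
  shows "koszul_sign R a \<odot>\<^bsub>opobj P r p\<^esub> (koszul_sign R b \<odot>\<^bsub>opobj P r p\<^esub> x) =
      koszul_sign R (a + b) \<odot>\<^bsub>opobj P r p\<^esub> x"
    "koszul_sign R (a + 1) \<odot>\<^bsub>opobj P r p\<^esub> x = \<ominus>\<^bsub>opobj P r p\<^esub> (koszul_sign R a \<odot>\<^bsub>opobj P r p\<^esub> x)"
proof -
  interpret M: module R "opobj P r p" by (rule opobj_module)
  show "koszul_sign R a \<odot>\<^bsub>opobj P r p\<^esub> (koszul_sign R b \<odot>\<^bsub>opobj P r p\<^esub> x) =
      koszul_sign R (a + b) \<odot>\<^bsub>opobj P r p\<^esub> x"
    by (simp add: M.smult_assoc1[symmetric] sign_closed assms koszul_sign_mult[OF R_cring])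
  show "koszul_sign R (a + 1) \<odot>\<^bsub>opobj P r p\<^esub> x = \<ominus>\<^bsub>opobj P r p\<^esub> (koszul_sign R a \<odot>\<^bsub>opobj P r p\<^esub> x)"
    using assms by (auto simp: koszul_sign_def M.smult_l_minus)
qed

section \<open>Components of the tracking operad\<close>

lemma TPD:
  assumes "X \<in> carrier (opobj TP r p)"
  shows "fst X \<in> carrier (opobj P r p)" "snd X e j \<in> carrier (opobj P r (p - of_bool e))"
    "snd X False j \<in> carrier (opobj P r p)" "snd X True j \<in> carrier (opobj P r (p - 1))"
    "r \<le> k \<Longrightarrow> snd X e (Some k) = \<zero>\<^bsub>opobj P r (p - of_bool e)\<^esub>"
    "kept P r p X j \<in> carrier (opobj P r p)"
proof -
  from assms have a: "fst X \<in> carrier (opobj P r p)"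
    "\<And>e j. snd X e j \<in> carrier (opobj P r (p - of_bool e))"
    "\<And>e k. r \<le> k \<Longrightarrow> snd X e (Some k) = \<zero>\<^bsub>opobj P r (p - of_bool e)\<^esub>"
    by (auto simp: tracking_operad_def)
  show "fst X \<in> carrier (opobj P r p)" "snd X e j \<in> carrier (opobj P r (p - of_bool e))"
    "r \<le> k \<Longrightarrow> snd X e (Some k) = \<zero>\<^bsub>opobj P r (p - of_bool e)\<^esub>" using a by auto
  show b: "snd X False j \<in> carrier (opobj P r p)" "snd X True j \<in> carrier (opobj P r (p - 1))" for j
    using a(2)[of False j] a(2)[of True j] by auto
  show "kept P r p X j \<in> carrier (opobj P r p)"
    using a(1) b(1) by (auto simp: kept_def minus_closed split: option.split)
qed


lemma TP_simps:
  "fst \<zero>\<^bsub>opobj TP r p\<^esub> = \<zero>\<^bsub>opobj P r p\<^esub>"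
  "snd \<zero>\<^bsub>opobj TP r p\<^esub> e j = \<zero>\<^bsub>opobj P r (p - of_bool e)\<^esub>"
  "fst (X \<oplus>\<^bsub>opobj TP r p\<^esub> Y) = fst X \<oplus>\<^bsub>opobj P r p\<^esub> fst Y"
  "snd (X \<oplus>\<^bsub>opobj TP r p\<^esub> Y) e j = snd X e j \<oplus>\<^bsub>opobj P r (p - of_bool e)\<^esub> snd Y e j"
  "fst (c \<odot>\<^bsub>opobj TP r p\<^esub> X) = c \<odot>\<^bsub>opobj P r p\<^esub> fst X"
  "snd (c \<odot>\<^bsub>opobj TP r p\<^esub> X) e j = c \<odot>\<^bsub>opobj P r (p - of_bool e)\<^esub> snd X e j"
  "fst (opdiff TP r p X) = opdiff P r p (fst X)"
  "snd (opdiff TP r p X) False j = opdiff P r p (snd X False j)"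
  "snd (opdiff TP r p X) True j = snd X False j \<ominus>\<^bsub>opobj P r p\<^esub> opdiff P r (p - 1) (snd X True j)"
  "fst (sym_act TP r p \<sigma> X) = sym_act P r p \<sigma> (fst X)"
  "snd (sym_act TP r p \<sigma> X) e j = sym_act P r (p - of_bool e) \<sigma> (snd X e (map_option \<sigma> j))"
  "fst (op_unit TP) = op_unit P"
  "snd (op_unit TP) e j = \<zero>\<^bsub>opobj P 1 (0 - of_bool e)\<^esub>"
  "fst (pcomp TP r i m p q X Y) = pcomp P r i m p q (fst X) (fst Y)"
  "snd (pcomp TP r i m p q X Y) e j =
     pcomp P r i m (p - of_bool e) q (snd X e (left_index m i j)) (fst Y)
     \<oplus>\<^bsub>opobj P (r + m - 1) (p + q - of_bool e)\<^esub>
     koszul_sign R (of_bool e * p) \<odot>\<^bsub>opobj P (r + m - 1) (p + q - of_bool e)\<^esub>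
       pcomp P r i m p (q - of_bool e) (kept P r p X (left_index m i j)) (snd Y e (right_index m i j))"
  by (simp_all add: tracking_operad_def)

lemma TP_eqI: "fst X = fst Y \<Longrightarrow> (\<And>e j. snd X e j = snd Y e j) \<Longrightarrow> X = Y"
  by (simp add: prod_eq_iff fun_eq_iff)

lemma TPI:
  assumes "fst X \<in> carrier (opobj P r p)"
    "\<And>e j. snd X e j \<in> carrier (opobj P r (p - of_bool e))"
    "\<And>e k. r \<le> k \<Longrightarrow> snd X e (Some k) = \<zero>\<^bsub>opobj P r (p - of_bool e)\<^esub>"
  shows "X \<in> carrier (opobj TP r p)"
  using assms by (simp add: tracking_operad_def)

lemma module_TP: "module R (opobj TP r p)"
proof (rule moduleI[OF R_cring])
  show "abelian_group (opobj TP r p)"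
  proof (rule abelian_groupI)
    fix X assume X: "X \<in> carrier (opobj TP r p)"
    define Y where "Y = (\<ominus>\<^bsub>opobj P r p\<^esub> fst X, \<lambda>e j. \<ominus>\<^bsub>opobj P r (p - of_bool e)\<^esub> snd X e j)"
    have "Y \<in> carrier (opobj TP r p)"
      using TPD[OF X] by (intro TPI) (auto simp: Y_def neg_closed opobj_zero_arith)
    moreover have "Y \<oplus>\<^bsub>opobj TP r p\<^esub> X = \<zero>\<^bsub>opobj TP r p\<^esub>"
      using TPD[OF X] by (intro TP_eqI) (auto simp: Y_def TP_simps opobj_arith)
    ultimately show "\<exists>Y\<in>carrier (opobj TP r p). Y \<oplus>\<^bsub>opobj TP r p\<^esub> X = \<zero>\<^bsub>opobj TP r p\<^esub>" by blast
  qed ((rule TPI TP_eqI)?; simp add: TP_simps closures TPD opobj_arith opobj_ac opobj_zero_arith)+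
qed ((rule R_cring TPI TP_eqI)?; simp add: TP_simps closures TPD opobj_arith opobj_smult opobj_zero_arith cring.cring_simprules[OF R_cring])+

text \<open>After two differentials the component \<open>H\<close> is dD - d(D - dH) = ddH =
  0.\<close>

lemma complex_TP: "cochain_complex R (component TP r)"
proof (rule cochain_complex.intro)
  show "module R (opobj TP r p)" for p by (rule module_TP)
  show "opdiff TP r p \<in> mod_hom R (opobj TP r p) (opobj TP r (p + 1))" for p
  proof -
    have "opdiff TP r p X \<in> carrier (opobj TP r (p + 1))" if "X \<in> carrier (opobj TP r p)" for X
    proof (rule TPI)
      show "snd (opdiff TP r p X) e j \<in> carrier (opobj P r (p + 1 - of_bool e))" for e j
        using TPD[OF that] by (cases e) (auto simp: TP_simps closures)
      show "snd (opdiff TP r p X) e (Some k) = \<zero>\<^bsub>opobj P r (p + 1 - of_bool e)\<^esub>" if "r \<le> k" for e k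
        using TPD(5)[OF \<open>X \<in> _\<close> that, of True] TPD(5)[OF \<open>X \<in> _\<close> that, of False] opdiff_zero[of r "p - 1"]
        by (cases e) (auto simp: TP_simps opdiff_zero a_minus_def opobj_zero_arith opobj_arith zero_closed)
    qed (use TPD[OF that] in \<open>auto simp: TP_simps closures\<close>)
    moreover have "opdiff TP r p (X \<oplus>\<^bsub>opobj TP r p\<^esub> Y) =
        opdiff TP r p X \<oplus>\<^bsub>opobj TP r (p + 1)\<^esub> opdiff TP r p Y"
      if "X \<in> carrier (opobj TP r p)" "Y \<in> carrier (opobj TP r p)" for X Y
    proof (rule TP_eqI)
      show "snd (opdiff TP r p (X \<oplus>\<^bsub>opobj TP r p\<^esub> Y)) e j =
          snd (opdiff TP r p X \<oplus>\<^bsub>opobj TP r (p + 1)\<^esub> opdiff TP r p Y) e j" for e j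
        using TPD[OF that(1)] TPD[OF that(2)] opdiff_simps(2)[of _ r "p - 1"]
        by (cases e) (auto simp: TP_simps closures opdiff_simps a_minus_def opobj_ac)
    qed (use TPD[OF that(1)] TPD[OF that(2)] in \<open>auto simp: TP_simps opdiff_simps\<close>)
    moreover have "opdiff TP r p (c \<odot>\<^bsub>opobj TP r p\<^esub> X) = c \<odot>\<^bsub>opobj TP r (p + 1)\<^esub> opdiff TP r p X"
      if "X \<in> carrier (opobj TP r p)" "c \<in> carrier R" for X c
    proof (rule TP_eqI)
      show "snd (opdiff TP r p (c \<odot>\<^bsub>opobj TP r p\<^esub> X)) e j =
          snd (c \<odot>\<^bsub>opobj TP r (p + 1)\<^esub> opdiff TP r p X) e j" for e j
        using TPD[OF that(1)] that opdiff_simps(3)[of _ _ r "p - 1"]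
        by (cases e) (auto simp: TP_simps closures opdiff_simps a_minus_def opobj_smult)
    qed (use TPD[OF that(1)] that in \<open>auto simp: TP_simps opdiff_simps\<close>)
    ultimately show ?thesis by (auto simp: mod_hom_def)
  qed
  show "opdiff TP r (p + 1) (opdiff TP r p X) = \<zero>\<^bsub>opobj TP r (p + 2)\<^esub>"
    if "X \<in> carrier (opobj TP r p)" for p X
  proof (rule TP_eqI)
    have e: "p + 2 - 1 = p + 1" by simp
    show "snd (opdiff TP r (p + 1) (opdiff TP r p X)) e j = snd \<zero>\<^bsub>opobj TP r (p + 2)\<^esub> e j" for e j
      using TPD[OF that] opdiff_opdiff[of "snd X True j" r "p - 1"]
      by (cases e) (auto simp: TP_simps closures opdiff_opdiff opdiff_simps opdiff_neg a_minus_def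
          opobj_arith opobj_zero_arith opobj_ac e add.commute[of 1 p])
  qed (use TPD[OF that] in \<open>auto simp: TP_simps opdiff_opdiff\<close>)
qed

lemma kept_simps:
  "kept P r p X None = fst X"
  "X \<in> carrier (opobj TP r p) \<Longrightarrow> r \<le> k \<Longrightarrow> kept P r p X (Some k) = fst X"
  using TPD(5)[of X r p k False] opobj_arith(2) TPD(1)[of X r p]
  by (auto simp: kept_def a_minus_def opobj_zero_arith)

lemma kept_TP:
  assumes X: "X \<in> carrier (opobj TP r p)"
  shows "Y \<in> carrier (opobj TP r p) \<Longrightarrow>
      kept P r p (X \<oplus>\<^bsub>opobj TP r p\<^esub> Y) j = kept P r p X j \<oplus>\<^bsub>opobj P r p\<^esub> kept P r p Y j"
    "c \<in> carrier R \<Longrightarrow> kept P r p (c \<odot>\<^bsub>opobj TP r p\<^esub> X) j = c \<odot>\<^bsub>opobj P r p\<^esub> kept P r p X j"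
    "kept P r (p + 1) (opdiff TP r p X) j = opdiff P r p (kept P r p X j)"
    "\<sigma> permutes {..<r} \<Longrightarrow>
      kept P r p (sym_act TP r p \<sigma> X) j = sym_act P r p \<sigma> (kept P r p X (map_option \<sigma> j))"
  using TPD[OF X] TPD[of Y r p]
  by (auto simp: kept_def TP_simps a_minus_def closures opdiff_simps opdiff_neg act_simps act_neg
      opobj_ac opobj_smult split: option.split)

text \<open>For a path, xy - (Dx)y - (Bx)(Dy) = (Bx)y - (Bx)(Dy) = (Bx)(By). This multiplicativity
  makes the twisted Leibniz rule associative.\<close>

lemma kept_pcomp:
  assumes X: "X \<in> carrier (opobj TP r p)" and Y: "Y \<in> carrier (opobj TP m q)" and i: "i < r"
  shows "kept P (r + m - 1) (p + q) (pcomp TP r i m p q X Y) j =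
    pcomp P r i m p q (kept P r p X (left_index m i j)) (kept P m q Y (right_index m i j))"
proof (cases j)
  case (Some k)
  define L where "L = left_index m i j"
  define U where "U = right_index m i j"
  have k: "kept P r p X L = fst X \<ominus>\<^bsub>opobj P r p\<^esub> snd X False L"
    "kept P m q Y U = fst Y \<ominus>\<^bsub>opobj P m q\<^esub> snd Y False U"
    using Some by (simp_all add: kept_def L_def U_def left_index_def right_index_def)
  have "kept P (r + m - 1) (p + q) (pcomp TP r i m p q X Y) j =
    fst (pcomp TP r i m p q X Y) \<ominus>\<^bsub>opobj P (r + m - 1) (p + q)\<^esub> snd (pcomp TP r i m p q X Y) False j"
    using Some by (simp add: kept_def)
  then show ?thesis
    using TPD[OF X] TPD[OF Y] i unfolding L_def[symmetric] U_def[symmetric] TP_simps k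
    by (simp add: a_minus_def closures pcomp_left_simps(2) pcomp_right_simps(2)
      pcomp_neg_left pcomp_neg_right opobj_ac opobj_arith koszul_sign_def)
qed (simp add: kept_simps left_index_def right_index_def TP_simps)


text \<open>The right side of the rule for E(xy), with \<open>a\<close>, \<open>A\<close>,
  \<open>c\<close> in the places of Ex, Bx, Ey. The operator E lowers degrees by \<open>u\<close>:
  the value 0 covers D and 1 covers H, so both are treated at once. The sign is that of moving E
  past x.\<close>

definition twist ::
    "int \<Rightarrow> nat \<Rightarrow> nat \<Rightarrow> nat \<Rightarrow> int \<Rightarrow> int \<Rightarrow> 'a \<Rightarrow> 'a \<Rightarrow> 'a \<Rightarrow> 'a \<Rightarrow> 'a" where
  "twist u r i m p q a A y c =
    pcomp P r i m (p - u) q a y \<oplus>\<^bsub>opobj P (r + m - 1) (p + q - u)\<^esub>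
    koszul_sign R (u * p) \<odot>\<^bsub>opobj P (r + m - 1) (p + q - u)\<^esub> pcomp P r i m p (q - u) A c"

lemma snd_pcomp_TP:
  "snd (pcomp TP r i m p q X Y) e j =
    twist (of_bool e) r i m p q (snd X e (left_index m i j)) (kept P r p X (left_index m i j))
      (fst Y) (snd Y e (right_index m i j))"
  by (simp add: TP_simps twist_def)

lemma twist_closed:
  "\<lbrakk>i < r; a \<in> carrier (opobj P r (p - u)); A \<in> carrier (opobj P r p);
    y \<in> carrier (opobj P m q); c \<in> carrier (opobj P m (q - u)); k = r + m - 1; v = p + q - u\<rbrakk> \<Longrightarrow>
    twist u r i m p q a A y c \<in> carrier (opobj P k v)"
  unfolding twist_def by (auto intro!: closures)

lemma twist_zero:
  assumes "i < r" "A \<in> carrier (opobj P r p)" "y \<in> carrier (opobj P m q)"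
  shows "twist u r i m p q \<zero>\<^bsub>opobj P r (p - u)\<^esub> A y \<zero>\<^bsub>opobj P m (q - u)\<^esub> =
    \<zero>\<^bsub>opobj P (r + m - 1) (p + q - u)\<^esub>"
proof -
  have e: "p - u + q = p + q - u" "p + (q - u) = p + q - u" by auto
  show ?thesis
    using assms pcomp_zero_left[of i r y m q "p - u"] pcomp_zero_right[of i r A p m "q - u"]
    by (simp add: twist_def e opobj_zero_arith sign_closed opobj_arith zero_closed)
qed

lemma twist_add_left:
  assumes "i < r" "a \<in> carrier (opobj P r (p - u))" "A \<in> carrier (opobj P r p)"
    "a' \<in> carrier (opobj P r (p - u))" "A' \<in> carrier (opobj P r p)"
    "y \<in> carrier (opobj P m q)" "c \<in> carrier (opobj P m (q - u))"
  shows "twist u r i m p q (a \<oplus>\<^bsub>opobj P r (p - u)\<^esub> a') (A \<oplus>\<^bsub>opobj P r p\<^esub> A') y c =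
    twist u r i m p q a A y c \<oplus>\<^bsub>opobj P (r + m - 1) (p + q - u)\<^esub> twist u r i m p q a' A' y c"
proof -
  have e: "p - u + q = p + q - u" "p + (q - u) = p + q - u" by auto
  show ?thesis using assms
    by (simp add: twist_def pcomp_left_simps(2) closures opobj_smult e opobj_ac)
qed

lemma twist_smult_left:
  assumes "i < r" "a \<in> carrier (opobj P r (p - u))" "A \<in> carrier (opobj P r p)" "b \<in> carrier R"
    "y \<in> carrier (opobj P m q)" "c \<in> carrier (opobj P m (q - u))"
  shows "twist u r i m p q (b \<odot>\<^bsub>opobj P r (p - u)\<^esub> a) (b \<odot>\<^bsub>opobj P r p\<^esub> A) y c =
    b \<odot>\<^bsub>opobj P (r + m - 1) (p + q - u)\<^esub> twist u r i m p q a A y c"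
proof -
  interpret cring R by (rule R_cring)
  have e: "p - u + q = p + q - u" "p + (q - u) = p + q - u" by auto
  show ?thesis using assms
    by (simp add: twist_def pcomp_left_simps(3) closures opobj_smult e m_comm)
qed

lemma twist_add_right:
  assumes "i < r" "a \<in> carrier (opobj P r (p - u))" "A \<in> carrier (opobj P r p)"
    "y \<in> carrier (opobj P m q)" "c \<in> carrier (opobj P m (q - u))"
    "y' \<in> carrier (opobj P m q)" "c' \<in> carrier (opobj P m (q - u))"
  shows "twist u r i m p q a A (y \<oplus>\<^bsub>opobj P m q\<^esub> y') (c \<oplus>\<^bsub>opobj P m (q - u)\<^esub> c') =
    twist u r i m p q a A y c \<oplus>\<^bsub>opobj P (r + m - 1) (p + q - u)\<^esub> twist u r i m p q a A y' c'"
proof -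
  have e: "p - u + q = p + q - u" "p + (q - u) = p + q - u" by auto
  show ?thesis using assms
    by (simp add: twist_def pcomp_right_simps(2) closures opobj_smult e opobj_ac)
qed

lemma twist_smult_right:
  assumes "i < r" "a \<in> carrier (opobj P r (p - u))" "A \<in> carrier (opobj P r p)" "b \<in> carrier R"
    "y \<in> carrier (opobj P m q)" "c \<in> carrier (opobj P m (q - u))"
  shows "twist u r i m p q a A (b \<odot>\<^bsub>opobj P m q\<^esub> y) (b \<odot>\<^bsub>opobj P m (q - u)\<^esub> c) =
    b \<odot>\<^bsub>opobj P (r + m - 1) (p + q - u)\<^esub> twist u r i m p q a A y c"
proof -
  interpret cring R by (rule R_cring)
  have e: "p - u + q = p + q - u" "p + (q - u) = p + q - u" by auto
  show ?thesis using assms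
    by (simp add: twist_def pcomp_right_simps(3) closures opobj_smult e m_comm)
qed

text \<open>Both sides expand to the three terms \<open>a y z\<close>, \<open>A b z\<close>,
  \<open>A B c\<close>; the sign of the last one is the same because u*p + u*q = u*(p + q). The
  composite of \<open>A\<close> and \<open>B\<close> on the left is what \<open>kept_pcomp\<close>
  supplies.\<close>

lemma twist_assoc:
  assumes ij: "i < r" "j < m" and a: "a \<in> carrier (opobj P r (p - u))" "A \<in> carrier (opobj P r p)"
    and y: "y \<in> carrier (opobj P m q)" "b \<in> carrier (opobj P m (q - u))" "B \<in> carrier (opobj P m q)"
    and z: "z \<in> carrier (opobj P l t)" "c \<in> carrier (opobj P l (t - u))"
  shows "twist u (r + m - 1) (i + j) l (p + q) t (twist u r i m p q a A y b) (pcomp P r i m p q A B) z c =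
    twist u r i (m + l - 1) p (q + t) a A (pcomp P m j l q t y z) (twist u m j l q t b B z c)"
proof -
  have e: "p - u + q = p + q - u" "p + (q - u) = p + q - u" "q - u + t = q + t - u"
    "q + (t - u) = q + t - u" "p + (q + t) = p + q + t" "p + (q + t - u) = p + q + t - u"
    "p + q - u + t = p + q + t - u" "p + q + (t - u) = p + q + t - u" "u * p + u * q = u * (p + q)"
    by (auto simp: algebra_simps)
  have n: "r + m - 1 + l - 1 = r + (m + l - 1) - 1" "i + j < r + m - 1" using ij by auto
  have as: "pcomp P (r + m - 1) (i + j) l (p + q - u) t (pcomp P r i m (p - u) q a y) z =
      pcomp P r i (m + l - 1) (p - u) (q + t) a (pcomp P m j l q t y z)"
    "pcomp P (r + m - 1) (i + j) l (p + q - u) t (pcomp P r i m p (q - u) A b) z =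
      pcomp P r i (m + l - 1) p (q + t - u) A (pcomp P m j l (q - u) t b z)"
    "pcomp P (r + m - 1) (i + j) l (p + q) (t - u) (pcomp P r i m p q A B) c =
      pcomp P r i (m + l - 1) p (q + t - u) A (pcomp P m j l q (t - u) B c)"
    using pcomp_assoc[OF ij a(1) y(1) z(1)] pcomp_assoc[OF ij a(2) y(2) z(1)]
      pcomp_assoc[OF ij a(2) y(3) z(2)] by (simp_all only: e)
  have c1: "pcomp P r i m (p - u) q a y \<in> carrier (opobj P (r + m - 1) (p + q - u))"
    "pcomp P r i m p (q - u) A b \<in> carrier (opobj P (r + m - 1) (p + q - u))"
    "pcomp P m j l (q - u) t b z \<in> carrier (opobj P (m + l - 1) (q + t - u))"
    "pcomp P m j l q (t - u) B c \<in> carrier (opobj P (m + l - 1) (q + t - u))"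
    "pcomp P m j l q t y z \<in> carrier (opobj P (m + l - 1) (q + t))"
    using ij a y z by (auto intro!: closures)
  have c2: "pcomp P r i (m + l - 1) (p - u) (q + t) a (pcomp P m j l q t y z)
      \<in> carrier (opobj P (r + (m + l - 1) - 1) (p + q + t - u))"
    "pcomp P r i (m + l - 1) p (q + t - u) A (pcomp P m j l (q - u) t b z)
      \<in> carrier (opobj P (r + (m + l - 1) - 1) (p + q + t - u))"
    "pcomp P r i (m + l - 1) p (q + t - u) A (pcomp P m j l q (t - u) B c)
      \<in> carrier (opobj P (r + (m + l - 1) - 1) (p + q + t - u))"
    using ij a c1 by (auto intro!: closures)
  show ?thesis
    using ij a y z n c1 c2
    by (simp add: twist_def pcomp_left_simps(2)[OF n(2)] pcomp_left_simps(3)[OF n(2)]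
      pcomp_right_simps(2,3) closures e as n(1) opobj_smult(1) opobj_sign opobj_ac del: One_nat_def)
qed

text \<open>The terms in \<open>a\<close> agree by the parallel axiom. The others compare
  \<open>A c y\<close> with \<open>A B c\<close>, and \<open>A C b\<close> with
  \<open>A b z\<close>, whence the two alternatives. For the derivation \<open>B = y\<close> and
  \<open>C = z\<close>. A path enters at most one of the two factors, and on a missed factor the
  tracked component is zero and the kept part is the whole element.\<close>

lemma twist_parallel:
  assumes ik: "i < k" "k < r"
    and a: "a \<in> carrier (opobj P r (p - u))" "A \<in> carrier (opobj P r p)"
    and y: "y \<in> carrier (opobj P m q)" "b \<in> carrier (opobj P m (q - u))" "B \<in> carrier (opobj P m q)"
    and z: "z \<in> carrier (opobj P l t)" "c \<in> carrier (opobj P l (t - u))" "C \<in> carrier (opobj P l t)"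
    and B: "B = y \<or> c = \<zero>\<^bsub>opobj P l (t - u)\<^esub>"
    and C: "C = z \<or> b = \<zero>\<^bsub>opobj P m (q - u)\<^esub>"
  shows "twist u (r + l - 1) i m (p + t) q (twist u r k l p t a A z c) (pcomp P r k l p t A C) y b =
    koszul_sign R (q * t) \<odot>\<^bsub>opobj P (r + l - 1 + m - 1) (p + t + q - u)\<^esub>
      twist u (r + m - 1) (k + m - 1) l (p + q) t
        (twist u r i m p q a A y b) (pcomp P r i m p q A B) z c"
proof -
  have i: "i < r" using ik by simp
  have e: "p - u + q = p + q - u" "p + (q - u) = p + q - u" "p - u + t = p + t - u"
    "p + (t - u) = p + t - u" "p + t - u + q = p + q + t - u" "p + t + (q - u) = p + q + t - u"
    "p + q - u + t = p + q + t - u" "p + q + (t - u) = p + q + t - u" "p + t + q = p + q + t"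
    by (auto simp: algebra_simps)
  have n: "r + l - 1 + m - 1 = r + m - 1 + l - 1" "i < r + l - 1" "k + m - 1 < r + m - 1"
    using ik by auto
  have l: "r + l + m - 2 = r + m + l - 2" by simp
  have pa: "pcomp P (r + l - 1) i m (p + t - u) q (pcomp P r k l (p - u) t a z) y =
      koszul_sign R (q * t) \<odot>\<^bsub>opobj P (r + m - 1 + l - 1) (p + q + t - u)\<^esub>
        pcomp P (r + m - 1) (k + m - 1) l (p + q - u) t (pcomp P r i m (p - u) q a y) z"
    using pcomp_parallel[OF ik a(1) y(1) z(1)] by (simp only: e n)
  have pb: "pcomp P (r + l - 1) i m (p + t) (q - u) (pcomp P r k l p t A C) b =
      koszul_sign R ((q - u) * t) \<odot>\<^bsub>opobj P (r + m - 1 + l - 1) (p + q + t - u)\<^esub>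
        pcomp P (r + m - 1) (k + m - 1) l (p + q - u) t (pcomp P r i m p (q - u) A b) z"
  proof (cases "C = z")
    case True
    then show ?thesis using pcomp_parallel[OF ik a(2) y(2) z(1)] by (simp only: e n)
  next
    case False
    \<comment> \<open>Here \<open>b\<close> is zero, so both sides vanish.\<close>
    have 0: "pcomp P r i m p (q - u) A \<zero>\<^bsub>opobj P m (q - u)\<^esub> = \<zero>\<^bsub>opobj P (r + m - 1) (p + q - u)\<^esub>"
      "pcomp P (r + m - 1) (k + m - 1) l (p + q - u) t \<zero>\<^bsub>opobj P (r + m - 1) (p + q - u)\<^esub> z =
        \<zero>\<^bsub>opobj P (r + m - 1 + l - 1) (p + q + t - u)\<^esub>"
      "pcomp P (r + l - 1) i m (p + t) (q - u) (pcomp P r k l p t A C) \<zero>\<^bsub>opobj P m (q - u)\<^esub> =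
        \<zero>\<^bsub>opobj P (r + m - 1 + l - 1) (p + q + t - u)\<^esub>"
      using pcomp_zero_right[OF i a(2), of m "q - u"] pcomp_zero_left[OF n(3) z(1), of "p + q - u"]
        pcomp_zero_right[OF n(2) pcomp_closed[OF ik(2) a(2) z(3) HOL.refl HOL.refl], of m "q - u"]
      by (simp_all only: e n)
    show ?thesis using False C by (simp add: 0 opobj_zero_arith sign_closed del: One_nat_def)
  qed
  have pc: "pcomp P (r + l - 1) i m (p + t - u) q (pcomp P r k l p (t - u) A c) y =
      koszul_sign R (q * (t - u)) \<odot>\<^bsub>opobj P (r + m - 1 + l - 1) (p + q + t - u)\<^esub>
        pcomp P (r + m - 1) (k + m - 1) l (p + q) (t - u) (pcomp P r i m p q A B) c"
  proof (cases "B = y")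
    case True
    then show ?thesis using pcomp_parallel[OF ik a(2) y(1) z(2)] by (simp only: e n)
  next
    case False
    have 0: "pcomp P r k l p (t - u) A \<zero>\<^bsub>opobj P l (t - u)\<^esub> = \<zero>\<^bsub>opobj P (r + l - 1) (p + t - u)\<^esub>"
      "pcomp P (r + l - 1) i m (p + t - u) q \<zero>\<^bsub>opobj P (r + l - 1) (p + t - u)\<^esub> y =
        \<zero>\<^bsub>opobj P (r + m - 1 + l - 1) (p + q + t - u)\<^esub>"
      "pcomp P (r + m - 1) (k + m - 1) l (p + q) (t - u) (pcomp P r i m p q A B) \<zero>\<^bsub>opobj P l (t - u)\<^esub> =
        \<zero>\<^bsub>opobj P (r + m - 1 + l - 1) (p + q + t - u)\<^esub>"
      using pcomp_zero_right[OF ik(2) a(2), of l "t - u"] pcomp_zero_left[OF n(2) y(1), of "p + t - u"]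
        pcomp_zero_right[OF n(3) pcomp_closed[OF i a(2) y(3) HOL.refl HOL.refl], of l "t - u"]
      by (simp_all only: e n)
    show ?thesis using False B by (simp add: 0 opobj_zero_arith sign_closed del: One_nat_def)
  qed
  \<comment> \<open>The first two exponents differ by the even number 2*u*q; the second two are
    equal.\<close>
  have s: "koszul_sign R (u * p + q * (t - u)) = koszul_sign R (q * t + u * (p + q))"
    "koszul_sign R (u * (p + t) + (q - u) * t) = koszul_sign R (q * t + u * p)"
    by (rule koszul_sign_cong; simp add: algebra_simps)+
  have c1: "pcomp P r k l (p - u) t a z \<in> carrier (opobj P (r + l - 1) (p + t - u))"
    "pcomp P r k l p (t - u) A c \<in> carrier (opobj P (r + l - 1) (p + t - u))"
    "pcomp P r i m (p - u) q a y \<in> carrier (opobj P (r + m - 1) (p + q - u))"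
    "pcomp P r i m p (q - u) A b \<in> carrier (opobj P (r + m - 1) (p + q - u))"
    "pcomp P r i m p q A B \<in> carrier (opobj P (r + m - 1) (p + q))"
    using ik a y z by (auto intro!: closures)
  have c2: "pcomp P (r + m - 1) (k + m - 1) l (p + q - u) t (pcomp P r i m (p - u) q a y) z
      \<in> carrier (opobj P (r + m - 1 + l - 1) (p + q + t - u))"
    "pcomp P (r + m - 1) (k + m - 1) l (p + q - u) t (pcomp P r i m p (q - u) A b) z
      \<in> carrier (opobj P (r + m - 1 + l - 1) (p + q + t - u))"
    "pcomp P (r + m - 1) (k + m - 1) l (p + q) (t - u) (pcomp P r i m p q A B) c
      \<in> carrier (opobj P (r + m - 1 + l - 1) (p + q + t - u))"
    using n y z c1 by (auto intro!: closures)
  show ?thesis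
    using n(2,3) y z c1 c2
    unfolding twist_def n(1)
    by (simp add: l pcomp_left_simps(2)[OF n(2)] pcomp_left_simps(3)[OF n(2)]
      pcomp_left_simps(2)[OF n(3)] pcomp_left_simps(3)[OF n(3)]
      closures e pa pb pc n(1) opobj_smult(1) opobj_sign s opobj_ac del: One_nat_def)
qed

lemma twist_act:
  assumes p: "\<sigma> permutes {..<r}" "\<tau> permutes {..<m}" and i: "i < r"
    and a: "a \<in> carrier (opobj P r (p - u))" "A \<in> carrier (opobj P r p)"
    and y: "y \<in> carrier (opobj P m q)" "c \<in> carrier (opobj P m (q - u))"
  shows "twist u r i m p q (sym_act P r (p - u) \<sigma> a) (sym_act P r p \<sigma> A)
      (sym_act P m q \<tau> y) (sym_act P m (q - u) \<tau> c) =
    sym_act P (r + m - 1) (p + q - u) (comp_perm r m i \<sigma> \<tau>) (twist u r (\<sigma> i) m p q a A y c)"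
proof -
  have e: "p - u + q = p + q - u" "p + (q - u) = p + q - u" by auto
  have si: "\<sigma> i < r" using permutes_in_image[OF p(1), of i] i by simp
  note cp = comp_perm_permutes[OF p i]
  have eq: "pcomp P r i m (p - u) q (sym_act P r (p - u) \<sigma> a) (sym_act P m q \<tau> y) =
      sym_act P (r + m - 1) (p + q - u) (comp_perm r m i \<sigma> \<tau>) (pcomp P r (\<sigma> i) m (p - u) q a y)"
    "pcomp P r i m p (q - u) (sym_act P r p \<sigma> A) (sym_act P m (q - u) \<tau> c) =
      sym_act P (r + m - 1) (p + q - u) (comp_perm r m i \<sigma> \<tau>) (pcomp P r (\<sigma> i) m p (q - u) A c)"
    using pcomp_equivariant[OF p i a(1) y(1)] pcomp_equivariant[OF p i a(2) y(2)] by (simp_all only: e)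
  have "pcomp P r (\<sigma> i) m (p - u) q a y \<in> carrier (opobj P (r + m - 1) (p + q - u))"
    "pcomp P r (\<sigma> i) m p (q - u) A c \<in> carrier (opobj P (r + m - 1) (p + q - u))"
    using a y si by (auto intro!: closures)
  then show ?thesis
    using si by (simp add: twist_def eq act_simps(2,3)[OF cp] closures del: One_nat_def)
qed

text \<open>An out-of-range index is a number whose exact value depends on how it was computed. All
  of them carry zero components, so the index identities are only required up to this
  relation.\<close>

definition same_slot :: "nat \<Rightarrow> nat option \<Rightarrow> nat option \<Rightarrow> bool" where
  "same_slot m j k \<longleftrightarrow> j = k \<or> (\<exists>a b. j = Some a \<and> k = Some b \<and> m \<le> a \<and> m \<le> b)"

lemma slot_eq:
  assumes "Y \<in> carrier (opobj TP m q)" "same_slot m j k"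
  shows "snd Y e j = snd Y e k" "kept P m q Y j = kept P m q Y k"
  using assms TPD(5)[OF assms(1)] kept_simps(2)[OF assms(1)] by (auto simp: same_slot_def)

lemma pcomp_TP_closed:
  assumes X: "X \<in> carrier (opobj TP r p)" and Y: "Y \<in> carrier (opobj TP m q)" and i: "i < r"
  shows "pcomp TP r i m p q X Y \<in> carrier (opobj TP (r + m - 1) (p + q))"
proof (rule TPI)
  note D = TPD[OF X] TPD[OF Y]
  show "fst (pcomp TP r i m p q X Y) \<in> carrier (opobj P (r + m - 1) (p + q))"
    unfolding TP_simps using i D by (auto intro!: closures)
  show "snd (pcomp TP r i m p q X Y) e j \<in> carrier (opobj P (r + m - 1) (p + q - of_bool e))" for e j
    unfolding snd_pcomp_TP using i D by (intro twist_closed) auto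
  show "snd (pcomp TP r i m p q X Y) e (Some k) = \<zero>\<^bsub>opobj P (r + m - 1) (p + q - of_bool e)\<^esub>"
    if "r + m - 1 \<le> k" for e k
  proof -
    \<comment> \<open>An input beyond the composite lies beyond both factors, so both terms of the
      Leibniz rule vanish.\<close>
    have "left_index m i (Some k) = Some (k + 1 - m)" "right_index m i (Some k) = Some (k - i)"
      "r \<le> k + 1 - m" "m \<le> k - i"
      using that i by (auto simp: left_index_def right_index_def)
    then show ?thesis
      using twist_zero[OF i D(6) D(7), where u = "of_bool e"] D(5) D(11) by (simp add: snd_pcomp_TP)
  qed
qed

lemma act_TP_closed:
  assumes X: "X \<in> carrier (opobj TP r p)" and p: "\<sigma> permutes {..<r}"
  shows "sym_act TP r p \<sigma> X \<in> carrier (opobj TP r p)"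
proof (rule TPI)
  show "snd (sym_act TP r p \<sigma> X) e (Some k) = \<zero>\<^bsub>opobj P r (p - of_bool e)\<^esub>" if "r \<le> k" for e k
    using TPD(5)[OF X that] permutes_not_in[OF p, of k] that by (simp add: TP_simps act_zero[OF p])
qed (use TPD[OF X] in \<open>auto simp: TP_simps act_simps(1)[OF p]\<close>)

section \<open>Following an input through composites and permutations\<close>

lemma left_index_assoc: "j < m \<Longrightarrow> left_index m i (left_index l (i + j) k) = left_index (m + l - 1) i k"
  by (cases k) (auto simp: left_index_def)

text \<open>Equality fails out of range: for an input \<open>k < i\<close> the second pair of
  indices is \<open>l\<close> and \<open>m + l - 1 - j\<close>, in general different, but both at
  least \<open>l\<close>.\<close>

lemma right_index_assoc:
  "j < m \<Longrightarrow> same_slot m (right_index m i (left_index l (i + j) k))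
    (left_index l j (right_index (m + l - 1) i k))"
  "j < m \<Longrightarrow> same_slot l (right_index l (i + j) k) (right_index l j (right_index (m + l - 1) i k))"
  by (cases k; auto simp: left_index_def right_index_def same_slot_def)+

lemma left_index_parallel:
  "i < k \<Longrightarrow> left_index l k (left_index m i j) = left_index m i (left_index l (k + m - 1) j)"
  by (cases j) (auto simp: left_index_def)

lemma right_index_parallel:
  "i < k \<Longrightarrow> same_slot l (right_index l k (left_index m i j)) (right_index l (k + m - 1) j)"
  "i < k \<Longrightarrow> same_slot m (right_index m i j) (right_index m i (left_index l (k + m - 1) j))"
  by (cases j; auto simp: left_index_def right_index_def same_slot_def)+

text \<open>A path cannot enter two parallel factors. Inputs before \<open>k + m - 1\<close> miss
  the factor of arity \<open>l\<close>; since \<open>i < k\<close>, the remaining ones lie beyond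
  the block of \<open>m\<close> inputs that starts at \<open>i\<close>.\<close>

lemma right_index_disjoint:
  assumes "i < k"
  obtains "j = None" | a where "right_index l (k + m - 1) j = Some a" "l \<le> a"
    | a where "right_index m i j = Some a" "m \<le> a"
proof (cases j)
  case (Some a)
  show ?thesis
  proof (cases "a < k + m - 1")
    case True
    with Some show ?thesis by (intro that(2)[of l]) (auto simp: right_index_def)
  next
    case False
    with Some assms show ?thesis by (intro that(3)[of "a - i"]) (auto simp: right_index_def)
  qed
qed (use that in simp)

lemma left_index_perm:
  assumes p: "\<sigma> permutes {..<r}" "\<tau> permutes {..<m}" and i: "i < r"
  shows "left_index m (\<sigma> i) (map_option (comp_perm r m i \<sigma> \<tau>) j) = map_option \<sigma> (left_index m i j)"
    "same_slot m (right_index m (\<sigma> i) (map_option (comp_perm r m i \<sigma> \<tau>) j))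
      (map_option \<tau> (right_index m i j))"
proof -
  have s: "\<sigma> i < r" "\<And>k. \<sigma> k = \<sigma> i \<Longrightarrow> k = i" "\<And>k. r \<le> k \<Longrightarrow> \<sigma> k = k"
    using permutes_in_image[OF p(1), of i] i permutes_inj[OF p(1)] permutes_not_in[OF p(1)]
    by (auto dest: injD)
  have t: "\<tau> k < m \<longleftrightarrow> k < m" for k using permutes_in_image[OF p(2), of k] by simp
  have t': "m \<le> k \<Longrightarrow> \<tau> k = k" for k using permutes_not_in[OF p(2), of k] by simp
  have *: "left_index m (\<sigma> i) (Some (comp_perm r m i \<sigma> \<tau> k)) = map_option \<sigma> (left_index m i (Some k)) \<and>
    same_slot m (right_index m (\<sigma> i) (Some (comp_perm r m i \<sigma> \<tau> k))) (map_option \<tau> (right_index m i (Some k)))"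
    for k
  proof -
    consider "k < i" | "i \<le> k" "k < i + m" | "i + m \<le> k" "k < r + m - 1" | "r + m - 1 \<le> k" by linarith
    then show ?thesis
    proof cases
      case 1
      then have "\<sigma> k \<noteq> \<sigma> i" using s(2)[of k] by auto
      then show ?thesis using 1 t'[of m]
        by (auto simp: left_index_def right_index_def same_slot_def comp_perm_def Let_def)
    next
      case 2
      then show ?thesis using t[of "k - i"]
        by (auto simp: left_index_def right_index_def same_slot_def comp_perm_def Let_def)
    next
      case 3
      \<comment> \<open>The input of the outer operation that carries \<open>k\<close>. It differs
        from \<open>\<sigma> i\<close>, and its side of the inserted block decides whether
        \<open>comp_perm\<close> shifts it.\<close>
      define w where "w = \<sigma> (Suc k - m)"
      have "w \<noteq> \<sigma> i" using s(2)[of "k + 1 - m"] 3 by (auto simp: w_def)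
      then consider "w < \<sigma> i" | "\<sigma> i < w" by linarith
      then show ?thesis using 3 t'[of "k - i"] t'[of m]
        by cases (auto simp: left_index_def right_index_def same_slot_def comp_perm_def Let_def w_def[symmetric])
    next
      case 4
      then show ?thesis using s(1) i s(3)[of "k + 1 - m"] t'[of "k - i"]
        by (auto simp: left_index_def right_index_def same_slot_def comp_perm_def Let_def)
    qed
  qed
  show "left_index m (\<sigma> i) (map_option (comp_perm r m i \<sigma> \<tau>) j) = map_option \<sigma> (left_index m i j)"
    "same_slot m (right_index m (\<sigma> i) (map_option (comp_perm r m i \<sigma> \<tau>) j))
      (map_option \<tau> (right_index m i j))"
    using * by (cases j; simp add: left_index_def right_index_def same_slot_def)+
qed

text \<open>In the component \<open>D\<close> this is the Leibniz rule of \<open>P\<close> applied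
  to both terms, as \<open>B\<close> commutes with d. In the component \<open>H\<close>, writing a0,
  a1 for Dx, Hx, c0, c1 for Dy, Hy and A for Bx, both sides are a0 y + A c0 - (d a1) y + (-1)^p a1
  (dy) - (-1)^p (dA) c1 - A (d c1).\<close>

lemma pcomp_TP_differential:
  assumes X: "X \<in> carrier (opobj TP r p)" and Y: "Y \<in> carrier (opobj TP m q)" and i: "i < r"
  shows "opdiff TP (r + m - 1) (p + q) (pcomp TP r i m p q X Y) =
    pcomp TP r i m (p + 1) q (opdiff TP r p X) Y
    \<oplus>\<^bsub>opobj TP (r + m - 1) (p + q + 1)\<^esub>
    koszul_sign R p \<odot>\<^bsub>opobj TP (r + m - 1) (p + q + 1)\<^esub>
      pcomp TP r i m p (q + 1) X (opdiff TP m q Y)" (is "?l = ?r")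
proof (rule TP_eqI)
  note D = TPD[OF X] TPD[OF Y]
  show "fst ?l = fst ?r"
    using pcomp_differential[OF i D(1) D(7)] by (simp add: TP_simps)
  show "snd ?l e j = snd ?r e j" for e j
  proof -
    let ?N = "r + m - 1"
    define L U where "L = left_index m i j" and "U = right_index m i j"
    define A where "A = kept P r p X L"
    have A: "A \<in> carrier (opobj P r p)" using D by (simp add: A_def)
    define y a0 a1 c0 c1 where "y = fst Y" and "a0 = snd X False L" and "a1 = snd X True L"
      and "c0 = snd Y False U" and "c1 = snd Y True U"
    have c: "y \<in> carrier (opobj P m q)" "a0 \<in> carrier (opobj P r p)" "a1 \<in> carrier (opobj P r (p - 1))"
      "c0 \<in> carrier (opobj P m q)" "c1 \<in> carrier (opobj P m (q - 1))"
      using D by (auto simp: y_def a0_def a1_def c0_def c1_def)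
    have e: "p + 1 - 1 = p" "p - 1 + 1 = p" "q - 1 + 1 = q" "q + 1 - 1 = q" "p + 1 + q = p + q + 1"
      "p + (q + 1) = p + q + 1" "p + q + 1 - 1 = p + q" "p + q - 1 + 1 = p + q"
      "p - 1 + q = p + q - 1" "p + (q - 1) = p + q - 1" "p + 1 + (q - 1) = p + q" "p - 1 + (q + 1) = p + q"
      by auto
    show ?thesis
    proof (cases e)
      case False
      have d: "opdiff P ?N (p + q) (pcomp P r i m p q a0 y) =
          pcomp P r i m (p + 1) q (opdiff P r p a0) y \<oplus>\<^bsub>opobj P ?N (p + q + 1)\<^esub>
          koszul_sign R p \<odot>\<^bsub>opobj P ?N (p + q + 1)\<^esub> pcomp P r i m p (q + 1) a0 (opdiff P m q y)"
        "opdiff P ?N (p + q) (pcomp P r i m p q A c0) =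
          pcomp P r i m (p + 1) q (opdiff P r p A) c0 \<oplus>\<^bsub>opobj P ?N (p + q + 1)\<^esub>
          koszul_sign R p \<odot>\<^bsub>opobj P ?N (p + q + 1)\<^esub> pcomp P r i m p (q + 1) A (opdiff P m q c0)"
        using pcomp_differential[OF i c(2,1)] pcomp_differential[OF i A c(4)] by auto
      have cl: "pcomp P r i m p q a0 y \<in> carrier (opobj P ?N (p + q))"
        "pcomp P r i m p q A c0 \<in> carrier (opobj P ?N (p + q))"
        "pcomp P r i m (p + 1) q (opdiff P r p a0) y \<in> carrier (opobj P ?N (p + q + 1))"
        "pcomp P r i m (p + 1) q (opdiff P r p A) c0 \<in> carrier (opobj P ?N (p + q + 1))"
        "pcomp P r i m p (q + 1) a0 (opdiff P m q y) \<in> carrier (opobj P ?N (p + q + 1))"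
        "pcomp P r i m p (q + 1) A (opdiff P m q c0) \<in> carrier (opobj P ?N (p + q + 1))"
        using i c A by (auto intro!: closures)
      have k: "koszul_sign R 0 = \<one>" by (simp add: koszul_sign_def)
      show ?thesis using False cl d
        by (simp add: TP_simps(1-14) snd_pcomp_TP twist_def L_def[symmetric] U_def[symmetric] kept_TP(3)[OF X]
          y_def[symmetric] a0_def[symmetric] c0_def[symmetric] A_def[symmetric] k
          opobj_arith opdiff_simps(2) e opobj_smult(1) opobj_ac closures del: One_nat_def)
    next
      case True
      have d: "opdiff P ?N (p + q - 1) (pcomp P r i m (p - 1) q a1 y) =
          pcomp P r i m p q (opdiff P r (p - 1) a1) y \<oplus>\<^bsub>opobj P ?N (p + q)\<^esub>
          koszul_sign R (p - 1) \<odot>\<^bsub>opobj P ?N (p + q)\<^esub> pcomp P r i m (p - 1) (q + 1) a1 (opdiff P m q y)"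
        "opdiff P ?N (p + q - 1) (pcomp P r i m p (q - 1) A c1) =
          pcomp P r i m (p + 1) (q - 1) (opdiff P r p A) c1 \<oplus>\<^bsub>opobj P ?N (p + q)\<^esub>
          koszul_sign R p \<odot>\<^bsub>opobj P ?N (p + q)\<^esub> pcomp P r i m p q A (opdiff P m (q - 1) c1)"
        using pcomp_differential[OF i c(3,1)] pcomp_differential[OF i A c(5)] by (simp_all only: e)
      have cl: "pcomp P r i m (p - 1) q a1 y \<in> carrier (opobj P ?N (p + q - 1))"
        "pcomp P r i m p (q - 1) A c1 \<in> carrier (opobj P ?N (p + q - 1))"
        "pcomp P r i m p q a0 y \<in> carrier (opobj P ?N (p + q))"
        "pcomp P r i m p q A c0 \<in> carrier (opobj P ?N (p + q))"
        "pcomp P r i m p q (opdiff P r (p - 1) a1) y \<in> carrier (opobj P ?N (p + q))"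
        "pcomp P r i m (p - 1) (q + 1) a1 (opdiff P m q y) \<in> carrier (opobj P ?N (p + q))"
        "pcomp P r i m (p + 1) (q - 1) (opdiff P r p A) c1 \<in> carrier (opobj P ?N (p + q))"
        "pcomp P r i m p q A (opdiff P m (q - 1) c1) \<in> carrier (opobj P ?N (p + q))"
        "opdiff P r (p - 1) a1 \<in> carrier (opobj P r p)" "opdiff P m (q - 1) c1 \<in> carrier (opobj P m q)"
        using i c A by (auto intro!: closures)
      have k: "koszul_sign R 0 = \<one>" "koszul_sign R (p + p) = \<one>" by (simp_all add: koszul_sign_def)
      have k1: "koszul_sign R p \<odot>\<^bsub>opobj P ?N (p + q)\<^esub> x =
        \<ominus>\<^bsub>opobj P ?N (p + q)\<^esub> (koszul_sign R (p - 1) \<odot>\<^bsub>opobj P ?N (p + q)\<^esub> x)"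
        if "x \<in> carrier (opobj P ?N (p + q))" for x
        using opobj_sign(2)[OF that, of "p - 1"] by simp
      have k2: "koszul_sign R (2 * p - 1) \<odot>\<^bsub>opobj P ?N (p + q)\<^esub> x = \<ominus>\<^bsub>opobj P ?N (p + q)\<^esub> x"
        if "x \<in> carrier (opobj P ?N (p + q))" for x
        using opobj_sign(2)[OF that, of "2 * p - 2"] opobj_arith(6)[OF that] by (simp add: koszul_sign_def)
      show ?thesis using True cl d i A c
        by (simp add: TP_simps(1-14) snd_pcomp_TP twist_def L_def[symmetric] U_def[symmetric] kept_TP(3)[OF X]
          y_def[symmetric] a0_def[symmetric] c0_def[symmetric] a1_def[symmetric] c1_def[symmetric]
          A_def[symmetric] k a_minus_def
          pcomp_left_simps(2) pcomp_right_simps(2) pcomp_neg_left pcomp_neg_right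
          opobj_arith opdiff_simps(2,3) e opobj_smult(1,3) opobj_ac closures opobj_sign k1 k2 del: One_nat_def)
    qed
  qed
qed

text \<open>Associativity, the parallel axiom and equivariance hold on first components by the
  axioms of \<open>P\<close>; on the others they are the identities for \<open>twist\<close>, once
  the indices on both sides have been matched.\<close>

theorem operad_TP: "operad R TP"
proof (rule operad.intro)
  show "cochain_complex R (component TP r)" for r by (rule complex_TP)
  show "cochain_map R (component TP r) (component TP r) (\<lambda>p. sym_act TP r p \<sigma>)"
    if p: "\<sigma> permutes {..<r}" for \<sigma> r
  proof -
    have "sym_act TP r p \<sigma> (X \<oplus>\<^bsub>opobj TP r p\<^esub> Y) = sym_act TP r p \<sigma> X \<oplus>\<^bsub>opobj TP r p\<^esub> sym_act TP r p \<sigma> Y"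
      if "X \<in> carrier (opobj TP r p)" "Y \<in> carrier (opobj TP r p)" for X Y p
      using TPD[OF that(1)] TPD[OF that(2)] by (intro TP_eqI) (auto simp: TP_simps act_simps(2)[OF p])
    moreover have "sym_act TP r p \<sigma> (c \<odot>\<^bsub>opobj TP r p\<^esub> X) = c \<odot>\<^bsub>opobj TP r p\<^esub> sym_act TP r p \<sigma> X"
      if "X \<in> carrier (opobj TP r p)" "c \<in> carrier R" for X c p
      using TPD[OF that(1)] that(2) by (intro TP_eqI) (auto simp: TP_simps act_simps(3)[OF p])
    moreover have "sym_act TP r (q + 1) \<sigma> (opdiff TP r q X) = opdiff TP r q (sym_act TP r q \<sigma> X)"
      if "X \<in> carrier (opobj TP r q)" for X q
    proof (rule TP_eqI)
      show "snd (sym_act TP r (q + 1) \<sigma> (opdiff TP r q X)) e j =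
          snd (opdiff TP r q (sym_act TP r q \<sigma> X)) e j" for e j
        using TPD[OF that] act_opdiff[OF p, of _ "q - 1"]
        by (cases e) (auto simp: TP_simps act_opdiff[OF p] a_minus_def act_simps(2)[OF p] act_neg[OF p] closures)
    qed (use TPD[OF that] in \<open>auto simp: TP_simps act_opdiff[OF p]\<close>)
    ultimately show ?thesis
      unfolding cochain_map_def mod_hom_def using act_TP_closed[OF _ p] by simp
  qed
  show "sym_act TP r p id X = X" if "X \<in> carrier (opobj TP r p)" for r p X
    using TPD[OF that] by (intro TP_eqI) (auto simp: TP_simps act_id option.map_id)
  show "sym_act TP r p \<tau> (sym_act TP r p \<sigma> X) = sym_act TP r p (\<sigma> \<circ> \<tau>) X"
    if "\<sigma> permutes {..<r}" "\<tau> permutes {..<r}" "X \<in> carrier (opobj TP r p)" for \<sigma> \<tau> r p X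
    using TPD[OF that(3)] that(1,2) by (intro TP_eqI) (auto simp: TP_simps act_act option.map_comp)
  show "op_unit TP \<in> carrier (opobj TP 1 0)"
    by (intro TPI) (auto simp: TP_simps zero_closed unit_closed simp del: One_nat_def)
  show "opdiff TP 1 0 (op_unit TP) = \<zero>\<^bsub>opobj TP 1 1\<^esub>"
  proof (rule TP_eqI)
    show "snd (opdiff TP 1 0 (op_unit TP)) e j = snd \<zero>\<^bsub>opobj TP 1 1\<^esub> e j" for e j
      using opdiff_zero[of 1 "- 1"] opdiff_zero[of 1 0]
      by (cases e) (auto simp: TP_simps a_minus_def opobj_arith opobj_zero_arith zero_closed simp del: One_nat_def)
  qed (simp add: TP_simps unit_cocycle del: One_nat_def)
  show "(\<lambda>X. pcomp TP r i m p q X Y) \<in> mod_hom R (opobj TP r p) (opobj TP (r + m - 1) (p + q))"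
    if "i < r" "Y \<in> carrier (opobj TP m q)" for i r Y m p q
  proof -
    have "pcomp TP r i m p q (X \<oplus>\<^bsub>opobj TP r p\<^esub> X') Y =
        pcomp TP r i m p q X Y \<oplus>\<^bsub>opobj TP (r + m - 1) (p + q)\<^esub> pcomp TP r i m p q X' Y"
      if X: "X \<in> carrier (opobj TP r p)" "X' \<in> carrier (opobj TP r p)" for X X'
      using TPD[OF X(1)] TPD[OF X(2)] TPD[OF \<open>Y \<in> _\<close>] \<open>i < r\<close>
      by (intro TP_eqI) (simp_all only: TP_simps(1-14) pcomp_left_simps(2) snd_pcomp_TP kept_TP(1)[OF X] twist_add_left)
    moreover have "pcomp TP r i m p q (c \<odot>\<^bsub>opobj TP r p\<^esub> X) Y =
        c \<odot>\<^bsub>opobj TP (r + m - 1) (p + q)\<^esub> pcomp TP r i m p q X Y"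
      if X: "X \<in> carrier (opobj TP r p)" "c \<in> carrier R" for X c
      using TPD[OF X(1)] X(2) TPD[OF \<open>Y \<in> _\<close>] \<open>i < r\<close>
      by (intro TP_eqI) (simp_all only: TP_simps(1-14) pcomp_left_simps(3) snd_pcomp_TP kept_TP(2)[OF X] twist_smult_left)
    ultimately show ?thesis unfolding mod_hom_def using that pcomp_TP_closed by auto
  qed
  show "pcomp TP r i m p q X \<in> mod_hom R (opobj TP m q) (opobj TP (r + m - 1) (p + q))"
    if "i < r" "X \<in> carrier (opobj TP r p)" for i r X m p q
  proof -
    have "pcomp TP r i m p q X (Y \<oplus>\<^bsub>opobj TP m q\<^esub> Y') =
        pcomp TP r i m p q X Y \<oplus>\<^bsub>opobj TP (r + m - 1) (p + q)\<^esub> pcomp TP r i m p q X Y'"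
      if Y: "Y \<in> carrier (opobj TP m q)" "Y' \<in> carrier (opobj TP m q)" for Y Y'
      using TPD[OF Y(1)] TPD[OF Y(2)] TPD[OF \<open>X \<in> _\<close>] \<open>i < r\<close>
      by (intro TP_eqI) (simp_all only: TP_simps(1-14) pcomp_right_simps(2) snd_pcomp_TP twist_add_right)
    moreover have "pcomp TP r i m p q X (c \<odot>\<^bsub>opobj TP m q\<^esub> Y) =
        c \<odot>\<^bsub>opobj TP (r + m - 1) (p + q)\<^esub> pcomp TP r i m p q X Y"
      if Y: "Y \<in> carrier (opobj TP m q)" "c \<in> carrier R" for Y c
      using TPD[OF Y(1)] Y(2) TPD[OF \<open>X \<in> _\<close>] \<open>i < r\<close>
      by (intro TP_eqI) (simp_all only: TP_simps(1-14) pcomp_right_simps(3) snd_pcomp_TP twist_smult_right)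
    ultimately show ?thesis unfolding mod_hom_def using that pcomp_TP_closed by auto
  qed
  show "opdiff TP (r + m - 1) (p + q) (pcomp TP r i m p q X Y) =
          pcomp TP r i m (p + 1) q (opdiff TP r p X) Y
          \<oplus>\<^bsub>opobj TP (r + m - 1) (p + q + 1)\<^esub>
          koszul_sign R p \<odot>\<^bsub>opobj TP (r + m - 1) (p + q + 1)\<^esub>
            pcomp TP r i m p (q + 1) X (opdiff TP m q Y)"
    if "i < r" "X \<in> carrier (opobj TP r p)" "Y \<in> carrier (opobj TP m q)" for i r X Y m p q
    using that by (intro pcomp_TP_differential)
  show "pcomp TP 1 0 m 0 q (op_unit TP) Y = Y" if "Y \<in> carrier (opobj TP m q)" for m q Y
  proof (rule TP_eqI)
    note D = TPD[OF that]
    show "snd (pcomp TP 1 0 m 0 q (op_unit TP) Y) e j = snd Y e j" for e j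
    proof -
      have k: "kept P 1 0 (op_unit TP) l = op_unit P" for l
        unfolding kept_def TP_simps
        by (simp add: a_minus_def opobj_arith opobj_zero_arith unit_closed del: One_nat_def split: option.split)
      have "right_index m 0 j = j" by (cases j) (auto simp: right_index_def)
      moreover have "pcomp P 1 0 m (0 - of_bool e) q \<zero>\<^bsub>opobj P 1 (0 - of_bool e)\<^esub> (fst Y) =
          \<zero>\<^bsub>opobj P m (q - of_bool e)\<^esub>"
        using pcomp_zero_left[OF zero_less_one D(1), of "0 - of_bool e"] by (simp add: algebra_simps)
      moreover have "koszul_sign R 0 = \<one>" by (simp add: koszul_sign_def)
      ultimately show ?thesis
        using D(2)[of e j] pcomp_unit_left[OF D(2)[of e j]]
        by (simp add: snd_pcomp_TP twist_def k TP_simps(13) opobj_arith del: One_nat_def)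
    qed
  qed (use TPD(1)[OF that] in \<open>simp add: TP_simps pcomp_unit_left del: One_nat_def\<close>)
  show "pcomp TP r i 1 p 0 X (op_unit TP) = X" if "i < r" "X \<in> carrier (opobj TP r p)" for i r p X
  proof (rule TP_eqI)
    note D = TPD[OF that(2)]
    show "snd (pcomp TP r i 1 p 0 X (op_unit TP)) e j = snd X e j" for e j
    proof -
      have "left_index 1 i j = j" by (cases j) (auto simp: left_index_def)
      then show ?thesis
        using D(2)[of e j] pcomp_unit_right[OF that(1) D(2)[of e j]]
          pcomp_zero_right[OF that(1) D(6)[of j], of 1 "0 - of_bool e"]
        by (simp add: snd_pcomp_TP twist_def TP_simps(12,13) opobj_arith opobj_zero_arith sign_closed del: One_nat_def)
    qed
  qed (use that in \<open>simp add: TP_simps pcomp_unit_right[OF that(1)] TPD(1)[OF that(2)] del: One_nat_def\<close>)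
  show "pcomp TP (r + m - 1) (i + j) l (p + q) t (pcomp TP r i m p q X Y) Z =
        pcomp TP r i (m + l - 1) p (q + t) X (pcomp TP m j l q t Y Z)"
    if ij: "i < r" "j < m" and X: "X \<in> carrier (opobj TP r p)" and Y: "Y \<in> carrier (opobj TP m q)"
      and Z: "Z \<in> carrier (opobj TP l t)" for i r j m X p Y q Z l t
  proof (rule TP_eqI)
    note D = TPD[OF X] TPD[OF Y] TPD[OF Z]
    show "fst (pcomp TP (r + m - 1) (i + j) l (p + q) t (pcomp TP r i m p q X Y) Z) =
        fst (pcomp TP r i (m + l - 1) p (q + t) X (pcomp TP m j l q t Y Z))"
      using pcomp_assoc[OF ij D(1,7,13)] by (simp only: TP_simps)
    show "snd (pcomp TP (r + m - 1) (i + j) l (p + q) t (pcomp TP r i m p q X Y) Z) e k =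
        snd (pcomp TP r i (m + l - 1) p (q + t) X (pcomp TP m j l q t Y Z)) e k" for e k
      unfolding snd_pcomp_TP TP_simps(14) kept_pcomp[OF X Y ij(1)] left_index_assoc[OF ij(2)]
        slot_eq[OF Y right_index_assoc(1)[OF ij(2)]] slot_eq[OF Z right_index_assoc(2)[OF ij(2)]]
      by (rule twist_assoc[OF ij]) (fact D)+
  qed
  show "pcomp TP (r + l - 1) i m (p + t) q (pcomp TP r j l p t X Z) Y =
        koszul_sign R (q * t) \<odot>\<^bsub>opobj TP (r + l - 1 + m - 1) (p + t + q)\<^esub>
          pcomp TP (r + m - 1) (j + m - 1) l (p + q) t (pcomp TP r i m p q X Y) Z"
    if ij: "i < j" "j < r" and X: "X \<in> carrier (opobj TP r p)" and Y: "Y \<in> carrier (opobj TP m q)"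
      and Z: "Z \<in> carrier (opobj TP l t)" for i r j m X p Y q Z l t
  proof (rule TP_eqI)
    note D = TPD[OF X] TPD[OF Y] TPD[OF Z]
    have i: "i < r" using ij by simp
    show "fst (pcomp TP (r + l - 1) i m (p + t) q (pcomp TP r j l p t X Z) Y) =
        fst (koszul_sign R (q * t) \<odot>\<^bsub>opobj TP (r + l - 1 + m - 1) (p + t + q)\<^esub>
          pcomp TP (r + m - 1) (j + m - 1) l (p + q) t (pcomp TP r i m p q X Y) Z)"
      using pcomp_parallel[OF ij D(1,7,13)] by (simp only: TP_simps)
    show "snd (pcomp TP (r + l - 1) i m (p + t) q (pcomp TP r j l p t X Z) Y) e k =
        snd (koszul_sign R (q * t) \<odot>\<^bsub>opobj TP (r + l - 1 + m - 1) (p + t + q)\<^esub>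
          pcomp TP (r + m - 1) (j + m - 1) l (p + q) t (pcomp TP r i m p q X Y) Z) e k" for e k
    proof -
      note cong = slot_eq[OF Z right_index_parallel(1)[OF ij(1), of l m k]]
        slot_eq[OF Y right_index_parallel(2)[OF ij(1), of m k l]]
      let ?b = "snd Y e (right_index m i k)" and ?B = "kept P m q Y (right_index m i k)"
      let ?c = "snd Z e (right_index l (j + m - 1) k)" and ?C = "kept P l t Z (right_index l (j + m - 1) k)"
      have "(?B = fst Y \<or> ?c = \<zero>\<^bsub>opobj P l (t - of_bool e)\<^esub>) \<and>
        (?C = fst Z \<or> ?b = \<zero>\<^bsub>opobj P m (q - of_bool e)\<^esub>)"
      proof (rule right_index_disjoint[OF ij(1), where j = k and m = m and l = l])
        assume "k = None"
        then show ?thesis by (simp add: right_index_def kept_simps)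
      qed (use TPD(5)[OF Y] TPD(5)[OF Z] kept_simps(2)[OF Y] kept_simps(2)[OF Z] in auto)
      then show ?thesis
        unfolding TP_simps(6) snd_pcomp_TP TP_simps(14) kept_pcomp[OF X Y i] kept_pcomp[OF X Z ij(2)] cong(1,2)
          left_index_parallel[OF ij(1)] cong(3,4)[symmetric]
        by (intro twist_parallel[OF ij] D) auto
    qed
  qed
  show "pcomp TP r i m p q (sym_act TP r p \<sigma> X) (sym_act TP m q \<tau> Y) =
        sym_act TP (r + m - 1) (p + q) (comp_perm r m i \<sigma> \<tau>) (pcomp TP r (\<sigma> i) m p q X Y)"
    if p: "\<sigma> permutes {..<r}" "\<tau> permutes {..<m}" "i < r" and X: "X \<in> carrier (opobj TP r p)"
      and Y: "Y \<in> carrier (opobj TP m q)" for \<sigma> r \<tau> m i p q X Y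
  proof (rule TP_eqI)
    note D = TPD[OF X] TPD[OF Y]
    show "fst (pcomp TP r i m p q (sym_act TP r p \<sigma> X) (sym_act TP m q \<tau> Y)) =
        fst (sym_act TP (r + m - 1) (p + q) (comp_perm r m i \<sigma> \<tau>) (pcomp TP r (\<sigma> i) m p q X Y))"
      using pcomp_equivariant[OF p D(1,7)] by (simp only: TP_simps)
    show "snd (pcomp TP r i m p q (sym_act TP r p \<sigma> X) (sym_act TP m q \<tau> Y)) e j =
        snd (sym_act TP (r + m - 1) (p + q) (comp_perm r m i \<sigma> \<tau>) (pcomp TP r (\<sigma> i) m p q X Y)) e j" for e j
      unfolding TP_simps(10,11) snd_pcomp_TP kept_TP(4)[OF X p(1)] left_index_perm(1)[OF p]
        slot_eq[OF Y left_index_perm(2)[OF p]]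
      by (rule twist_act[OF p]) (fact D)+
  qed
qed

lemma fst_TP_hom: "operad_hom R TP P (\<lambda>r p. fst)"
  unfolding operad_hom_def cochain_map_def mod_hom_def by (auto simp: TP_simps TPD)

end

section \<open>A criterion for quasi-isomorphisms\<close>

text \<open>Since \<open>f\<close> maps \<open>A\<close> into \<open>B\<close>, the set attached to
  the coset of x is the single coset of \<open>f x\<close>. Both halves of bijectivity can then be
  tested on representatives.\<close>

lemma quotient_iso:
  assumes G: "comm_group G" and H: "comm_group H" and f: "f \<in> hom G H"
    and A: "subgroup A G" and B: "subgroup B H" and AB: "f ` A \<subseteq> B"
    and inj: "\<And>x. \<lbrakk>x \<in> carrier G; f x \<in> B\<rbrakk> \<Longrightarrow> x \<in> A"
    and surj: "\<And>y. y \<in> carrier H \<Longrightarrow> \<exists>x\<in>carrier G. \<exists>b\<in>B. y = b \<otimes>\<^bsub>H\<^esub> f x"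
  shows "(\<lambda>X. B <#>\<^bsub>H\<^esub> f ` X) \<in> iso (G Mod A) (H Mod B)"
proof -
  interpret G: comm_group G by fact
  interpret H: comm_group H by fact
  interpret f: group_hom G H f using f by unfold_locales
  interpret A: normal A G using G.subgroup_imp_normal[OF A] .
  interpret B: normal B H using H.subgroup_imp_normal[OF B] .
  have coset: "B <#>\<^bsub>H\<^esub> f ` (A #>\<^bsub>G\<^esub> x) = B #>\<^bsub>H\<^esub> f x" if x: "x \<in> carrier G" for x
  proof
    show "B <#>\<^bsub>H\<^esub> f ` (A #>\<^bsub>G\<^esub> x) \<subseteq> B #>\<^bsub>H\<^esub> f x"
    proof
      fix y assume "y \<in> B <#>\<^bsub>H\<^esub> f ` (A #>\<^bsub>G\<^esub> x)"
      then obtain b a where "b \<in> B" "a \<in> A" "y = b \<otimes>\<^bsub>H\<^esub> f (a \<otimes>\<^bsub>G\<^esub> x)"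
        by (auto simp: set_mult_def r_coset_def)
      moreover from this have "f a \<in> B" using AB by auto
      ultimately have "y = (b \<otimes>\<^bsub>H\<^esub> f a) \<otimes>\<^bsub>H\<^esub> f x" "b \<otimes>\<^bsub>H\<^esub> f a \<in> B" using x by (auto simp: H.m_assoc)
      then show "y \<in> B #>\<^bsub>H\<^esub> f x" by (auto simp: r_coset_def)
    qed
    have "x \<in> A #>\<^bsub>G\<^esub> x" using G.rcos_self[OF x A] .
    then show "B #>\<^bsub>H\<^esub> f x \<subseteq> B <#>\<^bsub>H\<^esub> f ` (A #>\<^bsub>G\<^esub> x)"
      unfolding r_coset_def[of H] set_mult_def by blast
  qed
  have cosetE: "\<exists>x\<in>carrier G. X = A #>\<^bsub>G\<^esub> x" if "X \<in> carrier (G Mod A)" for X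
    using that by (auto simp: carrier_FactGroup)
  show ?thesis
  proof (rule isoI)
    show "(\<lambda>X. B <#>\<^bsub>H\<^esub> f ` X) \<in> hom (G Mod A) (H Mod B)"
    proof (rule homI)
      fix X assume "X \<in> carrier (G Mod A)"
      then obtain x where x: "x \<in> carrier G" "X = A #>\<^bsub>G\<^esub> x" using cosetE by blast
      then show "B <#>\<^bsub>H\<^esub> f ` X \<in> carrier (H Mod B)" by (auto simp: coset carrier_FactGroup)
      fix Y assume "Y \<in> carrier (G Mod A)"
      then obtain y where y: "y \<in> carrier G" "Y = A #>\<^bsub>G\<^esub> y" using cosetE by blast
      show "B <#>\<^bsub>H\<^esub> f ` (X \<otimes>\<^bsub>G Mod A\<^esub> Y) = (B <#>\<^bsub>H\<^esub> f ` X) \<otimes>\<^bsub>H Mod B\<^esub> (B <#>\<^bsub>H\<^esub> f ` Y)"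
        using x y by (simp add: A.rcos_sum B.rcos_sum coset)
    qed
    show "bij_betw (\<lambda>X. B <#>\<^bsub>H\<^esub> f ` X) (carrier (G Mod A)) (carrier (H Mod B))"
    proof (rule bij_betw_imageI)
      show "inj_on (\<lambda>X. B <#>\<^bsub>H\<^esub> f ` X) (carrier (G Mod A))"
      proof (rule inj_onI)
        fix X Y assume "X \<in> carrier (G Mod A)" "Y \<in> carrier (G Mod A)" and eq: "B <#>\<^bsub>H\<^esub> f ` X = B <#>\<^bsub>H\<^esub> f ` Y"
        then obtain x y where x: "x \<in> carrier G" "X = A #>\<^bsub>G\<^esub> x" and y: "y \<in> carrier G" "Y = A #>\<^bsub>G\<^esub> y"
          using cosetE by meson
        have "f x \<in> B #>\<^bsub>H\<^esub> f y"
          using eq x y H.rcos_self[OF _ B, of "f x"] by (simp add: coset)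
        then obtain b where b: "b \<in> B" "f x = b \<otimes>\<^bsub>H\<^esub> f y" by (auto simp: r_coset_def)
        then have "f (x \<otimes>\<^bsub>G\<^esub> inv\<^bsub>G\<^esub> y) = b" using x y by (simp add: H.m_assoc)
        then have "x \<otimes>\<^bsub>G\<^esub> inv\<^bsub>G\<^esub> y \<in> A" using inj x y b by auto
        then show "X = Y"
          using x y A.rcos_module_rev[of y x] G.repr_independence[OF _ _ A, of x y] by auto
      qed
      show "(\<lambda>X. B <#>\<^bsub>H\<^esub> f ` X) ` carrier (G Mod A) = carrier (H Mod B)"
      proof -
        have "\<exists>x\<in>carrier G. B #>\<^bsub>H\<^esub> y = B #>\<^bsub>H\<^esub> f x" if "y \<in> carrier H" for y
        proof -
          from surj[OF that] obtain x b where "x \<in> carrier G" "b \<in> B" "y = b \<otimes>\<^bsub>H\<^esub> f x" by blast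
          then have "y \<in> B #>\<^bsub>H\<^esub> f x" by (auto simp: r_coset_def)
          then show ?thesis using H.repr_independence[OF _ _ B, of y "f x"] \<open>x \<in> _\<close> by auto
        qed
        then show ?thesis by (force simp: carrier_FactGroup image_image coset)
      qed
    qed
  qed
qed

lemma (in cochain_complex) cocycles_subgroup: "subgroup (cocycles C p) (add_monoid (obj C p))"
proof -
  interpret M: module R "obj C p" by (rule obj_module)
  interpret N: module R "obj C (p + 1)" by (rule obj_module)
  note d = mod_homD[OF differential_hom]
  show ?thesis
  proof (rule group.subgroupI[OF M.M.a_group])
    show "cocycles C p \<noteq> {}"
      using mod_hom_zero[OF differential_hom obj_module obj_module, of p] M.M.zero_closed
      by (auto simp: cocycles_def)
    show "inv\<^bsub>add_monoid (obj C p)\<^esub> a \<in> cocycles C p" if "a \<in> cocycles C p" for a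
      using that mod_hom_neg[OF differential_hom obj_module obj_module, of a p] M.M.a_inv_closed[of a]
        mod_hom_neg[OF differential_hom obj_module obj_module, of "\<zero>\<^bsub>obj C p\<^esub>" p]
        N.M.r_neg[OF N.M.zero_closed] N.M.a_inv_closed[OF N.M.zero_closed]
      by (auto simp: cocycles_def a_inv_def[symmetric])
  qed (auto simp: cocycles_def d)
qed

lemma (in cochain_complex) coboundaries_subgroup:
  "subgroup (coboundaries C p) (add_monoid (obj C p))"
proof -
  interpret M: module R "obj C p" by (rule obj_module)
  interpret N: module R "obj C (p - 1)" by (rule obj_module)
  have d: "differential C (p - 1) \<in> mod_hom R (obj C (p - 1)) (obj C p)"
    using differential_hom[of "p - 1"] by simp
  show ?thesis
  proof (rule group.subgroupI[OF M.M.a_group])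
    show "coboundaries C p \<noteq> {}" by (auto simp: coboundaries_def)
    show "inv\<^bsub>add_monoid (obj C p)\<^esub> a \<in> coboundaries C p" if a: "a \<in> coboundaries C p" for a
    proof -
      obtain b where b: "b \<in> carrier (obj C (p - 1))" "a = differential C (p - 1) b"
        using a by (auto simp: coboundaries_def)
      then have "inv\<^bsub>add_monoid (obj C p)\<^esub> a = differential C (p - 1) (\<ominus>\<^bsub>obj C (p - 1)\<^esub> b)"
        using mod_hom_neg[OF d N.module_axioms M.module_axioms] by (simp add: a_inv_def)
      then show ?thesis using b unfolding coboundaries_def by blast
    qed
    show "a \<otimes>\<^bsub>add_monoid (obj C p)\<^esub> b \<in> coboundaries C p"
      if "a \<in> coboundaries C p" "b \<in> coboundaries C p" for a b
    proof -
      from that(1) obtain a' where "a' \<in> carrier (obj C (p - 1))" "a = differential C (p - 1) a'"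
        unfolding coboundaries_def by (rule imageE)
      moreover from that(2) obtain b' where "b' \<in> carrier (obj C (p - 1))" "b = differential C (p - 1) b'"
        unfolding coboundaries_def by (rule imageE)
      ultimately have "a \<otimes>\<^bsub>add_monoid (obj C p)\<^esub> b = differential C (p - 1) (a' \<oplus>\<^bsub>obj C (p - 1)\<^esub> b')"
        "a' \<oplus>\<^bsub>obj C (p - 1)\<^esub> b' \<in> carrier (obj C (p - 1))"
        using mod_homD(2)[OF d] by auto
      then show ?thesis unfolding coboundaries_def by blast
    qed
  qed (use mod_homD(1)[OF d] in \<open>auto simp: coboundaries_def\<close>)
qed

lemma (in cochain_complex) coboundaries_subset: "coboundaries C p \<subseteq> cocycles C p"
proof -
  have e: "p - 1 + 1 = p" "p - 1 + 2 = p + 1" by auto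
  show ?thesis
    using differential_differential[of _ "p - 1"] mod_homD(1)[OF differential_hom[of "p - 1"]]
    unfolding e by (auto simp: coboundaries_def cocycles_def)
qed

text \<open>Turns the comparison of quotient groups into two conditions on single cocycles; cosets
  do not occur afterwards.\<close>

lemma quasi_isomorphismI:
  assumes C: "cochain_complex R C" and D: "cochain_complex R D" and f: "cochain_map R C D f"
    and inj: "\<And>p x. \<lbrakk>x \<in> cocycles C p; f p x \<in> coboundaries D p\<rbrakk> \<Longrightarrow> x \<in> coboundaries C p"
    and surj: "\<And>p y. y \<in> cocycles D p \<Longrightarrow>
      \<exists>x\<in>cocycles C p. y \<ominus>\<^bsub>obj D p\<^esub> f p x \<in> coboundaries D p"
  shows "quasi_isomorphism R C D f"
  unfolding quasi_isomorphism_def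
proof (intro conjI allI f)
  fix p
  interpret C: cochain_complex R C by fact
  interpret D: cochain_complex R D by fact
  interpret M: module R "obj C p" by (rule C.obj_module)
  interpret N: module R "obj D p" by (rule D.obj_module)
  interpret MG: comm_group "add_monoid (obj C p)" by (rule M.M.a_comm_group)
  interpret NG: comm_group "add_monoid (obj D p)" by (rule N.M.a_comm_group)
  let ?G = "(add_monoid (obj C p)) \<lparr>carrier := cocycles C p\<rparr>"
  let ?H = "(add_monoid (obj D p)) \<lparr>carrier := cocycles D p\<rparr>"
  have fh: "f p \<in> mod_hom R (obj C p) (obj D p)"
    and fd: "\<And>x. x \<in> carrier (obj C p) \<Longrightarrow> f (p + 1) (differential C p x) = differential D p (f p x)"
    and fh1: "f (p + 1) \<in> mod_hom R (obj C (p + 1)) (obj D (p + 1))"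
    using f by (auto simp: cochain_map_def)
  have fz: "f p x \<in> cocycles D p" if "x \<in> cocycles C p" for x
    using that fd[of x] mod_homD(1)[OF fh, of x] mod_hom_zero[OF fh1 C.obj_module D.obj_module]
    by (auto simp: cocycles_def)
  have "(\<lambda>X. coboundaries D p <#>\<^bsub>?H\<^esub> f p ` X) \<in> iso (?G Mod coboundaries C p) (?H Mod coboundaries D p)"
  proof (rule quotient_iso)
    show "comm_group ?G" 
      by (rule group.group_comm_groupI[OF subgroup.subgroup_is_group[OF C.cocycles_subgroup M.M.a_group]])
        (auto simp: cocycles_def M.M.a_comm)
    show "comm_group ?H" 
      by (rule group.group_comm_groupI[OF subgroup.subgroup_is_group[OF D.cocycles_subgroup N.M.a_group]])
        (auto simp: cocycles_def N.M.a_comm)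
    show "f p \<in> hom ?G ?H"
      using fz mod_homD(2)[OF fh] by (auto simp: hom_def cocycles_def)
    show "subgroup (coboundaries C p) ?G"
      by (rule group.subgroup_incl[OF M.M.a_group C.coboundaries_subgroup C.cocycles_subgroup C.coboundaries_subset])
    show "subgroup (coboundaries D p) ?H"
      by (rule group.subgroup_incl[OF N.M.a_group D.coboundaries_subgroup D.cocycles_subgroup D.coboundaries_subset])
    show "f p ` coboundaries C p \<subseteq> coboundaries D p"
    proof -
      have "f p (differential C (p - 1) x) = differential D (p - 1) (f (p - 1) x)"
        "f (p - 1) x \<in> carrier (obj D (p - 1))" if "x \<in> carrier (obj C (p - 1))" for x
        using f that mod_homD(1)[of "f (p - 1)"] by (auto simp: cochain_map_def dest!: spec[of _ "p - 1"])
      then show ?thesis by (auto simp: coboundaries_def)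
    qed
    show "\<exists>x\<in>carrier ?G. \<exists>b\<in>coboundaries D p. y = b \<otimes>\<^bsub>?H\<^esub> f p x" if "y \<in> carrier ?H" for y
    proof -
      have "y \<in> cocycles D p" using that by simp
      from surj[OF this] obtain x
        where x: "x \<in> cocycles C p" "y \<ominus>\<^bsub>obj D p\<^esub> f p x \<in> coboundaries D p" by blast
      have "y \<in> carrier (obj D p)" "f p x \<in> carrier (obj D p)"
        using that fz[OF x(1)] by (auto simp: cocycles_def)
      then have "y = (y \<ominus>\<^bsub>obj D p\<^esub> f p x) \<oplus>\<^bsub>obj D p\<^esub> f p x"
        by (simp add: a_minus_def N.M.a_assoc N.M.l_neg)
      then show ?thesis using x by auto
    qed
  qed (use inj in auto)
  \<comment> \<open>Restricting the carrier to cocycles does not change the operation, hence not the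
    set sums.\<close>
  moreover have "cohomology_map D f p = (\<lambda>X. coboundaries D p <#>\<^bsub>?H\<^esub> f p ` X)"
    by (auto simp: cohomology_map_def set_add_def set_mult_def fun_eq_iff)
  ultimately show "cohomology_map D f p \<in> iso (cohomology C p) (cohomology D p)"
    by (simp add: cohomology_def)
qed

section \<open>Suboperads and generation\<close>

lemma operad_hom_id: "operad_hom R P P (\<lambda>r p x. x)"
  by (auto simp: operad_hom_def cochain_map_def mod_hom_def)

lemma operad_homD:
  assumes "operad_hom R P Q f"
  shows "f r p \<in> mod_hom R (opobj P r p) (opobj Q r p)"
    "x \<in> carrier (opobj P r p) \<Longrightarrow> f r p x \<in> carrier (opobj Q r p)"
    "x \<in> carrier (opobj P r p) \<Longrightarrow> f r (p + 1) (opdiff P r p x) = opdiff Q r p (f r p x)"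
    "\<lbrakk>\<sigma> permutes {..<r}; x \<in> carrier (opobj P r p)\<rbrakk> \<Longrightarrow>
      f r p (sym_act P r p \<sigma> x) = sym_act Q r p \<sigma> (f r p x)"
    "f 1 0 (op_unit P) = op_unit Q"
    "\<lbrakk>i < r; x \<in> carrier (opobj P r p); y \<in> carrier (opobj P m q)\<rbrakk> \<Longrightarrow>
      f (r + m - 1) (p + q) (pcomp P r i m p q x y) = pcomp Q r i m p q (f r p x) (f m q y)"
  using assms by (auto simp: operad_hom_def cochain_map_def mod_hom_def Pi_iff)

lemma mod_hom_comp: "f \<in> mod_hom R A B \<Longrightarrow> g \<in> mod_hom R B C \<Longrightarrow> (\<lambda>x. g (f x)) \<in> mod_hom R A C"
  by (auto simp: mod_hom_def Pi_def)

lemma cochain_map_comp: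
  assumes "cochain_map R C D f" "cochain_map R D E g"
  shows "cochain_map R C E (\<lambda>p x. g p (f p x))"
  unfolding cochain_map_def
proof (intro conjI allI ballI)
  have f: "f p \<in> mod_hom R (obj C p) (obj D p)" and g: "g p \<in> mod_hom R (obj D p) (obj E p)" for p
    using assms by (simp_all add: cochain_map_def)
  show "(\<lambda>x. g p (f p x)) \<in> mod_hom R (obj C p) (obj E p)" for p by (rule mod_hom_comp[OF f g])
  show "g (p + 1) (f (p + 1) (differential C p x)) = differential E p (g p (f p x))"
    if "x \<in> carrier (obj C p)" for p x
    using assms mod_homD(1)[OF f that] that by (simp add: cochain_map_def)
qed

lemma operad_hom_comp:
  assumes "operad_hom R P Q f" "operad_hom R Q T g"
  shows "operad_hom R P T (\<lambda>r p x. g r p (f r p x))"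
  using operad_homD(2-6)[OF assms(1)] operad_homD(2-6)[OF assms(2)]
    mod_hom_comp[OF operad_homD(1)[OF assms(1)] operad_homD(1)[OF assms(2)]]
  unfolding operad_hom_def cochain_map_def by auto

text \<open>Serves as an induction predicate: on an operad given by generators, a suboperad that
  contains the generators is everything.\<close>

definition suboperad :: "'k ring \<Rightarrow> ('k, 'a) operad \<Rightarrow> (nat \<Rightarrow> int \<Rightarrow> 'a \<Rightarrow> bool) \<Rightarrow> bool" where
  "suboperad R P S \<longleftrightarrow>
    (\<forall>r p. S r p \<zero>\<^bsub>opobj P r p\<^esub>) \<and>
    (\<forall>r p. \<forall>x\<in>carrier (opobj P r p). \<forall>y\<in>carrier (opobj P r p).
      S r p x \<longrightarrow> S r p y \<longrightarrow> S r p (x \<oplus>\<^bsub>opobj P r p\<^esub> y)) \<and>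
    (\<forall>r p. \<forall>c\<in>carrier R. \<forall>x\<in>carrier (opobj P r p). S r p x \<longrightarrow> S r p (c \<odot>\<^bsub>opobj P r p\<^esub> x)) \<and>
    (\<forall>r p. \<forall>x\<in>carrier (opobj P r p). S r p x \<longrightarrow> S r (p + 1) (opdiff P r p x)) \<and>
    (\<forall>r p \<sigma>. \<forall>x\<in>carrier (opobj P r p). \<sigma> permutes {..<r} \<longrightarrow> S r p x \<longrightarrow> S r p (sym_act P r p \<sigma> x)) \<and>
    S 1 0 (op_unit P) \<and>
    (\<forall>r i m p q. \<forall>x\<in>carrier (opobj P r p). \<forall>y\<in>carrier (opobj P m q). i < r \<longrightarrow>
      S r p x \<longrightarrow> S m q y \<longrightarrow> S (r + m - 1) (p + q) (pcomp P r i m p q x y))"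

lemma (in presentation) suboperad_PO:
  assumes S: "suboperad R PO S" and gens: "\<And>r p g. g \<in> G r p \<Longrightarrow> S r p (cls (TGen r p g))"
    and X: "X \<in> carrier (opobj PO r p)"
  shows "S r p X"
proof -
  note s = S[unfolded suboperad_def]
  have "S (arity t) (deg t) (cls t)" if "wft t" for t
    using that
  proof (induction t)
    case (TAdd t u)
    then have c: "cls t \<in> carrier (opobj PO (arity t) (deg t))" "cls u \<in> carrier (opobj PO (arity t) (deg t))"
      by (auto intro: cls_carrier)
    have "S (arity t) (deg t) (cls t \<oplus>\<^bsub>opobj PO (arity t) (deg t)\<^esub> cls u)" using s TAdd c by auto
    then show ?case using TAdd by (simp add: ops_PO)
  next
    case (TScal a t)
    then have c: "cls t \<in> carrier (opobj PO (arity t) (deg t))" by (auto intro: cls_carrier)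
    have "S (arity t) (deg t) (a \<odot>\<^bsub>opobj PO (arity t) (deg t)\<^esub> cls t)" using s TScal c by auto
    then show ?case using TScal by (simp add: ops_PO)
  next
    case (TDiff t)
    then have c: "cls t \<in> carrier (opobj PO (arity t) (deg t))" by (auto intro: cls_carrier)
    have "S (arity t) (deg t + 1) (opdiff PO (arity t) (deg t) (cls t))" using s TDiff c by auto
    then show ?case using TDiff by (simp add: ops_PO)
  next
    case (TAct \<sigma> t)
    then have c: "cls t \<in> carrier (opobj PO (arity t) (deg t))" by (auto intro: cls_carrier)
    have "S (arity t) (deg t) (sym_act PO (arity t) (deg t) \<sigma> (cls t))" using s TAct c by auto
    then show ?case using TAct by (simp add: ops_PO)
  next
    case (TComp i t u)
    then have c: "cls t \<in> carrier (opobj PO (arity t) (deg t))" "cls u \<in> carrier (opobj PO (arity u) (deg u))"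
      by (auto intro: cls_carrier)
    have "S (arity t + arity u - 1) (deg t + deg u)
        (pcomp PO (arity t) i (arity u) (deg t) (deg u) (cls t) (cls u))"
      using s TComp c by auto
    then show ?case using TComp by (simp add: ops_PO)
  qed (use s gens in \<open>auto simp: ops_PO\<close>)
  then show ?thesis using X by (auto elim!: carrierE)
qed

lemma suboperad_pullback:
  assumes P: "operad R P" and Q: "operad R Q" and f: "operad_hom R P Q f" and S: "suboperad R Q S"
  shows "suboperad R P (\<lambda>r p x. S r p (f r p x))"
  using S operad_homD[OF f] mod_homD[OF operad_homD(1)[OF f]]
    mod_hom_zero[OF operad_homD(1)[OF f] operad.opobj_module[OF P] operad.opobj_module[OF Q]]
  unfolding suboperad_def by simp

text \<open>Generation in two stages. The preimage of \<open>S\<close> in the free operad is a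
  suboperad containing the generators from \<open>M\<close>, hence all of it; so \<open>S\<close>
  contains both families of generators of the coproduct.\<close>

lemma coproduct_free_suboperad:
  fixes R :: "'k ring" and P :: "('k, 'a) operad" and M :: "('k, 'b) cochain_complex" and n
  defines "F \<equiv> free_operad R M n"
  assumes P: "operad R P" and S: "suboperad R (operad_coproduct R P F) S"
    and inl: "\<And>r p x. x \<in> carrier (opobj P r p) \<Longrightarrow> S r p (coproduct_inl R P F r p x)"
    and gen: "\<And>p x. x \<in> carrier (obj M p) \<Longrightarrow> S n p (coproduct_inr R P F n p (free_in R M n p x))"
    and X: "X \<in> carrier (opobj (operad_coproduct R P F) r p)"
  shows "S r p X"
proof -
  interpret P: operad R P by fact
  interpret PF: presentation R "free_gens M n" "free_rel R M n" by (rule presentation.intro) (rule P.R_cring)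
  interpret PC: presentation R "coproduct_gens P F" "coproduct_rel R P F"
    by (rule presentation.intro) (rule P.R_cring)
  have F: "operad R F" using PF.operad_PO by (simp add: F_def free_operad_def)
  have S': "suboperad R F (\<lambda>r p x. S r p (coproduct_inr R P F r p x))"
    by (rule suboperad_pullback[OF F operad_operad_coproduct[OF P.R_cring] coproduct_inr_hom[OF F] S])
  have inr: "S r p (coproduct_inr R P F r p x)" if "x \<in> carrier (opobj F r p)" for r p x
  proof (rule PF.suboperad_PO)
    show "suboperad R PF.PO (\<lambda>r p x. S r p (coproduct_inr R P F r p x))"
      using S' by (simp add: F_def free_operad_def)
    show "S r p (coproduct_inr R P F r p (PF.cls (TGen r p g)))" if "g \<in> free_gens M n r p" for r p g
      using that gen[of g p] by (simp add: free_gens_def free_in_def split: if_splits)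
    show "x \<in> carrier (opobj PF.PO r p)" using that by (simp add: F_def free_operad_def)
  qed
  show ?thesis
  proof (rule PC.suboperad_PO)
    show "suboperad R PC.PO S" using S by (simp add: operad_coproduct_def)
    show "S r p (PC.cls (TGen r p g))" if "g \<in> coproduct_gens P F r p" for r p g
    proof -
      from that consider x where "x \<in> carrier (opobj P r p)" "g = Inl x"
        | x where "x \<in> carrier (opobj F r p)" "g = Inr x" unfolding coproduct_gens_def by blast
      then show ?thesis
        by cases (use inl inr in \<open>simp_all add: coproduct_inl_def coproduct_inr_def\<close>)
    qed
    show "X \<in> carrier (opobj PC.PO r p)" using X by (simp add: operad_coproduct_def)
  qed
qed

text \<open>Eigenvectors are not closed under addition, so generation is applied to their span. Sums
  suffice because the predicates used as \<open>K\<close> are themselves stable under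
  scalars.\<close>

inductive lin_span :: "('k, 'a) operad \<Rightarrow> (nat \<Rightarrow> int \<Rightarrow> 'a \<Rightarrow> bool) \<Rightarrow> nat \<Rightarrow> int \<Rightarrow> 'a \<Rightarrow> bool"
  for P K r p where
  base: "x \<in> carrier (opobj P r p) \<Longrightarrow> K r p x \<Longrightarrow> lin_span P K r p x"
| add: "lin_span P K r p x \<Longrightarrow> lin_span P K r p y \<Longrightarrow> lin_span P K r p (x \<oplus>\<^bsub>opobj P r p\<^esub> y)"

context operad
begin

lemma lin_span_closed: "lin_span P K r p x \<Longrightarrow> x \<in> carrier (opobj P r p)"
  by (induction rule: lin_span.induct) (auto intro: closures)

lemma lin_span_hom:
  assumes "lin_span P K r p x" and f: "f \<in> mod_hom R (opobj P r p) (opobj P m q)"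
    and "\<And>x. x \<in> carrier (opobj P r p) \<Longrightarrow> K r p x \<Longrightarrow> lin_span P K m q (f x)"
  shows "lin_span P K m q (f x)"
  using assms(1)
proof induction
  case (add x y)
  then show ?case using mod_homD(2)[OF f] lin_span_closed by (auto intro: lin_span.add)
qed (rule assms(3))

lemma smult_hom:
  assumes "c \<in> carrier R"
  shows "(\<lambda>x. c \<odot>\<^bsub>opobj P r p\<^esub> x) \<in> mod_hom R (opobj P r p) (opobj P r p)"
proof -
  interpret cring R by (rule R_cring)
  show ?thesis using assms by (auto simp: mod_hom_def closures opobj_smult m_comm)
qed

lemma lin_span_suboperad:
  assumes zero: "\<And>r p. K r p \<zero>\<^bsub>opobj P r p\<^esub>" and unit: "K 1 0 (op_unit P)"
    and smult: "\<And>r p c x. \<lbrakk>c \<in> carrier R; x \<in> carrier (opobj P r p); K r p x\<rbrakk> \<Longrightarrow>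
      K r p (c \<odot>\<^bsub>opobj P r p\<^esub> x)"
    and diff: "\<And>r p x. \<lbrakk>x \<in> carrier (opobj P r p); K r p x\<rbrakk> \<Longrightarrow> K r (p + 1) (opdiff P r p x)"
    and act: "\<And>r p \<sigma> x. \<lbrakk>\<sigma> permutes {..<r}; x \<in> carrier (opobj P r p); K r p x\<rbrakk> \<Longrightarrow>
      K r p (sym_act P r p \<sigma> x)"
    and comp: "\<And>r i m p q x y. \<lbrakk>i < r; x \<in> carrier (opobj P r p); y \<in> carrier (opobj P m q);
      K r p x; K m q y\<rbrakk> \<Longrightarrow> K (r + m - 1) (p + q) (pcomp P r i m p q x y)"
  shows "suboperad R P (lin_span P K)"
  unfolding suboperad_def
proof (intro conjI allI ballI impI)
  show "lin_span P K r p \<zero>\<^bsub>opobj P r p\<^esub>" for r p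
    using zero by (intro lin_span.base closures)
  show "lin_span P K 1 0 (op_unit P)" using unit by (intro lin_span.base unit_closed)
  show "lin_span P K r p (c \<odot>\<^bsub>opobj P r p\<^esub> x)" if "c \<in> carrier R" "lin_span P K r p x" for r p c x
    using that smult by (intro lin_span_hom[OF that(2) smult_hom]) (auto intro!: lin_span.base closures)
  show "lin_span P K r (p + 1) (opdiff P r p x)" if "lin_span P K r p x" for r p x
    using diff by (intro lin_span_hom[OF that opdiff_hom]) (auto intro!: lin_span.base closures)
  show "lin_span P K r p (sym_act P r p \<sigma> x)" if "\<sigma> permutes {..<r}" "lin_span P K r p x" for r p \<sigma> x
    using act that(1) by (intro lin_span_hom[OF that(2) act_hom]) (auto intro!: lin_span.base closures)
  show "lin_span P K (r + m - 1) (p + q) (pcomp P r i m p q x y)"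
    if i: "i < r" and x: "lin_span P K r p x" and y: "lin_span P K m q y" for r i m p q x y
  proof (rule lin_span_hom[OF x pcomp_hom_left[OF i lin_span_closed[OF y]]])
    \<comment> \<open>The first argument has been reduced to \<open>K\<close> with \<open>y\<close>
      still in the span; now \<open>y\<close> is reduced in the same way.\<close>
    show "lin_span P K (r + m - 1) (p + q) (pcomp P r i m p q x y)"
      if "x \<in> carrier (opobj P r p)" "K r p x" for x
      using that i comp
      by (intro lin_span_hom[OF y pcomp_hom_right]) (auto intro!: lin_span.base closures)
  qed
qed (auto intro: lin_span.add)

end
section \<open>Coproducts with a free operad on a contractible complex\<close>

definition contraction ::
    "'k ring \<Rightarrow> ('k, 'b) cochain_complex \<Rightarrow> (int \<Rightarrow> 'b \<Rightarrow> 'b) \<Rightarrow> bool" where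
  "contraction R M k \<longleftrightarrow>
    (\<forall>p. k p \<in> mod_hom R (obj M p) (obj M (p - 1))) \<and>
    (\<forall>p. \<forall>x\<in>carrier (obj M p).
      differential M (p - 1) (k p x) \<oplus>\<^bsub>obj M p\<^esub> k (p + 1) (differential M p x) = x)"

definition in_range :: "nat \<Rightarrow> nat option \<Rightarrow> bool" where
  "in_range n j \<longleftrightarrow> (case j of None \<Rightarrow> True | Some i \<Rightarrow> i < n)"

text \<open>On a generator D is the identity and H is the contraction. Compatibility with d in the
  component \<open>H\<close> says u(k(dx)) = u(x) - d(u(k x)), which is the identity dk + kd = 1. A
  path tracks the generator only through one of its \<open>n\<close> inputs.\<close>

lemma (in operad) tracked_generators:
  assumes M: "cochain_complex R M" and k: "contraction R M k" and u: "cochain_map R M (component P n) u"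
  defines "w \<equiv> \<lambda>p x. (u p x, \<lambda>e j.
    if in_range n j then (if e then u (p - 1) (k p x) else u p x) else \<zero>\<^bsub>opobj P n (p - of_bool e)\<^esub>)"
  shows "cochain_map R M (component TP n) w"
proof -
  interpret M: cochain_complex R M by fact
  have uh: "u p \<in> mod_hom R (obj M p) (opobj P n p)" for p using u by (simp add: cochain_map_def)
  have kh: "k p \<in> mod_hom R (obj M p) (obj M (p - 1))" for p using k by (simp add: contraction_def)
  note U = mod_homD[OF uh] and K = mod_homD[OF kh]
  have ud: "u (p + 1) (differential M p x) = opdiff P n p (u p x)" if "x \<in> carrier (obj M p)" for p x
    using that u by (simp add: cochain_map_def)
  have dk: "u p x \<ominus>\<^bsub>opobj P n p\<^esub> opdiff P n (p - 1) (u (p - 1) (k p x)) = u p (k (p + 1) (differential M p x))"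
    if x: "x \<in> carrier (obj M p)" for p x
  proof -
    define a b where "a = differential M (p - 1) (k p x)" and "b = k (p + 1) (differential M p x)"
    have ab: "a \<in> carrier (obj M p)" "b \<in> carrier (obj M p)"
      using K(1)[OF x] mod_homD(1)[OF M.differential_hom[of "p - 1"]]
        K(1)[OF mod_homD(1)[OF M.differential_hom x]] by (simp_all add: a_def b_def)
    have "x = a \<oplus>\<^bsub>obj M p\<^esub> b" using k x by (simp add: contraction_def a_def b_def)
    then have "u p x = u p b \<oplus>\<^bsub>opobj P n p\<^esub> u p a"
      using U(2)[OF ab] opobj_ac(1)[OF U(1)[OF ab(1)] U(1)[OF ab(2)]] by simp
    moreover have "opdiff P n (p - 1) (u (p - 1) (k p x)) = u p a"
      using ud[OF K(1)[OF x]] by (simp add: a_def)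
    ultimately show ?thesis using U(1)[OF ab(1)] U(1)[OF ab(2)]
      by (simp add: b_def[symmetric] a_minus_def opobj_ac(2) opobj_arith closures)
  qed
  have "w p x \<in> carrier (opobj TP n p)" if "x \<in> carrier (obj M p)" for p x
    using that U(1)[OF that] U(1)[OF K(1)[OF that]]
    by (intro TPI) (auto simp: w_def in_range_def zero_closed split: option.split)
  moreover have "w p (x \<oplus>\<^bsub>obj M p\<^esub> y) = w p x \<oplus>\<^bsub>opobj TP n p\<^esub> w p y"
    if "x \<in> carrier (obj M p)" "y \<in> carrier (obj M p)" for p x y
    using U(2)[OF that] U(2)[OF K(1)[OF that(1)] K(1)[OF that(2)]] K(2)[OF that]
    by (intro TP_eqI) (auto simp: w_def TP_simps opobj_arith zero_closed)
  moreover have "w p (c \<odot>\<^bsub>obj M p\<^esub> x) = c \<odot>\<^bsub>opobj TP n p\<^esub> w p x"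
    if "c \<in> carrier R" "x \<in> carrier (obj M p)" for p c x
    using U(3)[OF that] U(3)[OF that(1) K(1)[OF that(2)]] K(3)[OF that] that
    by (intro TP_eqI) (auto simp: w_def TP_simps opobj_zero_arith)
  moreover have "w (p + 1) (differential M p x) = opdiff TP n p (w p x)" if "x \<in> carrier (obj M p)" for p x
  proof (rule TP_eqI)
    show "snd (w (p + 1) (differential M p x)) e j = snd (opdiff TP n p (w p x)) e j" for e j
      using ud[OF that] dk[OF that] opdiff_zero[of n p] opdiff_zero[of n "p - 1"]
      by (cases e) (auto simp: w_def TP_simps a_minus_def opobj_zero_arith opobj_arith zero_closed)
  qed (use ud[OF that] in \<open>simp add: w_def TP_simps\<close>)
  ultimately show ?thesis unfolding cochain_map_def mod_hom_def by auto
qed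

text \<open>Operations from the given operad contain no new vertex, so D and H are set to zero on
  them; this respects composition because \<open>twist\<close> vanishes when both tracked entries
  do.\<close>

lemma (in operad) tracked_constants:
  assumes f: "operad_hom R Q P f"
  shows "operad_hom R Q TP (\<lambda>r p x. (f r p x, \<lambda>e j. \<zero>\<^bsub>opobj P r (p - of_bool e)\<^esub>))" (is "operad_hom R Q TP ?f")
proof -
  note F = operad_homD[OF f]
  note L = mod_homD[OF F(1)]
  have c: "?f r p x \<in> carrier (opobj TP r p)" if "x \<in> carrier (opobj Q r p)" for r p x
    using F(2)[OF that] by (intro TPI) (auto simp: zero_closed)
  have d: "?f r (p + 1) (opdiff Q r p x) = opdiff TP r p (?f r p x)" if "x \<in> carrier (opobj Q r p)" for r p x
  proof (rule TP_eqI)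
    show "snd (?f r (p + 1) (opdiff Q r p x)) e j = snd (opdiff TP r p (?f r p x)) e j" for e j
      using opdiff_zero[of r p] opdiff_zero[of r "p - 1"]
      by (cases e) (auto simp: TP_simps a_minus_def opobj_zero_arith opobj_arith zero_closed)
  qed (use F(3)[OF that] in \<open>simp add: TP_simps\<close>)
  have m: "?f (r + m - 1) (p + q) (pcomp Q r i m p q x y) = pcomp TP r i m p q (?f r p x) (?f m q y)"
    if i: "i < r" and "x \<in> carrier (opobj Q r p)" "y \<in> carrier (opobj Q m q)" for r i m p q x y
  proof (rule TP_eqI)
    note D = TPD[OF c[OF that(2)]] TPD[OF c[OF that(3)]]
    show "snd (?f (r + m - 1) (p + q) (pcomp Q r i m p q x y)) e j =
        snd (pcomp TP r i m p q (?f r p x) (?f m q y)) e j" for e j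
      using twist_zero[OF i D(6) D(7), where u = "of_bool e"] by (simp add: snd_pcomp_TP)
  qed (use F(6)[OF that] in \<open>simp add: TP_simps\<close>)
  show ?thesis
    unfolding operad_hom_def cochain_map_def mod_hom_def
  proof (intro conjI allI ballI impI CollectI)
    show "?f r p (sym_act Q r p \<sigma> x) = sym_act TP r p \<sigma> (?f r p x)"
      if "x \<in> carrier (opobj Q r p)" "\<sigma> permutes {..<r}" for r p \<sigma> x
      using F(4)[OF that(2,1)] by (intro TP_eqI) (simp_all add: TP_simps act_zero[OF that(2)])
    show "?f 1 0 (op_unit Q) = op_unit TP"
      using F(5) by (intro TP_eqI) (simp_all add: TP_simps)
    show "?f r p (x \<oplus>\<^bsub>opobj Q r p\<^esub> y) = ?f r p x \<oplus>\<^bsub>opobj TP r p\<^esub> ?f r p y"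
      if "x \<in> carrier (opobj Q r p)" "y \<in> carrier (opobj Q r p)" for r p x y
      using L(2)[OF that] by (intro TP_eqI) (simp_all add: TP_simps opobj_arith zero_closed)
    show "?f r p (b \<odot>\<^bsub>opobj Q r p\<^esub> x) = b \<odot>\<^bsub>opobj TP r p\<^esub> ?f r p x"
      if "b \<in> carrier R" "x \<in> carrier (opobj Q r p)" for r p b x
      using L(3)[OF that] that by (intro TP_eqI) (simp_all add: TP_simps opobj_zero_arith)
  qed (use c d m in auto)
qed

section \<open>Maps out of the coproduct\<close>

locale tracked_coproduct = P: operad R P + M: cochain_complex R M
  for R :: "'k ring" (structure) and P :: "('k, 'a) operad" and M :: "('k, 'b) cochain_complex" +
  fixes n :: nat and k :: "int \<Rightarrow> 'b \<Rightarrow> 'b"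
  assumes contraction: "contraction R M k"
begin

abbreviation "F \<equiv> free_operad R M n"
abbreviation "Q \<equiv> operad_coproduct R P F"
abbreviation "\<iota> \<equiv> coproduct_inl R P F"
abbreviation "\<kappa> p x \<equiv> coproduct_inr R P F n p (free_in R M n p x)"

lemma operad_F: "operad R F"
  unfolding free_operad_def by (intro presentation.operad_PO presentation.intro P.R_cring)

sublocale Q: operad R Q
  by (rule operad_operad_coproduct[OF P.R_cring])

lemma \<iota>_hom: "operad_hom R P Q \<iota>"
  by (rule coproduct_inl_hom) (rule P.operad_axioms)

lemma \<kappa>_map: "cochain_map R M (component Q n) \<kappa>"
proof -
  interpret PF: presentation R "free_gens M n" "free_rel R M n" by (rule presentation.intro) (rule P.R_cring)
  have "cochain_map R M (component F n) (\<lambda>p. free_in R M n p)"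
    unfolding cochain_map_def mod_hom_def free_operad_def free_in_def
    using mod_homD(1)[OF M.differential_hom]
    by (auto simp: PF.ops_PO free_gens_def module.smult_closed[OF M.obj_module]
        abelian_monoid.a_closed[OF abelian_group.axioms(1)[OF module.axioms(2)[OF M.obj_module]]] del: equalityI
        intro!: PF.cls_carrier PF.cls_eq term_eq.relation free_rel.intros)
  moreover have "cochain_map R (component F n) (component Q n) (coproduct_inr R P F n)"
    using coproduct_inr_hom[OF operad_F, of P] by (simp add: operad_hom_def)
  ultimately show ?thesis by (rule cochain_map_comp)
qed

text \<open>Joins the universal properties of the free operad and of the coproduct, so that
  uniqueness is tested on \<open>\<iota>\<close> and on the generators \<open>\<kappa>\<close>
  alone: a morphism restricted to the free operad is determined by its values on
  \<open>M\<close>.\<close>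

lemma universal:
  assumes T: "operad R T" and u: "operad_hom R P T u" and w: "cochain_map R M (component T n) w"
  obtains f where "operad_hom R Q T f"
    "\<And>r p x. x \<in> carrier (opobj P r p) \<Longrightarrow> f r p (\<iota> r p x) = u r p x"
    "\<And>p x. x \<in> carrier (obj M p) \<Longrightarrow> f n p (\<kappa> p x) = w p x"
    "\<And>g r p z. \<lbrakk>operad_hom R Q T g;
      \<And>r p x. x \<in> carrier (opobj P r p) \<Longrightarrow> g r p (\<iota> r p x) = u r p x;
      \<And>p x. x \<in> carrier (obj M p) \<Longrightarrow> g n p (\<kappa> p x) = w p x;
      z \<in> carrier (opobj Q r p)\<rbrakk> \<Longrightarrow> g r p z = f r p z"
proof -
  have fin: "free_in R M n p x \<in> carrier (opobj F n p)" if "x \<in> carrier (obj M p)" for p x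
  proof -
    interpret PF: presentation R "free_gens M n" "free_rel R M n" by (rule presentation.intro) (rule P.R_cring)
    show ?thesis using that unfolding free_operad_def free_in_def
      by (intro PF.cls_carrier) (auto simp: free_gens_def)
  qed
  from free_operad_universal[OF M.cochain_complex_axioms T w]
  obtain v where v': "operad_hom R F T v \<and>
    (\<forall>p. \<forall>x\<in>carrier (obj M p). v n p (free_in R M n p x) = w p x) \<and>
    (\<forall>g. operad_hom R F T g \<and> (\<forall>p. \<forall>x\<in>carrier (obj M p). g n p (free_in R M n p x) = w p x) \<longrightarrow>
      (\<forall>r p. \<forall>z\<in>carrier (opobj F r p). g r p z = v r p z))" ..
  note v = conjunct1[OF v'] conjunct1[OF conjunct2[OF v']]
  note vu = conjunct2[OF conjunct2[OF v']]
  from operad_coproduct_universal[OF P.operad_axioms operad_F T u v(1)]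
  obtain f where f': "operad_hom R Q T f \<and>
    (\<forall>r p. \<forall>x\<in>carrier (opobj P r p). f r p (\<iota> r p x) = u r p x) \<and>
    (\<forall>r p. \<forall>y\<in>carrier (opobj F r p). f r p (coproduct_inr R P F r p y) = v r p y) \<and>
    (\<forall>g. operad_hom R Q T g \<and> (\<forall>r p. \<forall>x\<in>carrier (opobj P r p). g r p (\<iota> r p x) = u r p x) \<and>
      (\<forall>r p. \<forall>y\<in>carrier (opobj F r p). g r p (coproduct_inr R P F r p y) = v r p y) \<longrightarrow>
      (\<forall>r p. \<forall>z\<in>carrier (opobj Q r p). g r p z = f r p z))" ..
  note f = conjunct1[OF f'] conjunct1[OF conjunct2[OF f']] conjunct1[OF conjunct2[OF conjunct2[OF f']]]
  note fu = conjunct2[OF conjunct2[OF conjunct2[OF f']]]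
  show thesis
  proof (rule that[of f])
    fix g r p z assume g: "operad_hom R Q T g"
      "\<And>r p x. x \<in> carrier (opobj P r p) \<Longrightarrow> g r p (\<iota> r p x) = u r p x"
      "\<And>p x. x \<in> carrier (obj M p) \<Longrightarrow> g n p (\<kappa> p x) = w p x" and z: "z \<in> carrier (opobj Q r p)"
    have "g r p (coproduct_inr R P F r p y) = v r p y" if "y \<in> carrier (opobj F r p)" for r p y
    proof -
      have "\<forall>p. \<forall>x\<in>carrier (obj M p). g n p (\<kappa> p x) = w p x" using g(3) by blast
      with spec[OF vu, of "\<lambda>r p x. g r p (coproduct_inr R P F r p x)"]
        operad_hom_comp[OF coproduct_inr_hom[OF operad_F] g(1)] that
      show ?thesis by blast
    qed
    then have "\<forall>r p. \<forall>y\<in>carrier (opobj F r p). g r p (coproduct_inr R P F r p y) = v r p y" by blast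
    moreover have "\<forall>r p. \<forall>x\<in>carrier (opobj P r p). g r p (\<iota> r p x) = u r p x" using g(2) by blast
    ultimately show "g r p z = f r p z" using spec[OF fu, of g] g(1) z by blast
  next
    show "f n p (\<kappa> p x) = w p x" if "x \<in> carrier (obj M p)" for p x
      using f(3) v(2) fin[OF that] that by simp
  qed (use f in \<open>blast+\<close>)
qed

text \<open>Projecting \<open>\<Phi>\<close> to first components gives an endomorphism of
  \<open>Q\<close> that fixes all generators, hence the identity. The remaining components of
  \<open>\<Phi>\<close> are thus operators on \<open>Q\<close> itself.\<close>

lemma tracking:
  obtains \<Phi> where "operad_hom R Q Q.TP \<Phi>"
    "\<And>r p z. z \<in> carrier (opobj Q r p) \<Longrightarrow> fst (\<Phi> r p z) = z"
    "\<And>r p x e j. x \<in> carrier (opobj P r p) \<Longrightarrow> snd (\<Phi> r p (\<iota> r p x)) e j = \<zero>\<^bsub>opobj Q r (p - of_bool e)\<^esub>"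
    "\<And>p x j. \<lbrakk>x \<in> carrier (obj M p); in_range n j\<rbrakk> \<Longrightarrow> snd (\<Phi> n p (\<kappa> p x)) False j = \<kappa> p x"
proof (rule universal[OF Q.operad_TP Q.tracked_constants[OF \<iota>_hom]
      Q.tracked_generators[OF M.cochain_complex_axioms contraction \<kappa>_map]])
  fix \<Phi> assume \<Phi>: "operad_hom R Q Q.TP \<Phi>"
    "\<And>r p x. x \<in> carrier (opobj P r p) \<Longrightarrow> \<Phi> r p (\<iota> r p x) = (\<iota> r p x, \<lambda>e j. \<zero>\<^bsub>opobj Q r (p - of_bool e)\<^esub>)"
    "\<And>p x. x \<in> carrier (obj M p) \<Longrightarrow> \<Phi> n p (\<kappa> p x) = (\<kappa> p x, \<lambda>e j.
      if in_range n j then (if e then \<kappa> (p - 1) (k p x) else \<kappa> p x) else \<zero>\<^bsub>opobj Q n (p - of_bool e)\<^esub>)"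
  have fst: "fst (\<Phi> r p z) = z" if z: "z \<in> carrier (opobj Q r p)" for r p z
  proof (rule universal[OF Q.operad_axioms \<iota>_hom \<kappa>_map])
    fix f assume f: "\<And>g r p z. \<lbrakk>operad_hom R Q Q g;
        \<And>r p x. x \<in> carrier (opobj P r p) \<Longrightarrow> g r p (\<iota> r p x) = \<iota> r p x;
        \<And>p x. x \<in> carrier (obj M p) \<Longrightarrow> g n p (\<kappa> p x) = \<kappa> p x;
        z \<in> carrier (opobj Q r p)\<rbrakk> \<Longrightarrow> g r p z = f r p z"
    have "fst (\<Phi> r p z) = f r p z"
      by (rule f[OF operad_hom_comp[OF \<Phi>(1) Q.fst_TP_hom] _ _ z]) (simp_all add: \<Phi>(2,3))
    also have "\<dots> = z" by (rule f[OF operad_hom_id _ _ z, symmetric]) simp_all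
    finally show ?thesis .
  qed
  show thesis
  proof (rule that[OF \<Phi>(1) fst])
    show "snd (\<Phi> r p (\<iota> r p x)) e j = \<zero>\<^bsub>opobj Q r (p - of_bool e)\<^esub>"
      if "x \<in> carrier (opobj P r p)" for r p x e j using \<Phi>(2)[OF that] by simp
    show "snd (\<Phi> n p (\<kappa> p x)) False j = \<kappa> p x"
      if "x \<in> carrier (obj M p)" "in_range n j" for p x j using \<Phi>(3)[OF that(1)] that(2) by simp
  qed
qed

text \<open>Sends the new generators to zero. It gives injectivity in cohomology, and subtracting
  \<iota>\<pi>z from z removes the part of z without new vertices.\<close>

lemma retraction:
  obtains \<pi> where "operad_hom R Q P \<pi>"
    "\<And>r p x. x \<in> carrier (opobj P r p) \<Longrightarrow> \<pi> r p (\<iota> r p x) = x"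
    "\<And>p x. x \<in> carrier (obj M p) \<Longrightarrow> \<pi> n p (\<kappa> p x) = \<zero>\<^bsub>opobj P n p\<^esub>"
proof -
  have "cochain_map R M (component P n) (\<lambda>p x. \<zero>\<^bsub>opobj P n p\<^esub>)"
    using P.opdiff_zero by (auto simp: cochain_map_def mod_hom_def P.zero_closed P.opobj_arith P.opobj_zero_arith)
  note zero = this
  show thesis
  proof (rule universal[OF P.operad_axioms operad_hom_id zero])
    fix f assume "operad_hom R Q P f" "\<And>r p x. x \<in> carrier (opobj P r p) \<Longrightarrow> f r p (\<iota> r p x) = x"
      "\<And>p x. x \<in> carrier (obj M p) \<Longrightarrow> f n p (\<kappa> p x) = \<zero>\<^bsub>opobj P n p\<^esub>"
    then show thesis by (rule that)
  qed
qed

end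

section \<open>Eigenvectors and acyclicity\<close>

text \<open>All that the cohomological argument uses of the coproduct: \<open>P\<close> is a retract
  of \<open>Q\<close>, and the projection from the tracking operad of \<open>Q\<close> has a section
  that is trivial on \<open>P\<close>.\<close>

locale tracked_retract = P: operad R P + Q: operad R Q
  for R :: "'k ring" (structure) and P :: "('k, 'a) operad" and Q :: "('k, 'c) operad" +
  fixes \<iota> :: "nat \<Rightarrow> int \<Rightarrow> 'a \<Rightarrow> 'c" and \<pi> :: "nat \<Rightarrow> int \<Rightarrow> 'c \<Rightarrow> 'a"
    and \<Phi> :: "nat \<Rightarrow> int \<Rightarrow> 'c \<Rightarrow> 'c \<times> (bool \<Rightarrow> nat option \<Rightarrow> 'c)"
  assumes \<iota>: "operad_hom R P Q \<iota>" and \<pi>: "operad_hom R Q P \<pi>"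
    and \<pi>_\<iota>: "x \<in> carrier (opobj P r p) \<Longrightarrow> \<pi> r p (\<iota> r p x) = x"
    and \<Phi>: "operad_hom R Q Q.TP \<Phi>"
    and fst_\<Phi>: "z \<in> carrier (opobj Q r p) \<Longrightarrow> fst (\<Phi> r p z) = z"
    and \<Phi>_\<iota>: "x \<in> carrier (opobj P r p) \<Longrightarrow>
      snd (\<Phi> r p (\<iota> r p x)) e j = \<zero>\<^bsub>opobj Q r (p - of_bool e)\<^esub>"
begin

section \<open>The operators D and H on \<open>Q\<close>\<close>

definition D :: "nat \<Rightarrow> int \<Rightarrow> nat option \<Rightarrow> 'c \<Rightarrow> 'c" where
  "D r p j z = snd (\<Phi> r p z) False j"

definition H :: "nat \<Rightarrow> int \<Rightarrow> nat option \<Rightarrow> 'c \<Rightarrow> 'c" where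
  "H r p j z = snd (\<Phi> r p z) True j"

lemmas \<Phi>_closed = operad_homD(2)[OF \<Phi>]
lemmas \<Phi>D = Q.TPD[OF \<Phi>_closed]

lemma D_closed: "z \<in> carrier (opobj Q r p) \<Longrightarrow> D r p j z \<in> carrier (opobj Q r p)"
  and H_closed: "z \<in> carrier (opobj Q r p) \<Longrightarrow> H r p j z \<in> carrier (opobj Q r (p - 1))"
  by (simp_all add: D_def H_def \<Phi>D)

lemma D_hom: "D r p j \<in> mod_hom R (opobj Q r p) (opobj Q r p)"
  using mod_homD(2,3)[OF operad_homD(1)[OF \<Phi>, of r p]]
    Q.TP_simps(4)[where e = False] Q.TP_simps(6)[where e = False]
  by (auto simp: mod_hom_def D_closed[unfolded D_def] D_def)

lemma D_\<iota>: "x \<in> carrier (opobj P r p) \<Longrightarrow> D r p j (\<iota> r p x) = \<zero>\<^bsub>opobj Q r p\<^esub>"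
  using \<Phi>_\<iota>[of x r p False] by (simp add: D_def)

lemma D_opdiff: "z \<in> carrier (opobj Q r p) \<Longrightarrow> D r (p + 1) j (opdiff Q r p z) = opdiff Q r p (D r p j z)"
  by (simp add: D_def operad_homD(3)[OF \<Phi>] Q.TP_simps)

text \<open>The component \<open>H\<close> of \<Phi>(dz) = d(\<Phi> z) reads H(dz) = Dz - d(Hz), and
  the left side is zero.\<close>

lemma D_cocycle:
  assumes z: "z \<in> cocycles (component Q r) p"
  shows "D r p j z = opdiff Q r (p - 1) (H r p j z)"
proof -
  interpret N: module R "opobj Q r p" by (rule Q.opobj_module)
  have z': "z \<in> carrier (opobj Q r p)" "opdiff Q r p z = \<zero>\<^bsub>opobj Q r (p + 1)\<^esub>"
    using z by (auto simp: cocycles_def)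
  have "snd (\<Phi> r (p + 1) (opdiff Q r p z)) True j = \<zero>\<^bsub>opobj Q r p\<^esub>"
    using mod_hom_zero[OF operad_homD(1)[OF \<Phi>] Q.opobj_module Q.module_TP, of r "p + 1"] Q.TP_simps(2)[of r "p + 1" True]
    by (simp add: z')
  then have "D r p j z \<ominus>\<^bsub>opobj Q r p\<^esub> opdiff Q r (p - 1) (H r p j z) = \<zero>\<^bsub>opobj Q r p\<^esub>"
    by (simp add: operad_homD(3)[OF \<Phi> z'(1)] Q.TP_simps D_def H_def)
  moreover have "opdiff Q r (p - 1) (H r p j z) \<in> carrier (opobj Q r p)"
    by (intro Q.closures H_closed z') simp
  ultimately show ?thesis
    using D_closed[OF z'(1), of j] N.M.a_assoc[of "D r p j z" "\<ominus>\<^bsub>opobj Q r p\<^esub> opdiff Q r (p - 1) (H r p j z)"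
        "opdiff Q r (p - 1) (H r p j z)"]
    by (simp add: a_minus_def N.M.l_neg)
qed

lemma D_out_of_range: "z \<in> carrier (opobj Q r p) \<Longrightarrow> r \<le> j \<Longrightarrow> D r p (Some j) z = \<zero>\<^bsub>opobj Q r p\<^esub>"
  using \<Phi>D(5)[of z r p j False] by (simp add: D_def)

lemma D_act:
  "\<lbrakk>\<sigma> permutes {..<r}; z \<in> carrier (opobj Q r p)\<rbrakk> \<Longrightarrow>
    D r p j (sym_act Q r p \<sigma> z) = sym_act Q r p \<sigma> (D r p (map_option \<sigma> j) z)"
  by (simp add: D_def operad_homD(4)[OF \<Phi>] Q.TP_simps)

lemma D_pcomp:
  assumes "i < r" and x: "x \<in> carrier (opobj Q r p)" and y: "y \<in> carrier (opobj Q m q)"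
  shows "D (r + m - 1) (p + q) j (pcomp Q r i m p q x y) =
    pcomp Q r i m p q (D r p (left_index m i j) x) y \<oplus>\<^bsub>opobj Q (r + m - 1) (p + q)\<^esub>
    pcomp Q r i m p q (if j = None then x else x \<ominus>\<^bsub>opobj Q r p\<^esub> D r p (left_index m i j) x)
      (D m q (right_index m i j) y)"
proof -
  have k: "kept Q r p (\<Phi> r p x) (left_index m i j) =
      (if j = None then x else x \<ominus>\<^bsub>opobj Q r p\<^esub> D r p (left_index m i j) x)" (is "_ = ?K")
    using fst_\<Phi>[OF x] by (auto simp: kept_def D_def left_index_def split: option.split)
  have "?K \<in> carrier (opobj Q r p)" using k \<Phi>D(6)[OF x] by metis
  then have "pcomp Q r i m p q ?K (D m q (right_index m i j) y) \<in> carrier (opobj Q (r + m - 1) (p + q))"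
    using assms D_closed[OF y] by (intro Q.closures) auto
  then have one: "koszul_sign R 0 \<odot>\<^bsub>opobj Q (r + m - 1) (p + q)\<^esub> pcomp Q r i m p q ?K (D m q (right_index m i j) y) =
      pcomp Q r i m p q ?K (D m q (right_index m i j) y)"
    using Q.opobj_arith(6) by (simp add: koszul_sign_def)
  have "D (r + m - 1) (p + q) j (pcomp Q r i m p q x y) =
      snd (pcomp Q.TP r i m p q (\<Phi> r p x) (\<Phi> m q y)) False j"
    using operad_homD(6)[OF \<Phi> assms] by (simp add: D_def)
  also have "\<dots> = pcomp Q r i m p q (D r p (left_index m i j) x) y \<oplus>\<^bsub>opobj Q (r + m - 1) (p + q)\<^esub>
      koszul_sign R 0 \<odot>\<^bsub>opobj Q (r + m - 1) (p + q)\<^esub> pcomp Q r i m p q ?K (D m q (right_index m i j) y)"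
    unfolding Q.TP_simps(15) k using fst_\<Phi>[OF y] by (simp add: D_def)
  finally show ?thesis unfolding one .
qed

lemma \<iota>_\<pi>_hom: "(\<lambda>z. \<iota> r p (\<pi> r p z)) \<in> mod_hom R (opobj Q r p) (opobj Q r p)"
  by (rule mod_hom_comp[OF operad_homD(1)[OF \<pi>] operad_homD(1)[OF \<iota>]])

text \<open>The composite of the maps D - c, where D is taken at \<open>J t\<close> and c is
  \<open>c t\<close>. Since D vanishes on cohomology, each factor acts there as the unit -c; on an
  eigenvector with eigenvalue c it is zero. Confronting these two facts gives acyclicity in both
  cases of the theorem.\<close>

fun annihilate :: "nat \<Rightarrow> int \<Rightarrow> (nat \<Rightarrow> nat option) \<Rightarrow> (nat \<Rightarrow> 'k) \<Rightarrow> nat \<Rightarrow> 'c \<Rightarrow> 'c" where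
  "annihilate r p J c 0 z = z"
| "annihilate r p J c (Suc t) z =
    D r p (J t) (annihilate r p J c t z) \<ominus>\<^bsub>opobj Q r p\<^esub> c t \<odot>\<^bsub>opobj Q r p\<^esub> annihilate r p J c t z"

context
  fixes J :: "nat \<Rightarrow> nat option" and c :: "nat \<Rightarrow> 'k"
  assumes c: "\<And>t. c t \<in> Units R"
begin

interpretation cring R by (rule Q.R_cring)

lemma c_closed: "c t \<in> carrier R"
  using c by blast

lemma annihilate_hom: "annihilate r p J c N \<in> mod_hom R (opobj Q r p) (opobj Q r p)"
proof (induction N)
  case 0
  have "annihilate r p J c 0 = (\<lambda>z. z)" by (simp add: fun_eq_iff)
  then show ?case by (simp add: mod_hom_def)
next
  case (Suc N)
  note A = mod_homD[OF Suc]
  note E = mod_homD[OF D_hom]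
  show ?case
    by (auto simp: mod_hom_def A E Q.closures c_closed a_minus_def Q.opobj_ac Q.opobj_smult m_comm)
qed

lemma annihilate_cocycle:
  assumes "z \<in> cocycles (component Q r) p"
  shows "annihilate r p J c N z \<in> cocycles (component Q r) p"
proof (induction N)
  case (Suc N)
  define y where "y = annihilate r p J c N z"
  have y: "y \<in> carrier (opobj Q r p)" "opdiff Q r p y = \<zero>\<^bsub>opobj Q r (p + 1)\<^esub>"
    using Suc by (auto simp: cocycles_def y_def)
  have "opdiff Q r p (D r p (J N) y) = \<zero>\<^bsub>opobj Q r (p + 1)\<^esub>"
    using D_opdiff[OF y(1), of "J N"] mod_hom_zero[OF D_hom Q.opobj_module Q.opobj_module] by (simp add: y(2))
  then show ?case
    using y D_closed[OF y(1)]
    by (simp add: y_def[symmetric] cocycles_def a_minus_def Q.closures c_closed Q.opdiff_simps Q.opdiff_neg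
      Q.opobj_arith Q.opobj_zero_arith)
qed (use assms in simp)

text \<open>One factor is undone at a time: if Dy - cy = db, then Dy = dh with h = Hy gives cy = d(h
  - b), and c is invertible.\<close>

lemma annihilate_coboundary:
  assumes z: "z \<in> cocycles (component Q r) p"
    and "annihilate r p J c N z \<in> coboundaries (component Q r) p"
  shows "z \<in> coboundaries (component Q r) p"
  using assms(2)
proof (induction N)
  case (Suc N)
  let ?B = "coboundaries (component Q r) p"
  define y where "y = annihilate r p J c N z"
  have yz: "y \<in> cocycles (component Q r) p" unfolding y_def by (rule annihilate_cocycle[OF z])
  then have y: "y \<in> carrier (opobj Q r p)" by (simp add: cocycles_def)
  interpret N: module R "opobj Q r p" by (rule Q.opobj_module)
  have d: "opdiff Q r (p - 1) \<in> mod_hom R (opobj Q r (p - 1)) (opobj Q r p)"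
    using Q.opdiff_hom[of r "p - 1"] by simp
  obtain b where b: "b \<in> carrier (opobj Q r (p - 1))"
    "D r p (J N) y \<ominus>\<^bsub>opobj Q r p\<^esub> c N \<odot>\<^bsub>opobj Q r p\<^esub> y = opdiff Q r (p - 1) b"
    using Suc.prems by (auto simp: coboundaries_def y_def)
  let ?h = "H r p (J N) y"
  have h: "?h \<in> carrier (opobj Q r (p - 1))" using H_closed[OF y] .
  have cy: "c N \<odot>\<^bsub>opobj Q r p\<^esub> y \<in> carrier (opobj Q r p)" using y c_closed by auto
  have "c N \<odot>\<^bsub>opobj Q r p\<^esub> y = D r p (J N) y \<ominus>\<^bsub>opobj Q r p\<^esub>
      (D r p (J N) y \<ominus>\<^bsub>opobj Q r p\<^esub> c N \<odot>\<^bsub>opobj Q r p\<^esub> y)"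
    using D_closed[OF y, of "J N"] cy by (simp add: a_minus_def N.M.minus_add N.M.r_neg2)
  also have "\<dots> = opdiff Q r (p - 1) (?h \<oplus>\<^bsub>opobj Q r (p - 1)\<^esub> \<ominus>\<^bsub>opobj Q r (p - 1)\<^esub> b)"
    using h b mod_homD(2)[OF d] mod_hom_neg[OF d Q.opobj_module Q.opobj_module]
    by (simp add: D_cocycle[OF yz, of "J N"] a_minus_def Q.neg_closed)
  finally have e: "c N \<odot>\<^bsub>opobj Q r p\<^esub> y =
    opdiff Q r (p - 1) (?h \<oplus>\<^bsub>opobj Q r (p - 1)\<^esub> \<ominus>\<^bsub>opobj Q r (p - 1)\<^esub> b)" .
  have i: "inv (c N) \<in> carrier R" "inv (c N) \<otimes> c N = \<one>" using c by auto
  have "y = inv (c N) \<odot>\<^bsub>opobj Q r p\<^esub> (c N \<odot>\<^bsub>opobj Q r p\<^esub> y)"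
    using y i c_closed by (simp add: N.smult_assoc1[symmetric])
  also have "\<dots> = opdiff Q r (p - 1) (inv (c N) \<odot>\<^bsub>opobj Q r (p - 1)\<^esub>
      (?h \<oplus>\<^bsub>opobj Q r (p - 1)\<^esub> \<ominus>\<^bsub>opobj Q r (p - 1)\<^esub> b))"
    using e i h b mod_homD(3)[OF d] by (simp add: Q.closures)
  finally have "y \<in> ?B"
    unfolding coboundaries_def using i h b by (auto intro!: imageI Q.closures)
  then show ?case using Suc.IH by (simp add: y_def)
qed simp

lemma annihilate_mono:
  assumes "annihilate r p J c N z = \<zero>\<^bsub>opobj Q r p\<^esub>" "N \<le> N'"
  shows "annihilate r p J c N' z = \<zero>\<^bsub>opobj Q r p\<^esub>"
  using assms(2)
proof (induction rule: dec_induct)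
  case (step N')
  then show ?case
    using mod_hom_zero[OF D_hom Q.opobj_module Q.opobj_module]
    by (simp add: a_minus_def Q.opobj_zero_arith Q.opobj_arith Q.zero_closed c_closed)
qed (rule assms(1))

text \<open>As \<open>z\<close> is an eigenvector of every operator involved, the factors before
  \<open>t\<close> only rescale it, and the factor \<open>t\<close> still meets a multiple of
  \<open>z\<close>.\<close>

lemma annihilate_eigenvector:
  assumes z: "z \<in> carrier (opobj Q r p)"
    and ev: "\<And>s. \<exists>\<mu>\<in>carrier R. D r p (J s) z = \<mu> \<odot>\<^bsub>opobj Q r p\<^esub> z"
    and t: "D r p (J t) z = c t \<odot>\<^bsub>opobj Q r p\<^esub> z"
  shows "annihilate r p J c (Suc t) z = \<zero>\<^bsub>opobj Q r p\<^esub>"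
proof -
  interpret N: module R "opobj Q r p" by (rule Q.opobj_module)
  have "\<exists>a\<in>carrier R. annihilate r p J c N z = a \<odot>\<^bsub>opobj Q r p\<^esub> z" for N
  proof (induction N)
    case 0
    show ?case using z by (intro bexI[of _ \<one>]) auto
  next
    case (Suc N)
    then obtain a where a: "a \<in> carrier R" "annihilate r p J c N z = a \<odot>\<^bsub>opobj Q r p\<^esub> z" by blast
    obtain \<mu> where \<mu>: "\<mu> \<in> carrier R" "D r p (J N) z = \<mu> \<odot>\<^bsub>opobj Q r p\<^esub> z" using ev by blast
    have "annihilate r p J c (Suc N) z = (a \<otimes> \<mu> \<ominus> c N \<otimes> a) \<odot>\<^bsub>opobj Q r p\<^esub> z"
      using a \<mu> z c_closed mod_homD(3)[OF D_hom]
      by (simp add: a_minus_def N.smult_l_distr N.smult_l_minus N.smult_assoc1)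
    then show ?case using a \<mu> c_closed by (intro bexI[of _ "a \<otimes> \<mu> \<ominus> c N \<otimes> a"]) auto
  qed
  then obtain a where a: "a \<in> carrier R" "annihilate r p J c t z = a \<odot>\<^bsub>opobj Q r p\<^esub> z" by blast
  then show ?thesis
    using t z c_closed mod_homD(3)[OF D_hom]
    by (simp add: N.smult_assoc1[symmetric] m_comm a_minus_def N.M.r_neg)
qed

text \<open>On spanning elements z - \<iota>\<pi>z is zero or an eigenvector, so each such
  difference is killed by some \<open>annihilate\<close>. If z is a cocycle, the difference is
  therefore a coboundary, which is surjectivity in cohomology. Injectivity comes from
  \<open>\<pi>\<close>.\<close>

lemma quasi_isomorphism_of_eigenvectors:
  assumes span: "\<And>r p z. z \<in> carrier (opobj Q r p) \<Longrightarrow> lin_span Q K r p z"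
    and K: "\<And>r p z. \<lbrakk>z \<in> carrier (opobj Q r p); K r p z\<rbrakk> \<Longrightarrow>
      z \<in> \<iota> r p ` carrier (opobj P r p) \<or> \<pi> r p z = \<zero>\<^bsub>opobj P r p\<^esub> \<and>
        (\<forall>s. \<exists>\<mu>\<in>carrier R. D r p (J s) z = \<mu> \<odot>\<^bsub>opobj Q r p\<^esub> z) \<and>
        (\<exists>t. D r p (J t) z = c t \<odot>\<^bsub>opobj Q r p\<^esub> z)"
  shows "componentwise_quasi_isomorphism R P Q \<iota>"
  unfolding componentwise_quasi_isomorphism_def
proof (intro conjI allI \<iota>)
  fix r
  have dz: "\<exists>N. annihilate r p J c N (z \<ominus>\<^bsub>opobj Q r p\<^esub> \<iota> r p (\<pi> r p z)) = \<zero>\<^bsub>opobj Q r p\<^esub>"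
    if "lin_span Q K r p z" for p z
    using that
  proof induction
    case (base z)
    have \<iota>0: "\<iota> r p \<zero>\<^bsub>opobj P r p\<^esub> = \<zero>\<^bsub>opobj Q r p\<^esub>"
      by (rule mod_hom_zero[OF operad_homD(1)[OF \<iota>] P.opobj_module Q.opobj_module])
    from K[OF base] show ?case
    proof (elim disjE conjE exE)
      assume "z \<in> \<iota> r p ` carrier (opobj P r p)"
      then have "z \<ominus>\<^bsub>opobj Q r p\<^esub> \<iota> r p (\<pi> r p z) = \<zero>\<^bsub>opobj Q r p\<^esub>"
        using \<pi>_\<iota> base by (auto simp: a_minus_def Q.opobj_arith)
      then show ?thesis by (intro exI[of _ 0]) simp
    next
      fix t assume "\<pi> r p z = \<zero>\<^bsub>opobj P r p\<^esub>" "D r p (J t) z = c t \<odot>\<^bsub>opobj Q r p\<^esub> z"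
        "\<forall>s. \<exists>\<mu>\<in>carrier R. D r p (J s) z = \<mu> \<odot>\<^bsub>opobj Q r p\<^esub> z"
      then show ?thesis
        using annihilate_eigenvector[OF base(1), of t] base(1)
        by (intro exI[of _ "Suc t"]) (simp add: a_minus_def Q.opobj_arith Q.opobj_zero_arith \<iota>0 del: annihilate.simps)
    qed
  next
    case (add x y)
    define x' y' where "x' = x \<ominus>\<^bsub>opobj Q r p\<^esub> \<iota> r p (\<pi> r p x)" and "y' = y \<ominus>\<^bsub>opobj Q r p\<^esub> \<iota> r p (\<pi> r p y)"
    have xy: "x \<in> carrier (opobj Q r p)" "y \<in> carrier (opobj Q r p)" using add Q.lin_span_closed by auto
    note ip = mod_homD[OF \<iota>_\<pi>_hom]
    have xy': "x' \<in> carrier (opobj Q r p)" "y' \<in> carrier (opobj Q r p)"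
      using xy ip(1) by (auto simp: x'_def y'_def Q.closures)
    have e: "(x \<oplus>\<^bsub>opobj Q r p\<^esub> y) \<ominus>\<^bsub>opobj Q r p\<^esub> \<iota> r p (\<pi> r p (x \<oplus>\<^bsub>opobj Q r p\<^esub> y)) = x' \<oplus>\<^bsub>opobj Q r p\<^esub> y'"
      using xy ip(1) ip(2)[OF xy] by (simp add: x'_def y'_def a_minus_def Q.opobj_ac Q.closures)
    from add obtain N N' where "annihilate r p J c N x' = \<zero>\<^bsub>opobj Q r p\<^esub>" "annihilate r p J c N' y' = \<zero>\<^bsub>opobj Q r p\<^esub>"
      unfolding x'_def y'_def by blast
    \<comment> \<open>The two summands may need different numbers of factors; further factors do no
      harm.\<close>
    then have "annihilate r p J c (max N N') x' = \<zero>\<^bsub>opobj Q r p\<^esub>" "annihilate r p J c (max N N') y' = \<zero>\<^bsub>opobj Q r p\<^esub>"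
      using annihilate_mono by auto
    then have "annihilate r p J c (max N N') (x' \<oplus>\<^bsub>opobj Q r p\<^esub> y') = \<zero>\<^bsub>opobj Q r p\<^esub>"
      using mod_homD(2)[OF annihilate_hom xy'] by (simp add: Q.opobj_arith Q.zero_closed)
    then show ?case unfolding e by blast
  qed
  show "quasi_isomorphism R (component P r) (component Q r) (\<iota> r)"
  proof (rule quasi_isomorphismI[OF P.component_complex Q.component_complex])
    show "cochain_map R (component P r) (component Q r) (\<iota> r)"
      using \<iota> by (simp add: operad_hom_def)
    show "x \<in> coboundaries (component P r) p"
      if "x \<in> cocycles (component P r) p" "\<iota> r p x \<in> coboundaries (component Q r) p" for p x
    proof -
      from that(2) obtain b where b: "b \<in> carrier (opobj Q r (p - 1))" "\<iota> r p x = opdiff Q r (p - 1) b"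
        unfolding coboundaries_def by (rule imageE)
      have "x = \<pi> r p (\<iota> r p x)" using that(1) \<pi>_\<iota> by (simp add: cocycles_def)
      also have "\<dots> = opdiff P r (p - 1) (\<pi> r (p - 1) b)"
        using operad_homD(3)[OF \<pi> b(1)] b(2) by simp
      finally show ?thesis using operad_homD(2)[OF \<pi> b(1)] unfolding coboundaries_def by blast
    qed
    show "\<exists>x\<in>cocycles (component P r) p. z \<ominus>\<^bsub>opobj Q r p\<^esub> \<iota> r p x \<in> coboundaries (component Q r) p"
      if z: "z \<in> cocycles (component Q r) p" for p z
    proof -
      have z': "z \<in> carrier (opobj Q r p)" "opdiff Q r p z = \<zero>\<^bsub>opobj Q r (p + 1)\<^esub>"
        using z by (auto simp: cocycles_def)
      note p = operad_homD(2)[OF \<pi> z'(1)] operad_homD(3)[OF \<pi> z'(1)]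
      have \<pi>z: "opdiff P r p (\<pi> r p z) = \<zero>\<^bsub>opobj P r (p + 1)\<^esub>"
        using p(2) z'(2) mod_hom_zero[OF operad_homD(1)[OF \<pi>] Q.opobj_module P.opobj_module] by simp
      have i: "\<iota> r p (\<pi> r p z) \<in> carrier (opobj Q r p)"
        "opdiff Q r p (\<iota> r p (\<pi> r p z)) = \<zero>\<^bsub>opobj Q r (p + 1)\<^esub>"
        using operad_homD(2)[OF \<iota> p(1)] operad_homD(3)[OF \<iota> p(1)] \<pi>z
          mod_hom_zero[OF operad_homD(1)[OF \<iota>] P.opobj_module Q.opobj_module] by auto
      define y where "y = z \<ominus>\<^bsub>opobj Q r p\<^esub> \<iota> r p (\<pi> r p z)"
      have y: "y \<in> cocycles (component Q r) p"
        using z' i by (simp add: y_def cocycles_def a_minus_def Q.closures Q.opdiff_simps Q.opdiff_neg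
          Q.opobj_arith Q.opobj_zero_arith)
      obtain N where N: "annihilate r p J c N y = \<zero>\<^bsub>opobj Q r p\<^esub>"
        using dz[OF span[OF z'(1)]] unfolding y_def by blast
      have "\<zero>\<^bsub>opobj Q r p\<^esub> \<in> coboundaries (component Q r) p"
        using Q.opdiff_zero[of r "p - 1"] Q.zero_closed[of r "p - 1"] by (force simp: coboundaries_def)
      then have "y \<in> coboundaries (component Q r) p"
        using annihilate_coboundary[OF y, of N] N by simp
      then show ?thesis
        using p(1) \<pi>z unfolding y_def by (intro bexI[of _ "\<pi> r p z"]) (auto simp: cocycles_def)
    qed
  qed
qed

end

end

section \<open>The image of \<open>P\<close>, the kernel of the retraction, and spanning
  eigenvectors\<close>

context tracked_retract
begin

lemma image_zero: "\<zero>\<^bsub>opobj Q r p\<^esub> \<in> \<iota> r p ` carrier (opobj P r p)"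
  using mod_hom_zero[OF operad_homD(1)[OF \<iota>] P.opobj_module Q.opobj_module, of r p] P.zero_closed
  by (metis imageI)

lemma image_unit: "op_unit Q \<in> \<iota> 1 0 ` carrier (opobj P 1 0)"
  using operad_homD(5)[OF \<iota>] P.unit_closed by (metis imageI)

lemma image_smult:
  "\<lbrakk>z \<in> \<iota> r p ` carrier (opobj P r p); c \<in> carrier R\<rbrakk> \<Longrightarrow>
    c \<odot>\<^bsub>opobj Q r p\<^esub> z \<in> \<iota> r p ` carrier (opobj P r p)"
  using mod_homD(3)[OF operad_homD(1)[OF \<iota>], symmetric] P.closed_facts(2) by auto

lemma image_opdiff:
  "z \<in> \<iota> r p ` carrier (opobj P r p) \<Longrightarrow>
    opdiff Q r p z \<in> \<iota> r (p + 1) ` carrier (opobj P r (p + 1))"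
  using operad_homD(3)[OF \<iota>, symmetric] P.opdiff_closed by auto

lemma image_act:
  "\<lbrakk>z \<in> \<iota> r p ` carrier (opobj P r p); \<sigma> permutes {..<r}\<rbrakk> \<Longrightarrow>
    sym_act Q r p \<sigma> z \<in> \<iota> r p ` carrier (opobj P r p)"
  using operad_homD(4)[OF \<iota>, symmetric] P.act_simps(1) by auto

lemma image_pcomp:
  assumes "x \<in> \<iota> r p ` carrier (opobj P r p)" "y \<in> \<iota> m q ` carrier (opobj P m q)" "i < r"
  shows "pcomp Q r i m p q x y \<in> \<iota> (r + m - 1) (p + q) ` carrier (opobj P (r + m - 1) (p + q))"
proof -
  from assms obtain a b where "a \<in> carrier (opobj P r p)" "x = \<iota> r p a"
    "b \<in> carrier (opobj P m q)" "y = \<iota> m q b" by blast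
  then show ?thesis
    using operad_homD(6)[OF \<iota> assms(3), symmetric] P.pcomp_left_simps(1)[OF assms(3)] by simp
qed

lemma D_image: "z \<in> \<iota> r p ` carrier (opobj P r p) \<Longrightarrow> D r p j z = \<zero>\<^bsub>opobj Q r p\<^esub>"
  using D_\<iota> by blast

lemma image_closed: "z \<in> \<iota> r p ` carrier (opobj P r p) \<Longrightarrow> z \<in> carrier (opobj Q r p)"
  using operad_homD(2)[OF \<iota>] by blast

text \<open>The kernel of a morphism is an ideal: one factor in it puts the composite in it.\<close>

lemma \<pi>_zero:
  assumes z: "z \<in> carrier (opobj Q r p)" "\<pi> r p z = \<zero>\<^bsub>opobj P r p\<^esub>"
  shows "c \<in> carrier R \<Longrightarrow> \<pi> r p (c \<odot>\<^bsub>opobj Q r p\<^esub> z) = \<zero>\<^bsub>opobj P r p\<^esub>"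
    "\<pi> r (p + 1) (opdiff Q r p z) = \<zero>\<^bsub>opobj P r (p + 1)\<^esub>"
    "\<sigma> permutes {..<r} \<Longrightarrow> \<pi> r p (sym_act Q r p \<sigma> z) = \<zero>\<^bsub>opobj P r p\<^esub>"
    "\<lbrakk>y \<in> carrier (opobj Q m q); i < r\<rbrakk> \<Longrightarrow>
      \<pi> (r + m - 1) (p + q) (pcomp Q r i m p q z y) = \<zero>\<^bsub>opobj P (r + m - 1) (p + q)\<^esub>"
    "\<lbrakk>y \<in> carrier (opobj Q m q); i < m\<rbrakk> \<Longrightarrow>
      \<pi> (m + r - 1) (q + p) (pcomp Q m i r q p y z) = \<zero>\<^bsub>opobj P (m + r - 1) (q + p)\<^esub>"
  using mod_homD(3)[OF operad_homD(1)[OF \<pi>]] operad_homD(2-4,6)[OF \<pi>] z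
  by (simp_all add: P.opobj_zero_arith P.opdiff_zero P.act_zero P.pcomp_zero_left P.pcomp_zero_right)

text \<open>
  With \<open>q w\<close> the image of the natural number \<open>w\<close>, the map \<open>D r p None\<close> multiplies an operation
  by its weight, the number of generators it contains.
\<close>

definition weighted :: "(nat \<Rightarrow> 'k) \<Rightarrow> nat \<Rightarrow> int \<Rightarrow> 'c \<Rightarrow> bool" where
  "weighted q r p z \<longleftrightarrow> (\<exists>w. D r p None z = q w \<odot>\<^bsub>opobj Q r p\<^esub> z \<and>
    (if w = 0 then z \<in> \<iota> r p ` carrier (opobj P r p) else \<pi> r p z = \<zero>\<^bsub>opobj P r p\<^esub>))"

text \<open>At \<open>None\<close> the operator D is a derivation, so eigenvalues of composites add
  up. The alternative for \<open>w\<close> is inherited too: weight 0 forces both factors into the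
  image of \<open>P\<close>, and otherwise one of them lies in the kernel of \<open>\<pi>\<close>,
  which is an ideal.\<close>

lemma weighted_suboperad:
  assumes q0: "q 0 = \<zero>" and qc: "\<And>w. q w \<in> carrier R" and q_add: "\<And>v w. q (v + w) = q v \<oplus> q w"
  shows "suboperad R Q (lin_span Q (weighted q))"
proof (rule Q.lin_span_suboperad)
  have im: "weighted q r p z" if "z \<in> \<iota> r p ` carrier (opobj P r p)" for r p z
    unfolding weighted_def using that D_image[OF that] image_closed[OF that]
    by (intro exI[of _ 0]) (simp add: q0 module.smult_l_null[OF Q.opobj_module])
  show "weighted q r p \<zero>\<^bsub>opobj Q r p\<^esub>" for r p by (rule im[OF image_zero])
  show "weighted q 1 0 (op_unit Q)" by (rule im[OF image_unit])
  interpret cring R by (rule Q.R_cring)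
  show "weighted q r p (c \<odot>\<^bsub>opobj Q r p\<^esub> z)"
    if c: "c \<in> carrier R" and z: "z \<in> carrier (opobj Q r p)" and w: "weighted q r p z" for r p c z
  proof -
    from w obtain w where w: "D r p None z = q w \<odot>\<^bsub>opobj Q r p\<^esub> z"
      "if w = 0 then z \<in> \<iota> r p ` carrier (opobj P r p) else \<pi> r p z = \<zero>\<^bsub>opobj P r p\<^esub>"
      unfolding weighted_def by blast
    then show ?thesis unfolding weighted_def
      using c z qc mod_homD(3)[OF D_hom] image_smult \<pi>_zero(1)[OF z]
      by (intro exI[of _ w]) (auto simp: Q.opobj_smult Q.closures m_comm)
  qed
  show "weighted q r (p + 1) (opdiff Q r p z)"
    if z: "z \<in> carrier (opobj Q r p)" and w: "weighted q r p z" for r p z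
  proof -
    from w obtain w where w: "D r p None z = q w \<odot>\<^bsub>opobj Q r p\<^esub> z"
      "if w = 0 then z \<in> \<iota> r p ` carrier (opobj P r p) else \<pi> r p z = \<zero>\<^bsub>opobj P r p\<^esub>"
      unfolding weighted_def by blast
    then show ?thesis unfolding weighted_def
      using z qc D_opdiff[OF z] image_opdiff \<pi>_zero(2)[OF z]
      by (intro exI[of _ w]) (auto simp: Q.opdiff_simps(3))
  qed
  show "weighted q r p (sym_act Q r p \<sigma> z)"
    if s: "\<sigma> permutes {..<r}" and z: "z \<in> carrier (opobj Q r p)" and w: "weighted q r p z" for r p \<sigma> z
  proof -
    from w obtain w where w: "D r p None z = q w \<odot>\<^bsub>opobj Q r p\<^esub> z"
      "if w = 0 then z \<in> \<iota> r p ` carrier (opobj P r p) else \<pi> r p z = \<zero>\<^bsub>opobj P r p\<^esub>"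
      unfolding weighted_def by blast
    then show ?thesis unfolding weighted_def
      using s z qc D_act[OF s z, of None] image_act[OF _ s] \<pi>_zero(3)[OF z _ s]
      by (intro exI[of _ w]) (auto simp: Q.act_simps(3))
  qed
  show "weighted q (r + m - 1) (p + p') (pcomp Q r i m p p' x y)"
    if i: "i < r" and x: "x \<in> carrier (opobj Q r p)" and y: "y \<in> carrier (opobj Q m p')"
      and wx: "weighted q r p x" and wy: "weighted q m p' y" for r i m p p' x y
  proof -
    from wx obtain v where v: "D r p None x = q v \<odot>\<^bsub>opobj Q r p\<^esub> x"
      "if v = 0 then x \<in> \<iota> r p ` carrier (opobj P r p) else \<pi> r p x = \<zero>\<^bsub>opobj P r p\<^esub>"
      unfolding weighted_def by blast
    from wy obtain w where w: "D m p' None y = q w \<odot>\<^bsub>opobj Q m p'\<^esub> y"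
      "if w = 0 then y \<in> \<iota> m p' ` carrier (opobj P m p') else \<pi> m p' y = \<zero>\<^bsub>opobj P m p'\<^esub>"
      unfolding weighted_def by blast
    have "pcomp Q r i m p p' x y \<in> carrier (opobj Q (r + m - 1) (p + p'))"
      using i x y by (intro Q.closures) auto
    then have "D (r + m - 1) (p + p') None (pcomp Q r i m p p' x y) =
        q (v + w) \<odot>\<^bsub>opobj Q (r + m - 1) (p + p')\<^esub> pcomp Q r i m p p' x y"
      using D_pcomp[OF i x y, of None] i x y qc v(1) w(1)
      by (simp add: left_index_def right_index_def Q.pcomp_left_simps(3) Q.pcomp_right_simps(3) q_add
        Q.opobj_smult(2))
    moreover have "if v + w = 0
        then pcomp Q r i m p p' x y \<in> \<iota> (r + m - 1) (p + p') ` carrier (opobj P (r + m - 1) (p + p'))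
        else \<pi> (r + m - 1) (p + p') (pcomp Q r i m p p' x y) = \<zero>\<^bsub>opobj P (r + m - 1) (p + p')\<^esub>"
    proof (cases "v = 0 \<and> w = 0")
      case True
      then show ?thesis using v(2) w(2) image_pcomp[OF _ _ i] by simp
    next
      case False
      then show ?thesis
        using v(2) w(2) \<pi>_zero(4)[OF x _ y i] \<pi>_zero(5)[OF y _ x i] by (auto split: if_splits)
    qed
    ultimately show ?thesis unfolding weighted_def by blast
  qed
qed

text \<open>\<open>D r p (Some j)\<close> is the identity on operations with a generator on the path from the root to
  input \<open>j\<close>, and zero on those without.\<close>

definition detected :: "nat \<Rightarrow> int \<Rightarrow> 'c \<Rightarrow> bool" where
  "detected r p z \<longleftrightarrow> (\<forall>j. D r p (Some j) z = z \<or> D r p (Some j) z = \<zero>\<^bsub>opobj Q r p\<^esub>) \<and>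
    (z \<in> \<iota> r p ` carrier (opobj P r p) \<or>
      \<pi> r p z = \<zero>\<^bsub>opobj P r p\<^esub> \<and> (\<exists>j<r. D r p (Some j) z = z))"

text \<open>Plugging in a nullary operation can remove the only input that detects \<open>x\<close>;
  by \<open>arity0\<close> such a composite is zero. In all other cases an input that detects one
  factor lifts to an input that detects the composite.\<close>

lemma detected_suboperad:
  assumes arity0: "\<And>p z. z \<in> carrier (opobj Q 0 p) \<Longrightarrow> z = \<zero>\<^bsub>opobj Q 0 p\<^esub>"
  shows "suboperad R Q (lin_span Q detected)"
proof (rule Q.lin_span_suboperad)
  have im: "detected r p z" if "z \<in> \<iota> r p ` carrier (opobj P r p)" for r p z
    unfolding detected_def using that D_image[OF that] by blast
  show "detected r p \<zero>\<^bsub>opobj Q r p\<^esub>" for r p by (rule im[OF image_zero])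
  show "detected 1 0 (op_unit Q)" by (rule im[OF image_unit])
  show "detected r p (c \<odot>\<^bsub>opobj Q r p\<^esub> z)"
    if c: "c \<in> carrier R" and z: "z \<in> carrier (opobj Q r p)" and d: "detected r p z" for r p c z
  proof -
    have D: "D r p j (c \<odot>\<^bsub>opobj Q r p\<^esub> z) = c \<odot>\<^bsub>opobj Q r p\<^esub> D r p j z" for j
      by (rule mod_homD(3)[OF D_hom c z])
    show ?thesis
      using d c unfolding detected_def D
      by (metis image_smult Q.opobj_zero_arith(2) \<pi>_zero(1)[OF z])
  qed
  show "detected r (p + 1) (opdiff Q r p z)"
    if z: "z \<in> carrier (opobj Q r p)" and d: "detected r p z" for r p z
    using d unfolding detected_def D_opdiff[OF z]
    by (metis image_opdiff Q.opdiff_zero \<pi>_zero(2)[OF z])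
  show "detected r p (sym_act Q r p \<sigma> z)"
    if s: "\<sigma> permutes {..<r}" and z: "z \<in> carrier (opobj Q r p)" and d: "detected r p z" for r p \<sigma> z
  proof -
    have D: "D r p (Some j) (sym_act Q r p \<sigma> z) = sym_act Q r p \<sigma> (D r p (Some (\<sigma> j)) z)" for j
      using D_act[OF s z] by simp
    have "\<forall>j. D r p (Some j) (sym_act Q r p \<sigma> z) = sym_act Q r p \<sigma> z \<or>
        D r p (Some j) (sym_act Q r p \<sigma> z) = \<zero>\<^bsub>opobj Q r p\<^esub>"
      unfolding D using d Q.act_zero[OF s] unfolding detected_def by metis
    moreover have "\<exists>j<r. D r p (Some j) (sym_act Q r p \<sigma> z) = sym_act Q r p \<sigma> z"
      if "j < r" "D r p (Some j) z = z" for j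
    proof -
      \<comment> \<open>On the permuted operation D at an input acts through D at its image under
        \<open>\<sigma>\<close>, so the detecting input is the preimage of \<open>j\<close>.\<close>
      have "\<sigma> (inv_into UNIV \<sigma> j) = j" "inv_into UNIV \<sigma> j < r"
        using permutes_surj[OF s] permutes_in_image[OF s, of "inv_into UNIV \<sigma> j"] that(1)
        by (auto simp: surj_f_inv_f)
      then show ?thesis using that(2) D by metis
    qed
    ultimately show ?thesis
      using d image_act[OF _ s] \<pi>_zero(3)[OF z _ s] unfolding detected_def by metis
  qed
  show "detected (r + m - 1) (p + q) (pcomp Q r i m p q x y)"
    if i: "i < r" and x: "x \<in> carrier (opobj Q r p)" and y: "y \<in> carrier (opobj Q m q)"
      and dx: "detected r p x" and dy: "detected m q y" for r i m p q x y
  proof -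
    let ?N = "r + m - 1" and ?z = "pcomp Q r i m p q x y"
    have z: "?z \<in> carrier (opobj Q ?N (p + q))" using i x y by (intro Q.closures) auto
    \<comment> \<open>A vertex found in \<open>x\<close> makes 1 - D vanish on \<open>x\<close>, and
      the term involving \<open>y\<close> drops out.\<close>
    have D1: "D ?N (p + q) (Some j) ?z = ?z" if "D r p (left_index m i (Some j)) x = x" for j
    proof -
      have "x \<ominus>\<^bsub>opobj Q r p\<^esub> x = \<zero>\<^bsub>opobj Q r p\<^esub>" using x by (simp add: a_minus_def Q.opobj_arith)
      then show ?thesis using D_pcomp[OF i x y, of "Some j"] that z D_closed[OF y]
        by (simp add: Q.pcomp_zero_left[OF i] Q.opobj_arith)
    qed
    \<comment> \<open>With no vertex found in \<open>x\<close>, the search passes on to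
      \<open>y\<close>.\<close>
    have D0: "D ?N (p + q) (Some j) ?z = pcomp Q r i m p q x (D m q (right_index m i (Some j)) y)"
      if "D r p (left_index m i (Some j)) x = \<zero>\<^bsub>opobj Q r p\<^esub>" for j
    proof -
      have "x \<ominus>\<^bsub>opobj Q r p\<^esub> \<zero>\<^bsub>opobj Q r p\<^esub> = x"
        using x by (simp add: a_minus_def Q.opobj_arith Q.opobj_zero_arith)
      moreover have "pcomp Q r i m p q x (D m q (right_index m i (Some j)) y) \<in> carrier (opobj Q ?N (p + q))"
        using i x D_closed[OF y] by (intro Q.closures) auto
      ultimately show ?thesis using D_pcomp[OF i x y, of "Some j"] that
        by (simp add: Q.pcomp_zero_left[OF i y] Q.opobj_arith)
    qed
    have "D ?N (p + q) (Some j) ?z = ?z \<or> D ?N (p + q) (Some j) ?z = \<zero>\<^bsub>opobj Q ?N (p + q)\<^esub>" for j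
    proof -
      have "D r p (left_index m i (Some j)) x = x \<or> D r p (left_index m i (Some j)) x = \<zero>\<^bsub>opobj Q r p\<^esub>"
        using dx by (simp add: detected_def left_index_def)
      moreover have "D m q (right_index m i (Some j)) y = y \<or> D m q (right_index m i (Some j)) y = \<zero>\<^bsub>opobj Q m q\<^esub>"
        using dy by (simp add: detected_def right_index_def)
      ultimately show ?thesis using D1 D0 Q.pcomp_zero_right[OF i x] by metis
    qed
    moreover have "?z \<in> \<iota> ?N (p + q) ` carrier (opobj P ?N (p + q)) \<or>
      \<pi> ?N (p + q) ?z = \<zero>\<^bsub>opobj P ?N (p + q)\<^esub> \<and> (\<exists>j<?N. D ?N (p + q) (Some j) ?z = ?z)"
    proof -
      consider "m = 0" | "m > 0" "\<pi> r p x = \<zero>\<^bsub>opobj P r p\<^esub>" "\<exists>j<r. D r p (Some j) x = x"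
        | "m > 0" "\<pi> m q y = \<zero>\<^bsub>opobj P m q\<^esub>" "\<exists>j<m. D m q (Some j) y = y"
        | "x \<in> \<iota> r p ` carrier (opobj P r p)" "y \<in> \<iota> m q ` carrier (opobj P m q)"
        using dx dy unfolding detected_def by blast
      then show ?thesis
      proof cases
        case 1
        then have "?z = \<zero>\<^bsub>opobj Q ?N (p + q)\<^esub>"
          using arity0[of y q] y Q.pcomp_zero_right[OF i x, of m q] by simp
        then show ?thesis using image_zero by metis
      next
        case 2
        then obtain j where j: "j < r" "D r p (Some j) x = x" by blast
        \<comment> \<open>An input of the composite lying over input \<open>j\<close> of
          \<open>x\<close>. For \<open>j = i\<close> it is the first input of \<open>y\<close>,
          which exists because \<open>m > 0\<close>.\<close>
        define j' where "j' = (if j \<le> i then j else j + m - 1)"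
        have "left_index m i (Some j') = Some j" "j' < ?N"
          using j(1) i 2(1) by (auto simp: left_index_def j'_def)
        then show ?thesis using \<pi>_zero(4)[OF x 2(2) y i] D1[of j'] j(2) by metis
      next
        case 3
        then obtain j where j: "j < m" "D m q (Some j) y = y" by blast
        have l: "left_index m i (Some (i + j)) = Some i" "right_index m i (Some (i + j)) = Some j" "i + j < ?N"
          using j(1) i by (auto simp: left_index_def right_index_def)
        \<comment> \<open>The path to \<open>i + j\<close> enters \<open>y\<close> through input
          \<open>i\<close> of \<open>x\<close>: a vertex is met in \<open>x\<close> already, or else
          the one in \<open>y\<close> is.\<close>
        have "D r p (Some i) x = x \<or> D r p (Some i) x = \<zero>\<^bsub>opobj Q r p\<^esub>"
          using dx by (simp add: detected_def)
        then have "D ?N (p + q) (Some (i + j)) ?z = ?z"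
          using D1[of "i + j"] D0[of "i + j"] l j(2) by auto
        then show ?thesis using \<pi>_zero(5)[OF y 3(2) x i] l(3) by blast
      next
        case 4
        then show ?thesis using image_pcomp[OF _ _ i] by blast
      qed
    qed
    ultimately show ?thesis unfolding detected_def by blast
  qed
qed

end

text \<open>A composite of arity 0 has \<open>r = 1\<close> and \<open>m = 0\<close>, so its inner
  factor is already zero.\<close>

lemma zero_in_arity0_suboperad:
  assumes "operad R Q"
  shows "suboperad R Q (\<lambda>r p z. r = 0 \<longrightarrow> z = \<zero>\<^bsub>opobj Q 0 p\<^esub>)"
proof -
  interpret Q: operad R Q by fact
  have "pcomp Q r i m p q x y = \<zero>\<^bsub>opobj Q 0 (p + q)\<^esub>"
    if "x \<in> carrier (opobj Q r p)" "i < r" "m = 0 \<longrightarrow> y = \<zero>\<^bsub>opobj Q 0 q\<^esub>" "r + m - 1 = 0" for r i m p q x y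
  proof -
    have "m = 0" "r + m - 1 = 0" using that by auto
    then show ?thesis using Q.pcomp_zero_right[OF that(2,1), of m q] that(3) by simp
  qed
  then show ?thesis
    unfolding suboperad_def
    using Q.opdiff_zero[of 0] Q.act_zero[of _ 0] Q.opobj_zero_arith(2) Q.opobj_arith(1)[OF Q.zero_closed]
    by auto
qed

section \<open>The two cases of the theorem\<close>

context tracked_coproduct
begin

lemma \<kappa>_closed:
  assumes "x \<in> carrier (obj M p)"
  shows "\<kappa> p x \<in> carrier (opobj Q n p)"
proof (rule mod_homD(1)[OF _ assms])
  show "\<kappa> p \<in> mod_hom R (obj M p) (opobj Q n p)" using \<kappa>_map unfolding cochain_map_def by blast
qed

text \<open>An element is a finite sum of weights, so finitely many of the factors D - 1, D - 2, ...
  kill its part of positive weight. Weight 0 gets no factor, since that part is the image of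
  \<open>P\<close> and is removed by \<iota>\<pi>; thus only positive integers are inverted.\<close>

theorem inl_quasi_isomorphism_rational:
  assumes "contains_rationals R"
  shows "componentwise_quasi_isomorphism R P Q \<iota>"
proof -
  obtain \<pi> where \<pi>: "operad_hom R Q P \<pi>"
    "\<And>r p x. x \<in> carrier (opobj P r p) \<Longrightarrow> \<pi> r p (\<iota> r p x) = x"
    "\<And>p x. x \<in> carrier (obj M p) \<Longrightarrow> \<pi> n p (\<kappa> p x) = \<zero>\<^bsub>opobj P n p\<^esub>" by (rule retraction) (rule that)
  obtain \<Phi> where \<Phi>: "operad_hom R Q Q.TP \<Phi>"
    "\<And>r p z. z \<in> carrier (opobj Q r p) \<Longrightarrow> fst (\<Phi> r p z) = z"
    "\<And>r p x e j. x \<in> carrier (opobj P r p) \<Longrightarrow> snd (\<Phi> r p (\<iota> r p x)) e j = \<zero>\<^bsub>opobj Q r (p - of_bool e)\<^esub>"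
    "\<And>p x j. \<lbrakk>x \<in> carrier (obj M p); in_range n j\<rbrakk> \<Longrightarrow> snd (\<Phi> n p (\<kappa> p x)) False j = \<kappa> p x"
    by (rule tracking) (rule that)
  interpret T: tracked_retract R P Q \<iota> \<pi> \<Phi>
    using \<iota>_hom \<pi> \<Phi> by unfold_locales
  interpret cring R by (rule P.R_cring)
  obtain h where h: "h \<in> ring_hom \<lparr>carrier = (UNIV :: rat set), monoid.mult = (*), one = 1, zero = 0, add = (+)\<rparr> R"
    using assms unfolding contains_rationals_def by blast
  have hc: "h x \<in> carrier R" and hm: "h (x * y) = h x \<otimes> h y" and ha: "h (x + y) = h x \<oplus> h y"
    and h1: "h 1 = \<one>" for x y
    using ring_hom_closed[OF h, of x] ring_hom_mult[OF h, of x y] ring_hom_add[OF h, of x y] ring_hom_one[OF h]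
    by simp_all
  \<comment> \<open>Membership in \<open>ring_hom\<close> does not mention 0; the value follows from
    h 0 = h 0 + h 0.\<close>
  have h0: "h 0 = \<zero>" using ha[of 0 0] hc[of 0] by simp
  define q where "q w = h (of_nat w)" for w
  have q: "q 0 = \<zero>" "\<And>w. q w \<in> carrier R" "\<And>v w. q (v + w) = q v \<oplus> q w" "q 1 = \<one>"
    by (simp_all add: q_def h0 hc ha h1)
  have u: "q (Suc t) \<in> Units R" for t
  proof -
    have "h (of_nat (Suc t)) \<otimes> h (1 / of_nat (Suc t)) = \<one>" "h (1 / of_nat (Suc t)) \<otimes> h (of_nat (Suc t)) = \<one>"
      unfolding hm[symmetric] h1[symmetric] by (simp_all del: of_nat_Suc)
    then show ?thesis using hc unfolding Units_def q_def by blast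
  qed
  show ?thesis
  proof (rule T.quasi_isomorphism_of_eigenvectors[where J = "\<lambda>_. None" and c = "\<lambda>t. q (Suc t)" and K = "T.weighted q"])
    show "lin_span Q (T.weighted q) r p z" if "z \<in> carrier (opobj Q r p)" for r p z
    proof (rule coproduct_free_suboperad[OF P.operad_axioms T.weighted_suboperad[OF q(1-3)] _ _ that])
      show "lin_span Q (T.weighted q) r p (\<iota> r p x)" if "x \<in> carrier (opobj P r p)" for r p x
        using that operad_homD(2)[OF \<iota>_hom that] T.D_\<iota>[OF that]
        by (intro lin_span.base)
          (auto simp: T.weighted_def q(1) module.smult_l_null[OF Q.opobj_module] intro!: exI[of _ 0])
      show "lin_span Q (T.weighted q) n p (\<kappa> p x)" if "x \<in> carrier (obj M p)" for p x
      proof (rule lin_span.base)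
        show k: "\<kappa> p x \<in> carrier (opobj Q n p)" by (rule \<kappa>_closed[OF that])
        show "T.weighted q n p (\<kappa> p x)"
          unfolding T.weighted_def T.D_def using \<Phi>(4)[OF that, of None] \<pi>(3)[OF that] q(4) Q.opobj_arith(6)[OF k]
          by (intro exI[of _ 1]) (simp add: in_range_def)
      qed
    qed
    show "z \<in> \<iota> r p ` carrier (opobj P r p) \<or> \<pi> r p z = \<zero>\<^bsub>opobj P r p\<^esub> \<and>
        (\<forall>s. \<exists>\<mu>\<in>carrier R. T.D r p None z = \<mu> \<odot>\<^bsub>opobj Q r p\<^esub> z) \<and>
        (\<exists>t. T.D r p None z = q (Suc t) \<odot>\<^bsub>opobj Q r p\<^esub> z)"
      if "T.weighted q r p z" for r p z
      using that q(2) unfolding T.weighted_def by (metis not0_implies_Suc)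
  qed (rule u)
qed

text \<open>Along a path the eigenvalues are 0 and 1, so 1 is the only constant needed and no
  division occurs. The index runs through all naturals: an input that detects the operation kills
  it, and one beyond the arity only contributes the factor -1.\<close>

theorem inl_quasi_isomorphism_reduced:
  assumes P0: "\<And>p. carrier (opobj P 0 p) = {\<zero>\<^bsub>opobj P 0 p\<^esub>}" and n: "n > 0"
  shows "componentwise_quasi_isomorphism R P Q \<iota>"
proof -
  obtain \<pi> where \<pi>: "operad_hom R Q P \<pi>"
    "\<And>r p x. x \<in> carrier (opobj P r p) \<Longrightarrow> \<pi> r p (\<iota> r p x) = x"
    "\<And>p x. x \<in> carrier (obj M p) \<Longrightarrow> \<pi> n p (\<kappa> p x) = \<zero>\<^bsub>opobj P n p\<^esub>" by (rule retraction) (rule that)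
  obtain \<Phi> where \<Phi>: "operad_hom R Q Q.TP \<Phi>"
    "\<And>r p z. z \<in> carrier (opobj Q r p) \<Longrightarrow> fst (\<Phi> r p z) = z"
    "\<And>r p x e j. x \<in> carrier (opobj P r p) \<Longrightarrow> snd (\<Phi> r p (\<iota> r p x)) e j = \<zero>\<^bsub>opobj Q r (p - of_bool e)\<^esub>"
    "\<And>p x j. \<lbrakk>x \<in> carrier (obj M p); in_range n j\<rbrakk> \<Longrightarrow> snd (\<Phi> n p (\<kappa> p x)) False j = \<kappa> p x"
    by (rule tracking) (rule that)
  interpret T: tracked_retract R P Q \<iota> \<pi> \<Phi>
    using \<iota>_hom \<pi> \<Phi> by unfold_locales
  interpret cring R by (rule P.R_cring)
  \<comment> \<open>Nullary operations of the coproduct vanish because those of \<open>P\<close> do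
    and the new generators have \<open>n > 0\<close> inputs.\<close>
  have arity0: "z = \<zero>\<^bsub>opobj Q 0 p\<^esub>" if "z \<in> carrier (opobj Q 0 p)" for p z
  proof -
    have "\<iota> 0 p x = \<zero>\<^bsub>opobj Q 0 p\<^esub>" if "x \<in> carrier (opobj P 0 p)" for p x
      using that P0 mod_hom_zero[OF operad_homD(1)[OF \<iota>_hom] P.opobj_module Q.opobj_module] by simp
    then have "0 = (0::nat) \<longrightarrow> z = \<zero>\<^bsub>opobj Q 0 p\<^esub>"
      by (intro coproduct_free_suboperad[OF P.operad_axioms zero_in_arity0_suboperad[OF Q.operad_axioms] _ _ that])
        (use n in auto)
    then show ?thesis by simp
  qed
  show ?thesis
  proof (rule T.quasi_isomorphism_of_eigenvectors[where J = Some and c = "\<lambda>t. \<one>" and K = "T.detected"])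
    show "lin_span Q T.detected r p z" if "z \<in> carrier (opobj Q r p)" for r p z
    proof (rule coproduct_free_suboperad[OF P.operad_axioms T.detected_suboperad[OF arity0] _ _ that])
      show "lin_span Q T.detected r p (\<iota> r p x)" if "x \<in> carrier (opobj P r p)" for r p x
        using that operad_homD(2)[OF \<iota>_hom that] T.D_\<iota>[OF that]
        by (intro lin_span.base) (auto simp: T.detected_def)
      show "lin_span Q T.detected n p (\<kappa> p x)" if "x \<in> carrier (obj M p)" for p x
      proof (rule lin_span.base[OF \<kappa>_closed[OF that]])
        \<comment> \<open>A generator is detected at each of its inputs, and \<open>n > 0\<close>
          supplies one.\<close>
        have "T.D n p (Some j) (\<kappa> p x) = (if j < n then \<kappa> p x else \<zero>\<^bsub>opobj Q n p\<^esub>)" for j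
          using \<Phi>(4)[OF that, of "Some j"] T.D_out_of_range[OF \<kappa>_closed[OF that], of j]
          by (simp add: in_range_def T.D_def)
        then show "T.detected n p (\<kappa> p x)"
          unfolding T.detected_def using \<pi>(3)[OF that] n by auto
      qed
    qed
    show "z \<in> \<iota> r p ` carrier (opobj P r p) \<or> \<pi> r p z = \<zero>\<^bsub>opobj P r p\<^esub> \<and>
        (\<forall>s. \<exists>\<mu>\<in>carrier R. T.D r p (Some s) z = \<mu> \<odot>\<^bsub>opobj Q r p\<^esub> z) \<and>
        (\<exists>t. T.D r p (Some t) z = \<one> \<odot>\<^bsub>opobj Q r p\<^esub> z)"
      if z: "z \<in> carrier (opobj Q r p)" and d: "T.detected r p z" for r p z
    proof -
      have "\<one> \<odot>\<^bsub>opobj Q r p\<^esub> z = z" "\<zero> \<odot>\<^bsub>opobj Q r p\<^esub> z = \<zero>\<^bsub>opobj Q r p\<^esub>"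
        using z Q.opobj_arith(6) module.smult_l_null[OF Q.opobj_module] by auto
      then show ?thesis using d one_closed zero_closed unfolding T.detected_def by metis
    qed
  qed simp
qed

end

text \<open>In the cone of the identity, d(a, b) = (0, a) up to the sign of the shift, as the
  complex of the base ring has zero differential. Moving b into the first slot inverts this: dk
  gives (0, b) and kd gives (a, 0). The factor \<open>koszul_sign R s\<close> cancels the sign that
  the shift puts on d.\<close>

lemma contraction_shift_cone:
  assumes "cring R"
  shows "contraction R (shift R (cone (ring_complex R) (ring_complex R) (\<lambda>p x. x)) s)
    (\<lambda>p (a, b). (koszul_sign R s \<otimes>\<^bsub>R\<^esub> b, \<zero>\<^bsub>R\<^esub>))"
proof -
  interpret cring R by fact
  let ?C = "\<lambda>p. obj (ring_complex R) p"
  have C: "carrier (?C p) = (if p = 0 then carrier R else {\<zero>\<^bsub>R\<^esub>})" "zero (?C p) = \<zero>\<^bsub>R\<^esub>"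
    "add (?C p) = add R" "smult (?C p) = monoid.mult R" for p
    by (simp_all add: ring_complex_def ring_module_def)
  have neg: "\<ominus>\<^bsub>?C p\<^esub> \<zero>\<^bsub>R\<^esub> = \<zero>\<^bsub>R\<^esub>" for p
  proof -
    interpret M: module R "?C p" by (rule cochain_complex.obj_module[OF cochain_complex_ring_complex[OF assms]])
    show ?thesis using M.M.r_neg[OF M.M.zero_closed] M.M.l_zero[OF M.M.a_inv_closed[OF M.M.zero_closed]]
      unfolding C(2) by simp
  qed
  have s: "koszul_sign R s \<in> carrier R" by (rule koszul_sign_closed[OF assms])
  have ss: "koszul_sign R s \<otimes>\<^bsub>R\<^esub> (koszul_sign R s \<otimes>\<^bsub>R\<^esub> x) = x" if "x \<in> carrier R" for x
    using that s koszul_sign_mult[OF assms, of s s] by (simp add: m_assoc[symmetric]) (simp add: koszul_sign_def)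
  have d: "differential (ring_complex R) p x = \<zero>\<^bsub>R\<^esub>" for p x by (simp add: ring_complex_def)
  have sub: "x \<in> carrier (?C p) \<Longrightarrow> x \<in> carrier R" for x p by (auto simp: C split: if_splits)
  have sc: "x \<in> carrier (?C p) \<Longrightarrow> koszul_sign R s \<otimes>\<^bsub>R\<^esub> x \<in> carrier (?C p)" for x p
    using s by (auto simp: C split: if_splits)
  have e: "p - 1 + s + 1 = p + s" "p - 1 + s = p + s - 1" for p by auto
  show ?thesis
    unfolding contraction_def mod_hom_def shift_def cone_def prod_module_def
    using s sub sc
    by (auto simp: e C(2-4) d neg ss r_distr m_lcomm) (auto simp: C)
qed

theorem proposition3p1:
  fixes R :: "'k ring" and Op :: "('k, 'a) operad" and s :: int and n :: nat
  defines "M \<equiv> shift R (cone (ring_complex R) (ring_complex R) (\<lambda>p x. x)) s"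
  assumes "cring R"
    and "operad R Op"
    and "((\<forall>p. carrier (opobj Op 0 p) = {\<zero>\<^bsub>opobj Op 0 p\<^esub>}) \<and> n > 0) \<or> contains_rationals R"
  shows "componentwise_quasi_isomorphism R Op
           (operad_coproduct R Op (free_operad R M n))
           (coproduct_inl R Op (free_operad R M n))"
proof -
  interpret tracked_coproduct R Op M n "\<lambda>p (a, b). (koszul_sign R s \<otimes>\<^bsub>R\<^esub> b, \<zero>\<^bsub>R\<^esub>)"
    unfolding M_def tracked_coproduct_def tracked_coproduct_axioms_def
    using assms(2,3) cochain_complex_shift_cone_id contraction_shift_cone by blast
  show ?thesis
    using assms(4) inl_quasi_isomorphism_rational inl_quasi_isomorphism_reduced by blast
qed

end
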